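(* Let $\pi$ be a prior over $\Theta_1$ (a probability distribution on $\Theta_1$). For $t\ge 1$ and past observations $x_1,\dots,x_{t-1}$, let $W_{1,t}$ be the posterior distribution over $\Theta_1$ at time $t$, $$W_{1,t}(\theta) := \frac{\prod_{i=1}^{t-1} P_{\theta}(x_i)\, \pi(\theta)}{\int \prod_{i=1}^{t-1} P_{\theta}(x_i)\, \pi(\theta)\, \mathrm{d}\theta},$$ and let $$W_{0,t} := \operatorname*{argmin}_{W\in \mathcal{W}_0}\mathrm{KL}\left(\int P_{\theta}\, \mathrm{d}W_{1,t}(\theta),\int P_{\theta}\, \mathrm{d}W(\theta)\right).$$ Assume that $\mathrm{KL}(P_{\theta},P_{\theta'})<+\infty$ for all $\theta,\theta'\in\Theta_0\cup\Theta_1$. Then the Posterior Optimal E-value (POE) for $\pi$ exists and is given by the sequence $(E_t)_t$ with $$E_t(x^{:t}) = \prod_{i=1}^t \frac{\int P_{\theta}(x_i)\, \mathrm{d}W_{1,i}(\theta)}{\int P_{\theta}(x_i)\, \mathrm{d}W_{0,i}(\theta)}.$$ That is, $(E_t)$ is a test supermartingale for $\Theta_0$, and for every test supermartingale $(E_t')$ for $\Theta_0$, every stopping time $\tau$ and every $t$, $G_t(E_t,\pi,\tau)\ge G_t(E'_t,\pi,\tau)$.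
   Context: Let $\{P_\theta\}_{\theta\in\Theta}$ be a parametric family of distributions of one observation, with $P_\theta(x)$ also denoting the density (or mass) function with respect to a common reference measure, and let $\Theta_0,\Theta_1\subset\Theta$ be the parameter sets of the null and alternative hypotheses. Observations $X^1,X^2,\dots$ are i.i.d.; $X^{:t}=(X^1,\dots,X^t)$. $\mathcal{W}_0$ is the set of probability distributions (priors) on $\Theta_0$, and for a prior $W$, $P_W=\int P_\theta\,\mathrm{d}W(\theta)$. $\mathrm{KL}$ is the Kullback-Leibler divergence. In the posterior formula $\pi(\theta)\,\mathrm{d}\theta$ stands for integration against $\pi$; $W_{1,1}=\pi$. $W_{1,t}$ and $W_{0,t}$ depend on the past $x_1,\dots,x_{t-1}$. An e-variable for the null is a nonnegative (possibly infinite) function $E$ of the data with $\mathbb{E}_P[E]\le 1$ for every $P$ in the null hypothesis. A test supermartingale for $\Theta_0$ is a sequence of e-variables $E_t=E(X^{:t})$, $t\ge 0$ ($E_0$ a constant at most $1$), such that for every $t\geq 1$ and $\theta\in\Theta_0$, $\mathbb{E}_{X^{:t}\sim P_\theta^{\otimes t}}[E(X^{:t})\mid X^{:t-1}]\le E(X^{:t-1})$. The product formula for $E_t$ gives $E_0=1$ (empty product). For a stopping time $\tau$ (with respect to the filtration generated by the observations), $$G_t(E,\pi,\tau) := \mathbb{E}_{\theta\sim\pi}\left[\mathbb{E}_{X^{:t}\sim P_\theta^{\otimes t}}\left[\log\big(E(X^{:t\wedge\tau})\big)\,\mathbf{1}\{\theta\in\Theta_1\}\right]\right].$$ $(E_t)$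 is a Posterior Optimal E-value (POE) for $\pi$ if it is a test supermartingale and if for every test supermartingale $(E'_t)$ and every stopping time $\tau$: for all $t$, $G_t(E_t,\pi,\tau)\ge G_t(E'_t,\pi,\tau)$. Standing assumptions: for every $t$ and every past, $\int P_\theta\,\mathrm{d}W_{1,t}(\theta)$ has full support, the infimum of the KL divergence defining $W_{0,t}$ is finite, and it is attained by some $W_{0,t}\in\mathcal{W}_0$. *)

theory Defs
  imports "HOL-Probability.Probability"
begin

text \<open>
  Observations are indexed from 0: the point \<^term>\<open>\<omega> i\<close> is the observation of index \<open>i + 1\<close> in the
  usual 1-based numbering, and the first \<open>t\<close> observations form an element of the product over
  \<^term>\<open>{..<t}\<close>.  Consequently the weights attached below to a past of length \<open>t\<close> are the ones used
  to predict observation number \<open>t + 1\<close>.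
\<close>

definition first_obs :: "nat \<Rightarrow> (nat \<Rightarrow> 'x) \<Rightarrow> (nat \<Rightarrow> 'x)" where
  "first_obs t \<omega> = restrict \<omega> {..<t}"

text \<open>Time \<open>\<infinity>\<close> is included so that stopping times may be infinite.\<close>

definition obs_filtration :: "'x measure \<Rightarrow> enat \<Rightarrow> (nat \<Rightarrow> 'x) measure" where
  "obs_filtration M n =
     vimage_algebra (space (\<Pi>\<^sub>M i\<in>UNIV. M)) (\<lambda>\<omega>. restrict \<omega> {i. enat i < n}) (\<Pi>\<^sub>M i\<in>{i. enat i < n}. M)"

subsection \<open>Priors, mixtures and posteriors\<close>

definition priors :: "'p measure \<Rightarrow> 'p set \<Rightarrow> 'p measure set" where
  "priors T A = {W. prob_space W \<and> sets W = sets T \<and> (AE \<theta> in W. \<theta> \<in> A)}"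

definition mix_density :: "('p \<Rightarrow> 'x \<Rightarrow> real) \<Rightarrow> 'p measure \<Rightarrow> 'x \<Rightarrow> ennreal" where
  "mix_density p W x = (\<integral>\<^sup>+ \<theta>. ennreal (p \<theta> x) \<partial>W)"

definition mixture :: "'x measure \<Rightarrow> ('p \<Rightarrow> 'x \<Rightarrow> real) \<Rightarrow> 'p measure \<Rightarrow> 'x measure" where
  "mixture \<mu> p W = density \<mu> (mix_density p W)"

text \<open>If the normalising constant is \<open>0\<close> or \<open>\<infinity>\<close> this is the null measure.\<close>

definition posterior :: "('p \<Rightarrow> 'x \<Rightarrow> real) \<Rightarrow> 'p measure \<Rightarrow> nat \<Rightarrow> (nat \<Rightarrow> 'x) \<Rightarrow> 'p measure" where
  "posterior p \<pi> t xs =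
     density \<pi> (\<lambda>\<theta>. ennreal (\<Prod>i<t. p \<theta> (xs i)) / (\<integral>\<^sup>+ \<theta>'. ennreal (\<Prod>i<t. p \<theta>' (xs i)) \<partial>\<pi>))"

subsection \<open>Extended-real divergence and expectation\<close>

text \<open>
  The library's \<^term>\<open>KL_divergence\<close> is a real number (with the reference measure as first argument),
  so it cannot take the value \<open>\<infinity>\<close>.  For probability measures \<open>P \<lless> Q\<close> the negative part of the
  log-density is \<open>P\<close>-integrable, hence non-integrability means that the divergence is \<open>\<infinity>\<close>.
\<close>

definition KL :: "'x measure \<Rightarrow> 'x measure \<Rightarrow> ereal" where
  "KL P Q =
     (if absolutely_continuous Q P \<and> integrable P (entropy_density (exp 1) Q P)
      then ereal (KL_divergence (exp 1) Q P) else \<infinity>)"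

definition elog :: "ennreal \<Rightarrow> ereal" where
  "elog x = (if x = 0 then -\<infinity> else if x = \<infinity> then \<infinity> else ereal (ln (enn2real x)))"

text \<open>
  Positive part minus negative part.  In the undefined case \<open>\<infinity> - \<infinity>\<close> the value is \<open>\<infinity>\<close>, because
  \<^prop>\<open>\<infinity> - x = (\<infinity>::ereal)\<close>.
\<close>

definition eexpect :: "'a measure \<Rightarrow> ('a \<Rightarrow> ereal) \<Rightarrow> ereal" where
  "eexpect M f =
     enn2ereal (\<integral>\<^sup>+ x. e2ennreal (f x) \<partial>M) - enn2ereal (\<integral>\<^sup>+ x. e2ennreal (- f x) \<partial>M)"

subsection \<open>E-variables, test supermartingales and posterior optimality\<close>

definition e_variable :: "'a measure \<Rightarrow> 'a measure set \<Rightarrow> ('a \<Rightarrow> ennreal) \<Rightarrow> bool" where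
  "e_variable D H E \<longleftrightarrow> E \<in> borel_measurable D \<and> (\<forall>P\<in>H. (\<integral>\<^sup>+ x. E x \<partial>P) \<le> 1)"

text \<open>
  \<^term>\<open>E t\<close> is a function of the first \<open>t\<close> observations.  For \<open>t = 0\<close> the product space has a single
  point, so the e-variable condition says that the constant \<^term>\<open>E 0\<close> is at most 1.
\<close>

definition test_supermartingale ::
  "'x measure \<Rightarrow> ('p \<Rightarrow> 'x measure) \<Rightarrow> 'p set \<Rightarrow> (nat \<Rightarrow> (nat \<Rightarrow> 'x) \<Rightarrow> ennreal) \<Rightarrow> bool" where
  "test_supermartingale M P \<Theta>\<^sub>0 E \<longleftrightarrow>
     (\<forall>t. e_variable (\<Pi>\<^sub>M i\<in>{..<t}. M) ((\<lambda>\<theta>. \<Pi>\<^sub>M i\<in>{..<t}. P \<theta>) ` \<Theta>\<^sub>0) (E t)) \<and>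
     (\<forall>t. \<forall>\<theta>\<in>\<Theta>\<^sub>0. AE \<omega> in (\<Pi>\<^sub>M i\<in>UNIV. P \<theta>).
        nn_cond_exp (\<Pi>\<^sub>M i\<in>UNIV. P \<theta>) (obs_filtration M (enat t))
          (\<lambda>\<omega>'. E (Suc t) (first_obs (Suc t) \<omega>')) \<omega> \<le> E t (first_obs t \<omega>))"

definition stopped ::
  "(nat \<Rightarrow> (nat \<Rightarrow> 'x) \<Rightarrow> ennreal) \<Rightarrow> ((nat \<Rightarrow> 'x) \<Rightarrow> enat) \<Rightarrow> nat \<Rightarrow> (nat \<Rightarrow> 'x) \<Rightarrow> ennreal" where
  "stopped E \<tau> t \<omega> = (let n = the_enat (min (enat t) (\<tau> \<omega>)) in E n (first_obs n \<omega>))"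

definition growth ::
  "('p \<Rightarrow> 'x measure) \<Rightarrow> 'p set \<Rightarrow> nat \<Rightarrow> (nat \<Rightarrow> (nat \<Rightarrow> 'x) \<Rightarrow> ennreal) \<Rightarrow> 'p measure
     \<Rightarrow> ((nat \<Rightarrow> 'x) \<Rightarrow> enat) \<Rightarrow> ereal" where
  "growth P \<Theta>\<^sub>1 t E \<pi> \<tau> =
     eexpect \<pi> (\<lambda>\<theta>. eexpect (\<Pi>\<^sub>M i\<in>UNIV. P \<theta>) (\<lambda>\<omega>. elog (stopped E \<tau> t \<omega>) * indicator \<Theta>\<^sub>1 \<theta>))"

definition posterior_optimal_e_value ::
  "'x measure \<Rightarrow> ('p \<Rightarrow> 'x measure) \<Rightarrow> 'p set \<Rightarrow> 'p set \<Rightarrow> 'p measure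
     \<Rightarrow> (nat \<Rightarrow> (nat \<Rightarrow> 'x) \<Rightarrow> ennreal) \<Rightarrow> bool" where
  "posterior_optimal_e_value M P \<Theta>\<^sub>0 \<Theta>\<^sub>1 \<pi> E \<longleftrightarrow>
     test_supermartingale M P \<Theta>\<^sub>0 E \<and>
     (\<forall>E' \<tau>. test_supermartingale M P \<Theta>\<^sub>0 E' \<longrightarrow> stopping_time (obs_filtration M) \<tau> \<longrightarrow>
        (\<forall>t. growth P \<Theta>\<^sub>1 t E \<pi> \<tau> \<ge> growth P \<Theta>\<^sub>1 t E' \<pi> \<tau>))"

end

theory Submission
  imports Defs "HOL-Real_Asymp.Real_Asymp"
begin

text \<open>
  Fix a past, let \<open>q\<close> be the predictive density (the posterior mixture) and \<open>s\<close> the density of the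
  projection of \<open>q\<close> on the mixtures of the null.  Two dual facts about the ratio \<open>q / s\<close> carry the
  proof.

  Because \<open>s\<close> minimises the divergence over a convex set, moving from \<open>s\<close> a little towards a null
  density \<open>p \<theta>\<close> cannot decrease the divergence.  The derivative of the divergence in that direction
  is \<open>1 - \<integral> p \<theta> * (q / s)\<close>, so \<open>\<integral> p \<theta> * (q / s) \<le> 1\<close>: each factor of the product has conditional
  expectation at most 1 under the null, and the product \<open>E\<close> is a test supermartingale
  (\<open>reverse_projection_ratio_le_one\<close>, \<open>test_supermartingale_E\<close>).

  Conversely let \<open>E'\<close> be any test supermartingale.  Under the Bayesian mixture, where the next
  observation has density \<open>q\<close>, the ratio \<open>E' / E\<close> is a supermartingale: multiplying by \<open>q\<close> and dividing
  by \<open>q / s\<close> leaves \<open>s\<close>, and \<open>s\<close> is a mixture of null densities, under each of which \<open>E'\<close> does not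
  grow on average.  Stopping preserves this, so the stopped ratio has Bayesian mean at most 1
  (\<open>mean_stopped_ratio_le_one\<close>), and \<open>ln r \<le> r - 1\<close> turns the bound into the comparison of expected
  logarithms (\<open>growth_le\<close>).

  Two points need care.  First, the supermartingale property of \<open>E'\<close> is an almost sure statement for
  each null parameter separately, with an exceptional set of pasts that depends on the parameter,
  whereas the projection at a given past may be concentrated on a single parameter that varies with
  the past.  Joint measurability of the densities helps: it makes the family separable in \<open>L\<^sup>1\<close>
  (\<open>countable_L1_dense\<close>), and an inequality for countably many dense parameters extends to all of them
  (\<open>nn_integral_le_of_dense\<close>, \<open>supermartingale_constraint\<close>).  The finiteness of the pairwise divergences
  makes all the distributions involved equivalent to the reference measure, so that null sets agree.

  Second, the growth is an iterated expectation of a function that may fail to be integrable.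
  Comparing with the constant supermartingale 1 shows that the negative part of the logarithm of the
  stopped \<open>E\<close> always has mean at most 1.  Hence either the positive part has infinite mean and the growth of \<open>E\<close> is infinite,
  or all the positive parts in question are integrable, the iterated expectations are differences of
  means of positive and negative parts, and these can be compared.
\<close>

section \<open>Reverse information projection\<close>

lemma ennreal_mult_divide_cancel:
  fixes a b :: ennreal
  assumes "0 < a" "a \<noteq> \<infinity>"
  shows "a * (b / a) = b"
  using assms by (simp add: ennreal_times_divide ennreal_mult_divide_eq mult.commute[of a])

text \<open>
  Uniqueness of the Radon-Nikodym derivative, applied to the ratio of the densities.
\<close>

lemma entropy_density_density:
  assumes \<mu>: "sigma_finite_measure \<mu>"
    and [measurable]: "q \<in> borel_measurable \<mu>" "s \<in> borel_measurable \<mu>"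
    and s1: "(\<integral>\<^sup>+ x. s x \<partial>\<mu>) = 1" and pos: "AE x in \<mu>. 0 < s x"
  shows "AE x in \<mu>. entropy_density (exp 1) (density \<mu> s) (density \<mu> q) x = ln (enn2real (q x / s x))"
proof -
  interpret S: prob_space "density \<mu> s"
    by (rule prob_spaceI) (simp add: emeasure_density s1 cong: nn_integral_cong)
  have fin: "AE x in \<mu>. s x \<noteq> \<infinity>"
    using s1 by (intro nn_integral_noteq_infinite) auto
  have "density (density \<mu> s) (\<lambda>x. q x / s x) = density \<mu> (\<lambda>x. s x * (q x / s x))"
    by (subst density_density_eq) auto
  also have "\<dots> = density \<mu> q"
  proof (rule density_cong)
    show "AE x in \<mu>. s x * (q x / s x) = q x"
      using pos fin by eventually_elim (simp add: ennreal_mult_divide_cancel)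
  qed auto
  finally have "AE x in density \<mu> s. q x / s x = RN_deriv (density \<mu> s) (density \<mu> q) x"
    by (intro S.RN_deriv_unique) auto
  then have "AE x in \<mu>. 0 < s x \<longrightarrow> q x / s x = RN_deriv (density \<mu> s) (density \<mu> q) x"
    by (subst (asm) AE_density) auto
  then show ?thesis
    using pos by eventually_elim (simp add: entropy_density_def log_def)
qed

lemma AE_density_pos_iff:
  assumes [measurable]: "q \<in> borel_measurable \<mu>" and "\<And>x. x \<in> space \<mu> \<Longrightarrow> 0 < q x"
  shows "(AE x in density \<mu> q. A x) \<longleftrightarrow> (AE x in \<mu>. A x)"
  using assms by (subst AE_density) (auto intro!: AE_cong)

text \<open>
  Because \<open>q\<close> is positive everywhere, absolute continuity amounts to positivity of \<open>s\<close>, and almost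
  sure statements under \<open>q\<close> and under \<open>\<mu>\<close> agree.
\<close>

lemma KL_density_finite_iff:
  assumes \<mu>: "sigma_finite_measure \<mu>"
    and [measurable]: "q \<in> borel_measurable \<mu>" "s \<in> borel_measurable \<mu>"
    and q: "\<And>x. x \<in> space \<mu> \<Longrightarrow> 0 < q x" and s1: "(\<integral>\<^sup>+ x. s x \<partial>\<mu>) = 1"
  shows "KL (density \<mu> q) (density \<mu> s) < \<infinity> \<longleftrightarrow>
     (AE x in \<mu>. 0 < s x) \<and> integrable (density \<mu> q) (\<lambda>x. ln (enn2real (q x / s x)))" (is "?K < _ \<longleftrightarrow> ?pos \<and> ?int")
    and "KL (density \<mu> q) (density \<mu> s) < \<infinity> \<Longrightarrow>
     KL (density \<mu> q) (density \<mu> s) = ereal (\<integral>x. ln (enn2real (q x / s x)) \<partial>density \<mu> q)"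
proof -
  have ac: "absolutely_continuous (density \<mu> s) (density \<mu> q) \<longleftrightarrow> ?pos"
  proof
    assume *: "absolutely_continuous (density \<mu> s) (density \<mu> q)"
    have "{x\<in>space \<mu>. s x = 0} \<in> null_sets (density \<mu> s)"
      by (subst null_sets_density_iff) auto
    then have "{x\<in>space \<mu>. s x = 0} \<in> null_sets (density \<mu> q)"
      using * by (auto simp: absolutely_continuous_def)
    then have "AE x in \<mu>. x \<in> {x\<in>space \<mu>. s x = 0} \<longrightarrow> q x = 0"
      by (subst (asm) null_sets_density_iff) auto
    then show ?pos
      using AE_space by eventually_elim (use q in \<open>fastforce simp: zero_less_iff_neq_zero\<close>)
  next
    assume ?pos
    show "absolutely_continuous (density \<mu> s) (density \<mu> q)"
      unfolding absolutely_continuous_def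
    proof
      fix N assume "N \<in> null_sets (density \<mu> s)"
      then have N: "N \<in> sets \<mu>" "AE x in \<mu>. x \<in> N \<longrightarrow> s x = 0"
        by (auto simp: null_sets_density_iff)
      have "AE x in \<mu>. x \<in> N \<longrightarrow> q x = 0"
        using N(2) \<open>?pos\<close> by eventually_elim auto
      then show "N \<in> null_sets (density \<mu> q)"
        using N(1) by (simp add: null_sets_density_iff)
    qed
  qed
  have eq: "AE x in density \<mu> q. entropy_density (exp 1) (density \<mu> s) (density \<mu> q) x = ln (enn2real (q x / s x))" if ?pos
    using entropy_density_density[OF \<mu> _ _ s1 that, of q] by (simp add: AE_density_pos_iff q)
  have [measurable]: "entropy_density (exp 1) (density \<mu> s) (density \<mu> q) \<in> borel_measurable \<mu>"
  proof -
    have "RN_deriv (density \<mu> s) (density \<mu> q) \<in> borel_measurable (density \<mu> s)" by simp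
    then show ?thesis unfolding entropy_density_def by (auto simp: comp_def)
  qed
  have int: "integrable (density \<mu> q) (entropy_density (exp 1) (density \<mu> s) (density \<mu> q)) \<longleftrightarrow> ?int" if ?pos
    using eq[OF that] by (intro integrable_cong_AE) auto
  show iff: "?K < \<infinity> \<longleftrightarrow> ?pos \<and> ?int"
    using ac int by (auto simp: KL_def)
  assume "?K < \<infinity>"
  with iff have p: ?pos and i: ?int by auto
  have "KL_divergence (exp 1) (density \<mu> s) (density \<mu> q) = (\<integral>x. ln (enn2real (q x / s x)) \<partial>density \<mu> q)"
    unfolding KL_divergence_def using eq[OF p] by (intro integral_cong_AE) auto
  then show "?K = ereal (\<integral>x. ln (enn2real (q x / s x)) \<partial>density \<mu> q)"
    using ac int[OF p] p i by (simp add: KL_def)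
qed

text \<open>
  First-order optimality of the projection.  With \<open>u = r / s\<close>, the hypothesis for the perturbation of
  weight \<open>a\<close> says that \<open>ln (1 - a + a * u)\<close> has nonpositive mean under \<open>q\<close>.  Dividing by \<open>a\<close> and letting
  \<open>a\<close> tend to 0 gives mean at most 0 for \<open>u - 1\<close>; since \<open>ln (1 - a)\<close> bounds the logarithm from below,
  Fatou's lemma justifies the limit without any domination.
\<close>

lemma reverse_projection_ratio_le_one:
  assumes \<mu>: "sigma_finite_measure \<mu>"
    and [measurable]: "q \<in> borel_measurable \<mu>" "s \<in> borel_measurable \<mu>" "r \<in> borel_measurable \<mu>"
    and q: "\<And>x. x \<in> space \<mu> \<Longrightarrow> 0 < q x"
    and q1: "(\<integral>\<^sup>+ x. q x \<partial>\<mu>) = 1" and s1: "(\<integral>\<^sup>+ x. s x \<partial>\<mu>) = 1" and r1: "(\<integral>\<^sup>+ x. r x \<partial>\<mu>) = 1"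
    and fin: "KL (density \<mu> q) (density \<mu> s) < \<infinity>"
    and opt: "\<And>a::real. 0 < a \<Longrightarrow> a < 1 \<Longrightarrow> KL (density \<mu> q) (density \<mu> s)
               \<le> KL (density \<mu> q) (density \<mu> (\<lambda>x. ennreal (1 - a) * s x + ennreal a * r x))"
  shows "(\<integral>\<^sup>+ x. r x * (q x / s x) \<partial>\<mu>) \<le> 1"
proof -
  define Q where "Q = density \<mu> q"
  have setsQ[measurable_cong]: "sets Q = sets \<mu>" by (simp add: Q_def)
  interpret Q: prob_space Q
    unfolding Q_def by (rule prob_spaceI) (simp add: emeasure_density q1 cong: nn_integral_cong)
  have pos: "AE x in \<mu>. 0 < s x"
    and L: "integrable Q (\<lambda>x. ln (enn2real (q x / s x)))"
    and KLs: "KL Q (density \<mu> s) = ereal (\<integral>x. ln (enn2real (q x / s x)) \<partial>Q)"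
    using KL_density_finite_iff[OF \<mu> _ _ q s1] fin by (auto simp: Q_def)
  have finite: "AE x in \<mu>. q x \<noteq> \<infinity> \<and> s x \<noteq> \<infinity> \<and> r x \<noteq> \<infinity>"
    using q1 s1 r1 by (intro AE_conjI nn_integral_noteq_infinite) auto
  define u where "u x = enn2real (r x / s x)" for x
  have [measurable]: "u \<in> borel_measurable \<mu>" unfolding u_def by measurable
  have u0: "0 \<le> u x" for x by (simp add: u_def)
  have good: "AE x in \<mu>. \<exists>a b c. 0 < a \<and> 0 < b \<and> 0 \<le> c \<and> q x = ennreal a \<and> s x = ennreal b \<and> r x = ennreal c \<and> u x = c / b"
    using pos finite AE_space
  proof eventually_elim
    fix x assume *: "0 < s x" "q x \<noteq> \<infinity> \<and> s x \<noteq> \<infinity> \<and> r x \<noteq> \<infinity>" "x \<in> space \<mu>"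
    obtain a b c where "q x = ennreal a" "0 \<le> a" "s x = ennreal b" "0 \<le> b" "r x = ennreal c" "0 \<le> c"
      using *(2) by (cases "q x"; cases "s x"; cases "r x") auto
    with * q[OF *(3)] show "\<exists>a b c. 0 < a \<and> 0 < b \<and> 0 \<le> c \<and> q x = ennreal a \<and> s x = ennreal b \<and> r x = ennreal c \<and> u x = c / b"
      by (intro exI[of _ a] exI[of _ b] exI[of _ c]) (auto simp: u_def divide_ennreal)
  qed
  have goodQ: "AE x in Q. \<exists>a b c. 0 < a \<and> 0 < b \<and> 0 \<le> c \<and> q x = ennreal a \<and> s x = ennreal b \<and> r x = ennreal c \<and> u x = c / b"
    unfolding Q_def by (rule AE_density_pos_iff[THEN iffD2, OF _ _ good]) (auto intro: q)
  have bound: "(\<integral>\<^sup>+x. ennreal ((real n + 2) * ln (1 + u x / (real n + 1))) \<partial>Q) \<le> ennreal ((real n + 2) * - ln (1 - 1 / (real n + 2)))"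
    for n :: nat
  proof -
    (* With this weight a / (1 - a) = 1 / (n + 1), so the mixture factors as
       (1 - a) * s * (1 + u / (n + 1)). *)
    define a :: real where "a = 1 / (real n + 2)"
    have a: "0 < a" "a < 1" by (auto simp: a_def)
    define s' where "s' x = ennreal (1 - a) * s x + ennreal a * r x" for x
    have [measurable]: "s' \<in> borel_measurable \<mu>" unfolding s'_def by measurable
    have s'1: "(\<integral>\<^sup>+ x. s' x \<partial>\<mu>) = 1"
      unfolding s'_def using a
      by (subst nn_integral_add) (auto simp: nn_integral_cmult s1 r1 simp flip: ennreal_plus)
    have s'pos: "AE x in \<mu>. 0 < s' x"
      using pos by eventually_elim (use a in \<open>auto simp: s'_def add_pos_nonneg ennreal_zero_less_mult_iff\<close>)
    have ratio: "AE x in Q. ln (enn2real (q x / s' x)) = ln (enn2real (q x / s x)) - ln (1 + u x / (real n + 1)) - ln (1 - a)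
        \<and> 1 - enn2real (s' x / q x) \<le> ln (enn2real (q x / s' x)) \<and> s' x / q x = ennreal (enn2real (s' x / q x))"
      using goodQ
    proof eventually_elim
      fix x assume "\<exists>a b c. 0 < a \<and> 0 < b \<and> 0 \<le> c \<and> q x = ennreal a \<and> s x = ennreal b \<and> r x = ennreal c \<and> u x = c / b"
      then obtain k b c where k: "0 < k" "0 < b" "0 \<le> c" "q x = ennreal k" "s x = ennreal b" "r x = ennreal c" "u x = c / b"
        by blast
      define z where "z = (1 - a) * b + a * c"
      have z: "0 < z" "s' x = ennreal z"
        using a k by (auto simp: z_def s'_def ennreal_mult' add_pos_nonneg)
      have z': "z = b * (1 - a) * (1 + u x / (real n + 1))"
      proof -
        have "1 - a = a * (real n + 1)" by (simp add: a_def field_simps)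
        then have "a = (1 - a) / (real n + 1)" by (simp add: field_simps)
        then have "z = (1 - a) * b + (1 - a) / (real n + 1) * c" unfolding z_def by metis
        then show ?thesis using k by (simp add: field_simps)
      qed
      have u1: "0 < 1 + u x / (real n + 1)" using u0[of x] by (intro add_pos_nonneg) auto
      have 1: "q x / s' x = ennreal (k / z)" "q x / s x = ennreal (k / b)" "s' x / q x = ennreal (z / k)"
        using k z by (auto simp: divide_ennreal)
      have "ln (k / z) = ln (k / b) - ln (1 + u x / (real n + 1)) - ln (1 - a)"
        unfolding z' using k a u1 by (simp add: ln_mult ln_div)
      moreover have "1 - z / k \<le> ln (k / z)"
        using ln_le_minus_one[of "z / k"] k z by (simp add: ln_div)
      ultimately show "ln (enn2real (q x / s' x)) = ln (enn2real (q x / s x)) - ln (1 + u x / (real n + 1)) - ln (1 - a)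
        \<and> 1 - enn2real (s' x / q x) \<le> ln (enn2real (q x / s' x)) \<and> s' x / q x = ennreal (enn2real (s' x / q x))"
        unfolding 1 using k z by simp
    qed
    (* The lower bound ln (q / s') \<ge> 1 - s' / q is integrable because s' / q has mean 1 under q; together
       with the upper bound by the log-ratio of s it makes the divergence from s' finite. *)
    have int_inv: "integrable Q (\<lambda>x. enn2real (s' x / q x))"
    proof (rule integrableI_bounded)
      have "(\<integral>\<^sup>+ x. ennreal (norm (enn2real (s' x / q x))) \<partial>Q) = (\<integral>\<^sup>+ x. s' x / q x \<partial>Q)"
        using ratio by (intro nn_integral_cong_AE) auto
      also have "\<dots> = (\<integral>\<^sup>+ x. q x * (s' x / q x) \<partial>\<mu>)"
        unfolding Q_def by (subst nn_integral_density) auto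
      also have "\<dots> = (\<integral>\<^sup>+ x. s' x \<partial>\<mu>)"
        using finite AE_space
        by (intro nn_integral_cong_AE, eventually_elim)
           (use q in \<open>simp add: ennreal_mult_divide_cancel\<close>)
      finally show "(\<integral>\<^sup>+ x. ennreal (norm (enn2real (s' x / q x))) \<partial>Q) < \<infinity>" using s'1 by simp
    qed measurable
    have int': "integrable Q (\<lambda>x. ln (enn2real (q x / s' x)))"
    proof (rule Bochner_Integration.integrable_bound)
      show "integrable Q (\<lambda>x. \<bar>ln (enn2real (q x / s x))\<bar> + \<bar>ln (1 - a)\<bar> + (1 + enn2real (s' x / q x)))"
        using L int_inv by auto
      show "AE x in Q. norm (ln (enn2real (q x / s' x))) \<le> norm (\<bar>ln (enn2real (q x / s x))\<bar> + \<bar>ln (1 - a)\<bar> + (1 + enn2real (s' x / q x)))"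
        using ratio
      proof eventually_elim
        fix x assume *: "ln (enn2real (q x / s' x)) = ln (enn2real (q x / s x)) - ln (1 + u x / (real n + 1)) - ln (1 - a)
        \<and> 1 - enn2real (s' x / q x) \<le> ln (enn2real (q x / s' x)) \<and> s' x / q x = ennreal (enn2real (s' x / q x))"
        have "0 \<le> ln (1 + u x / (real n + 1))" "0 \<le> enn2real (s' x / q x)" using u0[of x] by auto
        with * show "norm (ln (enn2real (q x / s' x))) \<le> norm (\<bar>ln (enn2real (q x / s x))\<bar> + \<bar>ln (1 - a)\<bar> + (1 + enn2real (s' x / q x)))"
          unfolding real_norm_def by linarith
      qed
    qed measurable
    have int_u: "integrable Q (\<lambda>x. ln (1 + u x / (real n + 1)))"
    proof (rule integrable_cong_AE_imp)
      show "integrable Q (\<lambda>x. ln (enn2real (q x / s x)) - ln (enn2real (q x / s' x)) - ln (1 - a))"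
        using L int' by auto
      show "AE x in Q. ln (enn2real (q x / s x)) - ln (enn2real (q x / s' x)) - ln (1 - a) = ln (1 + u x / (real n + 1))"
        using ratio by eventually_elim auto
    qed measurable
    have KL': "KL Q (density \<mu> s') = ereal (\<integral>x. ln (enn2real (q x / s' x)) \<partial>Q)"
      unfolding Q_def using int' s'pos KL_density_finite_iff[OF \<mu> _ _ q s'1] by (auto simp: Q_def)
    have "(\<integral>x. ln (enn2real (q x / s x)) \<partial>Q) \<le> (\<integral>x. ln (enn2real (q x / s' x)) \<partial>Q)"
      using opt[OF a] KL' KLs by (simp add: s'_def[abs_def] Q_def)
    also have "\<dots> = (\<integral>x. ln (enn2real (q x / s x)) - ln (1 + u x / (real n + 1)) - ln (1 - a) \<partial>Q)"
      using ratio by (intro integral_cong_AE) auto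
    also have "\<dots> = (\<integral>x. ln (enn2real (q x / s x)) \<partial>Q) - (\<integral>x. ln (1 + u x / (real n + 1)) \<partial>Q) - ln (1 - a)"
      using L int_u by (simp add: Q.prob_space)
    finally have le: "(\<integral>x. ln (1 + u x / (real n + 1)) \<partial>Q) \<le> - ln (1 - a)" by simp
    have "(\<integral>\<^sup>+x. ennreal ((real n + 2) * ln (1 + u x / (real n + 1))) \<partial>Q) = ennreal (\<integral>x. (real n + 2) * ln (1 + u x / (real n + 1)) \<partial>Q)"
      using int_u u0 by (intro nn_integral_eq_integral) (auto intro!: AE_I2 mult_nonneg_nonneg)
    also have "\<dots> \<le> ennreal ((real n + 2) * - ln (1 - 1 / (real n + 2)))"
      using mult_left_mono[OF le, of "real n + 2"] by (intro ennreal_leI) (simp add: a_def)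
    finally show ?thesis .
  qed
  (* u is the limit of (n + 2) * ln (1 + u / (n + 1)), and the bounds on the means tend to 1. *)
  have "(\<integral>\<^sup>+ x. r x * (q x / s x) \<partial>\<mu>) = (\<integral>\<^sup>+ x. q x * ennreal (u x) \<partial>\<mu>)"
    using good
  proof (intro nn_integral_cong_AE, eventually_elim)
    fix x assume "\<exists>a b c. 0 < a \<and> 0 < b \<and> 0 \<le> c \<and> q x = ennreal a \<and> s x = ennreal b \<and> r x = ennreal c \<and> u x = c / b"
    then show "r x * (q x / s x) = q x * ennreal (u x)"
      by (auto simp: divide_ennreal mult.commute simp flip: ennreal_mult)
  qed
  also have "\<dots> = (\<integral>\<^sup>+ x. ennreal (u x) \<partial>Q)"
    unfolding Q_def by (subst nn_integral_density) auto
  also have "\<dots> = (\<integral>\<^sup>+ x. liminf (\<lambda>n. ennreal ((real n + 2) * ln (1 + u x / (real n + 1)))) \<partial>Q)"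
  proof (intro nn_integral_cong)
    fix x
    have "(\<lambda>n. (real n + 2) * ln (1 + u x / (real n + 1))) \<longlonglongrightarrow> u x"
    proof (cases "u x = 0")
      case False
      then have "u x > 0" using u0[of x] by simp
      then show ?thesis by real_asymp
    qed simp
    then show "ennreal (u x) = liminf (\<lambda>n. ennreal ((real n + 2) * ln (1 + u x / (real n + 1))))"
      using lim_imp_Liminf[OF trivial_limit_sequentially tendsto_ennrealI] by metis
  qed
  also have "\<dots> \<le> liminf (\<lambda>n. \<integral>\<^sup>+ x. ennreal ((real n + 2) * ln (1 + u x / (real n + 1))) \<partial>Q)"
    by (intro nn_integral_liminf) auto
  also have "\<dots> \<le> liminf (\<lambda>n. ennreal ((real n + 2) * - ln (1 - 1 / (real n + 2))))"
    using bound by (intro Liminf_mono) (auto intro!: always_eventually)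
  also have "\<dots> = ennreal 1"
  proof -
    have "(\<lambda>n. (real n + 2) * - ln (1 - 1 / (real n + 2))) \<longlonglongrightarrow> 1" by real_asymp
    then show ?thesis
      by (intro lim_imp_Liminf tendsto_ennrealI) auto
  qed
  finally show ?thesis by simp
qed

section \<open>Separability of jointly measurable families of densities\<close>

text \<open>
  Separability of the family \<open>f\<close> in \<open>L\<^sup>1\<close>, expressed by countable partitions of the parameter set into
  pieces of small diameter, where \<open>k \<theta>\<close> is the index of the piece of \<open>\<theta>\<close>.  In contrast to countable
  dense sets, such partitions combine under sums and limits without choosing approximants.
\<close>

definition small_fibres :: "'x measure \<Rightarrow> 'p set \<Rightarrow> ('p \<Rightarrow> 'x \<Rightarrow> real) \<Rightarrow> bool" where
  "small_fibres \<nu> S f \<longleftrightarrow>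
     (\<forall>e>0. \<exists>k :: 'p \<Rightarrow> nat. \<forall>\<theta>\<in>S. \<forall>\<theta>'\<in>S. k \<theta> = k \<theta>' \<longrightarrow>
        (\<integral>\<^sup>+ x. ennreal \<bar>f \<theta> x - f \<theta>' x\<bar> \<partial>\<nu>) \<le> ennreal e)"

lemma small_fibresE:
  assumes "small_fibres \<nu> S f" "0 < e"
  obtains k :: "'p \<Rightarrow> nat" where "\<And>\<theta> \<theta>'. \<theta> \<in> S \<Longrightarrow> \<theta>' \<in> S \<Longrightarrow> k \<theta> = k \<theta>' \<Longrightarrow>
        (\<integral>\<^sup>+ x. ennreal \<bar>f \<theta> x - f \<theta>' x\<bar> \<partial>\<nu>) \<le> ennreal e"
  using assms unfolding small_fibres_def by metis

lemma small_fibres_same_distances: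
  assumes f: "small_fibres \<nu> S f"
    and eq: "\<And>\<theta> \<theta>'. \<theta> \<in> S \<Longrightarrow> \<theta>' \<in> S \<Longrightarrow>
      (\<integral>\<^sup>+ x. ennreal \<bar>g \<theta> x - g \<theta>' x\<bar> \<partial>\<nu>) = (\<integral>\<^sup>+ x. ennreal \<bar>f \<theta> x - f \<theta>' x\<bar> \<partial>\<nu>)"
  shows "small_fibres \<nu> S g"
  unfolding small_fibres_def
proof (intro allI impI)
  fix e :: real assume "0 < e"
  from small_fibresE[OF f this] obtain k :: "'b \<Rightarrow> nat" where "\<And>\<theta> \<theta>'. \<theta> \<in> S \<Longrightarrow> \<theta>' \<in> S \<Longrightarrow> k \<theta> = k \<theta>' \<Longrightarrow>
        (\<integral>\<^sup>+ x. ennreal \<bar>f \<theta> x - f \<theta>' x\<bar> \<partial>\<nu>) \<le> ennreal e" by blast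
  then show "\<exists>k :: 'b \<Rightarrow> nat. \<forall>\<theta>\<in>S. \<forall>\<theta>'\<in>S. k \<theta> = k \<theta>' \<longrightarrow>
      (\<integral>\<^sup>+ x. ennreal \<bar>g \<theta> x - g \<theta>' x\<bar> \<partial>\<nu>) \<le> ennreal e"
    by (intro exI[of _ k]) (simp add: eq)
qed

lemma small_fibres_add:
  assumes f: "small_fibres \<nu> S f" and g: "small_fibres \<nu> S g"
    and mf: "\<And>\<theta>. \<theta> \<in> S \<Longrightarrow> f \<theta> \<in> borel_measurable \<nu>" and mg: "\<And>\<theta>. \<theta> \<in> S \<Longrightarrow> g \<theta> \<in> borel_measurable \<nu>"
  shows "small_fibres \<nu> S (\<lambda>\<theta> x. f \<theta> x + g \<theta> x)"
  unfolding small_fibres_def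
proof (intro allI impI)
  fix e :: real assume "0 < e"
  then have e: "0 < e / 2" by simp
  obtain k :: "'b \<Rightarrow> nat" where k: "\<And>\<theta> \<theta>'. \<theta> \<in> S \<Longrightarrow> \<theta>' \<in> S \<Longrightarrow> k \<theta> = k \<theta>' \<Longrightarrow>
        (\<integral>\<^sup>+ x. ennreal \<bar>f \<theta> x - f \<theta>' x\<bar> \<partial>\<nu>) \<le> ennreal (e / 2)"
    using small_fibresE[OF f e] by blast
  obtain l :: "'b \<Rightarrow> nat" where l: "\<And>\<theta> \<theta>'. \<theta> \<in> S \<Longrightarrow> \<theta>' \<in> S \<Longrightarrow> l \<theta> = l \<theta>' \<Longrightarrow>
        (\<integral>\<^sup>+ x. ennreal \<bar>g \<theta> x - g \<theta>' x\<bar> \<partial>\<nu>) \<le> ennreal (e / 2)"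
    using small_fibresE[OF g e] by blast
  show "\<exists>k :: 'b \<Rightarrow> nat. \<forall>\<theta>\<in>S. \<forall>\<theta>'\<in>S. k \<theta> = k \<theta>' \<longrightarrow>
      (\<integral>\<^sup>+ x. ennreal \<bar>f \<theta> x + g \<theta> x - (f \<theta>' x + g \<theta>' x)\<bar> \<partial>\<nu>) \<le> ennreal e"
  proof (intro exI[of _ "\<lambda>\<theta>. prod_encode (k \<theta>, l \<theta>)"] ballI impI)
    fix \<theta> \<theta>' assume *: "\<theta> \<in> S" "\<theta>' \<in> S" "prod_encode (k \<theta>, l \<theta>) = prod_encode (k \<theta>', l \<theta>')"
    note [measurable] = mf[OF *(1)] mf[OF *(2)] mg[OF *(1)] mg[OF *(2)]
    have "(\<integral>\<^sup>+ x. ennreal \<bar>f \<theta> x + g \<theta> x - (f \<theta>' x + g \<theta>' x)\<bar> \<partial>\<nu>)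
      \<le> (\<integral>\<^sup>+ x. ennreal \<bar>f \<theta> x - f \<theta>' x\<bar> + ennreal \<bar>g \<theta> x - g \<theta>' x\<bar> \<partial>\<nu>)"
      by (intro nn_integral_mono) (auto simp flip: ennreal_plus intro!: ennreal_leI)
    also have "\<dots> = (\<integral>\<^sup>+ x. ennreal \<bar>f \<theta> x - f \<theta>' x\<bar> \<partial>\<nu>) + (\<integral>\<^sup>+ x. ennreal \<bar>g \<theta> x - g \<theta>' x\<bar> \<partial>\<nu>)"
      by (intro nn_integral_add) auto
    also have "\<dots> \<le> ennreal (e / 2) + ennreal (e / 2)"
      using * by (intro add_mono k l) (auto simp: prod_encode_eq)
    also have "\<dots> = ennreal e" using e by (simp flip: ennreal_plus)
    finally show "(\<integral>\<^sup>+ x. ennreal \<bar>f \<theta> x + g \<theta> x - (f \<theta>' x + g \<theta>' x)\<bar> \<partial>\<nu>) \<le> ennreal e" .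
  qed
qed

text \<open>
  The number of terms after which the approximation is good depends on the parameter, but it is a
  natural number, so it can be made part of the index of the piece.
\<close>

lemma small_fibres_limit:
  assumes F: "\<And>n. small_fibres \<nu> S (F n)"
    and mF: "\<And>n \<theta>. \<theta> \<in> S \<Longrightarrow> F n \<theta> \<in> borel_measurable \<nu>" and mf: "\<And>\<theta>. \<theta> \<in> S \<Longrightarrow> f \<theta> \<in> borel_measurable \<nu>"
    and mw: "\<And>\<theta>. \<theta> \<in> S \<Longrightarrow> w \<theta> \<in> borel_measurable \<nu>"
    and wfin: "\<And>\<theta>. \<theta> \<in> S \<Longrightarrow> (\<integral>\<^sup>+ x. ennreal (w \<theta> x) \<partial>\<nu>) < \<infinity>"
    and bound: "\<And>n \<theta> x. \<theta> \<in> S \<Longrightarrow> x \<in> space \<nu> \<Longrightarrow> \<bar>F n \<theta> x - f \<theta> x\<bar> \<le> w \<theta> x"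
    and lim: "\<And>\<theta> x. \<theta> \<in> S \<Longrightarrow> x \<in> space \<nu> \<Longrightarrow> (\<lambda>n. F n \<theta> x) \<longlonglongrightarrow> f \<theta> x"
  shows "small_fibres \<nu> S f"
  unfolding small_fibres_def
proof (intro allI impI)
  fix e :: real assume "0 < e"
  then have e: "0 < e / 3" by simp
  have "\<exists>n. (\<integral>\<^sup>+ x. ennreal \<bar>F n \<theta> x - f \<theta> x\<bar> \<partial>\<nu>) < ennreal (e / 3)" if \<theta>: "\<theta> \<in> S" for \<theta>
  proof -
    note [measurable] = mF[OF \<theta>] mf[OF \<theta>] mw[OF \<theta>]
    have "(\<lambda>n. \<integral>\<^sup>+ x. ennreal \<bar>F n \<theta> x - f \<theta> x\<bar> \<partial>\<nu>) \<longlonglongrightarrow> (\<integral>\<^sup>+ x. 0 \<partial>\<nu>)"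
    proof (rule nn_integral_dominated_convergence[where w="\<lambda>x. ennreal (w \<theta> x)"])
      show "AE x in \<nu>. ennreal \<bar>F j \<theta> x - f \<theta> x\<bar> \<le> ennreal (w \<theta> x)" for j
        using bound[OF \<theta>] by (intro AE_I2 ennreal_leI)
      show "AE x in \<nu>. (\<lambda>n. ennreal \<bar>F n \<theta> x - f \<theta> x\<bar>) \<longlonglongrightarrow> 0"
      proof (rule AE_I2)
        fix x assume "x \<in> space \<nu>"
        then have "(\<lambda>n. \<bar>F n \<theta> x - f \<theta> x\<bar>) \<longlonglongrightarrow> 0"
          using lim[OF \<theta>] by (simp add: LIM_zero tendsto_rabs_zero)
        then show "(\<lambda>n. ennreal \<bar>F n \<theta> x - f \<theta> x\<bar>) \<longlonglongrightarrow> 0"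
          using tendsto_ennrealI by fastforce
      qed
    qed (use wfin[OF \<theta>] in auto)
    then have "\<forall>\<^sub>F n in sequentially. (\<integral>\<^sup>+ x. ennreal \<bar>F n \<theta> x - f \<theta> x\<bar> \<partial>\<nu>) < ennreal (e / 3)"
      using e by (intro order_tendstoD(2)[where y="\<integral>\<^sup>+ x. 0 \<partial>\<nu>"]) auto
    then show ?thesis by (auto simp: eventually_sequentially)
  qed
  then obtain N where N: "\<And>\<theta>. \<theta> \<in> S \<Longrightarrow> (\<integral>\<^sup>+ x. ennreal \<bar>F (N \<theta>) \<theta> x - f \<theta> x\<bar> \<partial>\<nu>) < ennreal (e / 3)"
    by metis
  have "\<forall>n. \<exists>k :: 'b \<Rightarrow> nat. \<forall>\<theta>\<in>S. \<forall>\<theta>'\<in>S. k \<theta> = k \<theta>' \<longrightarrow>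
        (\<integral>\<^sup>+ x. ennreal \<bar>F n \<theta> x - F n \<theta>' x\<bar> \<partial>\<nu>) \<le> ennreal (e / 3)"
    using F e unfolding small_fibres_def by blast
  then obtain k :: "nat \<Rightarrow> 'b \<Rightarrow> nat" where k: "\<And>n \<theta> \<theta>'. \<theta> \<in> S \<Longrightarrow> \<theta>' \<in> S \<Longrightarrow> k n \<theta> = k n \<theta>' \<Longrightarrow>
        (\<integral>\<^sup>+ x. ennreal \<bar>F n \<theta> x - F n \<theta>' x\<bar> \<partial>\<nu>) \<le> ennreal (e / 3)"
    by metis
  show "\<exists>k :: 'b \<Rightarrow> nat. \<forall>\<theta>\<in>S. \<forall>\<theta>'\<in>S. k \<theta> = k \<theta>' \<longrightarrow>
      (\<integral>\<^sup>+ x. ennreal \<bar>f \<theta> x - f \<theta>' x\<bar> \<partial>\<nu>) \<le> ennreal e"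
  proof (intro exI[of _ "\<lambda>\<theta>. prod_encode (N \<theta>, k (N \<theta>) \<theta>)"] ballI impI)
    fix \<theta> \<theta>' assume *: "\<theta> \<in> S" "\<theta>' \<in> S" "prod_encode (N \<theta>, k (N \<theta>) \<theta>) = prod_encode (N \<theta>', k (N \<theta>') \<theta>')"
    note [measurable] = mf[OF *(1)] mf[OF *(2)] mF[OF *(1)] mF[OF *(2)]
    define n where "n = N \<theta>"
    have n: "N \<theta> = n" "N \<theta>' = n" "k n \<theta> = k n \<theta>'" using * by (auto simp: prod_encode_eq n_def)
    have "(\<integral>\<^sup>+ x. ennreal \<bar>f \<theta> x - f \<theta>' x\<bar> \<partial>\<nu>)
      \<le> (\<integral>\<^sup>+ x. ennreal \<bar>F n \<theta> x - f \<theta> x\<bar> + (ennreal \<bar>F n \<theta> x - F n \<theta>' x\<bar> + ennreal \<bar>F n \<theta>' x - f \<theta>' x\<bar>) \<partial>\<nu>)"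
      by (intro nn_integral_mono) (auto simp flip: ennreal_plus intro!: ennreal_leI)
    also have "\<dots> = (\<integral>\<^sup>+ x. ennreal \<bar>F n \<theta> x - f \<theta> x\<bar> \<partial>\<nu>) +
        ((\<integral>\<^sup>+ x. ennreal \<bar>F n \<theta> x - F n \<theta>' x\<bar> \<partial>\<nu>) + (\<integral>\<^sup>+ x. ennreal \<bar>F n \<theta>' x - f \<theta>' x\<bar> \<partial>\<nu>))"
      by (simp add: nn_integral_add)
    also have "\<dots> \<le> ennreal (e / 3) + (ennreal (e / 3) + ennreal (e / 3))"
      using N[OF *(1)] N[OF *(2)] n by (intro add_mono k *) auto
    also have "\<dots> = ennreal e" using e by (simp flip: ennreal_plus)
    finally show "(\<integral>\<^sup>+ x. ennreal \<bar>f \<theta> x - f \<theta>' x\<bar> \<partial>\<nu>) \<le> ennreal e" .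
  qed
qed

lemma small_fibres_const_zero: "small_fibres \<nu> S (\<lambda>\<theta> x. 0)"
  by (auto simp: small_fibres_def)

text \<open>
  For a rectangle only membership of the parameter in the first side matters, so two pieces suffice.
  The sets with the property form a Dynkin system: the complement has the same distances, and a
  disjoint union is a limit of finite sums, dominated by 1 because the measure is finite.
\<close>

lemma small_fibres_indicator:
  assumes "finite_measure \<nu>" and A: "A \<in> sets (T \<Otimes>\<^sub>M \<nu>)" and S: "S \<subseteq> space T"
  shows "small_fibres \<nu> S (\<lambda>\<theta> x. indicator A (\<theta>, x))"
proof -
  interpret finite_measure \<nu> by fact
  show ?thesis
    using Int_stable_pair_measure_generator pair_measure_closed A[unfolded sets_pair_measure]
  proof (induction rule: sigma_sets_induct_disjoint)
    case (basic B)
    then obtain a b where B: "B = a \<times> b" by auto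
    show ?case
      unfolding small_fibres_def B
      by (intro allI impI exI[of _ "\<lambda>\<theta>. if \<theta> \<in> a then 1 else 0"]) (auto simp: indicator_def)
  next
    case empty
    then show ?case by (simp add: small_fibres_const_zero)
  next
    case (compl B)
    have "(\<integral>\<^sup>+ x. ennreal \<bar>indicator (space T \<times> space \<nu> - B) (\<theta>, x) - indicator (space T \<times> space \<nu> - B) (\<theta>', x)\<bar> \<partial>\<nu>)
        = (\<integral>\<^sup>+ x. ennreal \<bar>indicator B (\<theta>, x) - indicator B (\<theta>', x)\<bar> \<partial>\<nu>)" if "\<theta> \<in> S" "\<theta>' \<in> S" for \<theta> \<theta>'
      using that S by (intro nn_integral_cong) (auto simp: indicator_def)
    then show ?case by (rule small_fibres_same_distances[OF compl(2)])
  next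
    case (union B)
    have B[measurable]: "B i \<in> sets (T \<Otimes>\<^sub>M \<nu>)" for i using union(2) by (auto simp: sets_pair_measure)
    have [measurable]: "Pair \<theta> \<in> \<nu> \<rightarrow>\<^sub>M T \<Otimes>\<^sub>M \<nu>" if "\<theta> \<in> S" for \<theta>
      using that S by (intro measurable_Pair1') auto
    have meas: "(\<lambda>x. indicator (\<Union>i. B i) (\<theta>, x) :: real) \<in> borel_measurable \<nu>" if "\<theta> \<in> S" for \<theta>
    proof (rule measurable_compose[of "Pair \<theta>" \<nu> "T \<Otimes>\<^sub>M \<nu>" "indicator (\<Union>i. B i)"])
      show "Pair \<theta> \<in> \<nu> \<rightarrow>\<^sub>M T \<Otimes>\<^sub>M \<nu>" using that S by (intro measurable_Pair1') auto
      show "indicator (\<Union>i. B i) \<in> borel_measurable (T \<Otimes>\<^sub>M \<nu>)"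
        by (intro borel_measurable_indicator sets.countable_UN) auto
    qed
    have sums: "(\<lambda>i. indicator (B i) z :: real) sums indicator (\<Union>i. B i) z" for z
      using union(1) by (intro indicator_sums) (auto simp: disjoint_family_on_def)
    show ?case
    proof (rule small_fibres_limit[where F="\<lambda>n \<theta> x. \<Sum>i<n. indicator (B i) (\<theta>, x)" and w="\<lambda>_ _. 1"])
      fix n show "small_fibres \<nu> S (\<lambda>\<theta> x. \<Sum>i<n. indicator (B i) (\<theta>, x))"
      proof (induction n)
        case (Suc n)
        show ?case unfolding sum.lessThan_Suc by (intro small_fibres_add Suc union(3)) auto
      qed (simp add: small_fibres_const_zero)
    next
      fix n \<theta> x
      have "0 \<le> (\<Sum>i<n. indicator (B i) (\<theta>, x) :: real)" by (simp add: sum_nonneg)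
      moreover have "(\<Sum>i<n. indicator (B i) (\<theta>, x) :: real) \<le> indicator (\<Union>i. B i) (\<theta>, x)"
        using sum_le_suminf[OF sums_summable[OF sums], of "{..<n}" "(\<theta>, x)"] sums_unique[OF sums, of "(\<theta>, x)"] by simp
      moreover have "indicator (\<Union>i. B i) (\<theta>, x) \<le> (1::real)" by (simp add: indicator_def)
      ultimately show "\<bar>(\<Sum>i<n. indicator (B i) (\<theta>, x)) - indicator (\<Union>i. B i) (\<theta>, x)\<bar> \<le> (1::real)" by linarith
    qed (use sums meas in \<open>auto simp: sums_def emeasure_eq_measure\<close>)
  qed
qed

text \<open>
  The monotone class argument from indicators to nonnegative measurable functions; the limit is
  dominated by the function itself, which is integrable for every parameter considered.
\<close>

lemma small_fibres_finite_measure: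
  fixes u :: "'p \<times> 'x \<Rightarrow> real"
  assumes "finite_measure \<nu>" and u: "u \<in> borel_measurable (T \<Otimes>\<^sub>M \<nu>)" "\<And>z. 0 \<le> u z"
    and S: "S \<subseteq> space T" and fin: "\<And>\<theta>. \<theta> \<in> S \<Longrightarrow> (\<integral>\<^sup>+ x. ennreal (u (\<theta>, x)) \<partial>\<nu>) < \<infinity>"
  shows "small_fibres \<nu> S (\<lambda>\<theta> x. u (\<theta>, x))"
  using u S fin
proof (induction arbitrary: S rule: borel_measurable_induct_real)
  case (set A)
  then show ?case using small_fibres_indicator[OF assms(1)] by blast
next
  case (mult u c)
  show ?case
  proof (cases "c = 0")
    case True
    then show ?thesis by (simp add: small_fibres_const_zero)
  next
    case False
    with mult have c: "0 < c" by simp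
    note [measurable] = mult.hyps(2)
    have [measurable]: "Pair \<theta> \<in> \<nu> \<rightarrow>\<^sub>M T \<Otimes>\<^sub>M \<nu>" if "\<theta> \<in> S" for \<theta>
      using that mult by (intro measurable_Pair1') auto
    have mu: "(\<lambda>x. u (\<theta>, x)) \<in> borel_measurable \<nu>" if "\<theta> \<in> S" for \<theta>
      using that by measurable
    have "(\<integral>\<^sup>+ x. ennreal (u (\<theta>, x)) \<partial>\<nu>) < \<infinity>" if \<theta>: "\<theta> \<in> S" for \<theta>
      using mult.prems(2)[OF \<theta>] c mult.hyps(1,3) mu[OF \<theta>]
      by (auto simp: ennreal_mult nn_integral_cmult ennreal_mult_less_top)
    then have IH: "small_fibres \<nu> S (\<lambda>\<theta> x. u (\<theta>, x))" using mult by blast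
    show ?thesis unfolding small_fibres_def
    proof (intro allI impI)
      fix e :: real assume e: "0 < e"
      obtain k :: "'p \<Rightarrow> nat" where k: "\<And>\<theta> \<theta>'. \<theta> \<in> S \<Longrightarrow> \<theta>' \<in> S \<Longrightarrow> k \<theta> = k \<theta>' \<Longrightarrow>
          (\<integral>\<^sup>+ x. ennreal \<bar>u (\<theta>, x) - u (\<theta>', x)\<bar> \<partial>\<nu>) \<le> ennreal (e / c)"
        using small_fibresE[OF IH, of "e / c"] e c by auto
      show "\<exists>k :: 'p \<Rightarrow> nat. \<forall>\<theta>\<in>S. \<forall>\<theta>'\<in>S. k \<theta> = k \<theta>' \<longrightarrow>
          (\<integral>\<^sup>+ x. ennreal \<bar>c * u (\<theta>, x) - c * u (\<theta>', x)\<bar> \<partial>\<nu>) \<le> ennreal e"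
      proof (intro exI[of _ k] ballI impI)
        fix \<theta> \<theta>' assume *: "\<theta> \<in> S" "\<theta>' \<in> S" "k \<theta> = k \<theta>'"
        note [measurable] = mu[OF *(1)] mu[OF *(2)]
        have "(\<integral>\<^sup>+ x. ennreal \<bar>c * u (\<theta>, x) - c * u (\<theta>', x)\<bar> \<partial>\<nu>) = (\<integral>\<^sup>+ x. ennreal c * ennreal \<bar>u (\<theta>, x) - u (\<theta>', x)\<bar> \<partial>\<nu>)"
          using c by (intro nn_integral_cong) (simp add: abs_mult flip: ennreal_mult right_diff_distrib)
        also have "\<dots> \<le> ennreal c * ennreal (e / c)"
          using k[OF *] by (subst nn_integral_cmult) (auto intro: mult_left_mono)
        also have "\<dots> = ennreal e" using c e by (simp flip: ennreal_mult)
        finally show "(\<integral>\<^sup>+ x. ennreal \<bar>c * u (\<theta>, x) - c * u (\<theta>', x)\<bar> \<partial>\<nu>) \<le> ennreal e" .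
      qed
    qed
  qed
next
  case (add u v)
  note [measurable] = add.hyps(1,3)
  have [measurable]: "Pair \<theta> \<in> \<nu> \<rightarrow>\<^sub>M T \<Otimes>\<^sub>M \<nu>" if "\<theta> \<in> S" for \<theta>
    using that add by (intro measurable_Pair1') auto
  have "(\<integral>\<^sup>+ x. ennreal (u (\<theta>, x)) \<partial>\<nu>) \<le> (\<integral>\<^sup>+ x. ennreal (v (\<theta>, x) + u (\<theta>, x)) \<partial>\<nu>)"
    "(\<integral>\<^sup>+ x. ennreal (v (\<theta>, x)) \<partial>\<nu>) \<le> (\<integral>\<^sup>+ x. ennreal (v (\<theta>, x) + u (\<theta>, x)) \<partial>\<nu>)" for \<theta>
    using add.hyps(2,4) by (auto intro!: nn_integral_mono ennreal_leI)
  then have "(\<integral>\<^sup>+ x. ennreal (u (\<theta>, x)) \<partial>\<nu>) < \<infinity>" "(\<integral>\<^sup>+ x. ennreal (v (\<theta>, x)) \<partial>\<nu>) < \<infinity>"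
    if "\<theta> \<in> S" for \<theta>
    using add.prems(2)[OF that] le_less_trans by blast+
  then show ?case
    using add.prems by (intro small_fibres_add add.IH) auto
next
  case (seq U)
  note [measurable] = seq.hyps(1)
  note u[measurable]
  have [measurable]: "Pair \<theta> \<in> \<nu> \<rightarrow>\<^sub>M T \<Otimes>\<^sub>M \<nu>" if "\<theta> \<in> S" for \<theta>
    using that seq by (intro measurable_Pair1') auto
  have le: "U i (\<theta>, x) \<le> u (\<theta>, x)" if "\<theta> \<in> S" "x \<in> space \<nu>" for i \<theta> x
    using that seq by (intro incseq_le[of "\<lambda>i. U i (\<theta>, x)"]) (auto simp: incseq_def le_fun_def space_pair_measure)
  show ?case
  proof (rule small_fibres_limit[where F="\<lambda>n \<theta> x. U n (\<theta>, x)" and w="\<lambda>\<theta> x. u (\<theta>, x)"])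
    fix n show "small_fibres \<nu> S (\<lambda>\<theta> x. U n (\<theta>, x))"
    proof (rule seq.IH)
      fix \<theta> assume \<theta>: "\<theta> \<in> S"
      have "(\<integral>\<^sup>+ x. ennreal (U n (\<theta>, x)) \<partial>\<nu>) \<le> (\<integral>\<^sup>+ x. ennreal (u (\<theta>, x)) \<partial>\<nu>)"
        using le[OF \<theta>] by (intro nn_integral_mono ennreal_leI)
      then show "(\<integral>\<^sup>+ x. ennreal (U n (\<theta>, x)) \<partial>\<nu>) < \<infinity>" using seq.prems(2)[OF \<theta>] by auto
    qed fact
  next
    fix n \<theta> x assume "\<theta> \<in> S" "x \<in> space \<nu>"
    with le[OF this, of n] seq.hyps(2)[of n "(\<theta>, x)"] show "\<bar>U n (\<theta>, x) - u (\<theta>, x)\<bar> \<le> u (\<theta>, x)" by linarith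
  qed (use seq in \<open>auto simp: space_pair_measure\<close>)
qed

text \<open>
  Reweighting by a positive integrable function \<open>h\<close> and dividing the densities by \<open>h\<close> leaves all
  \<open>L\<^sup>1\<close> distances unchanged and reduces the claim to a finite measure.  One parameter from each piece
  of each partition then gives the dense set.
\<close>

lemma countable_L1_dense:
  fixes f :: "'p \<Rightarrow> 'x \<Rightarrow> real"
  assumes \<mu>: "sigma_finite_measure \<mu>" and f[measurable]: "(\<lambda>(\<theta>, x). f \<theta> x) \<in> borel_measurable (T \<Otimes>\<^sub>M \<mu>)"
    and nonneg: "\<And>\<theta> x. \<theta> \<in> space T \<Longrightarrow> x \<in> space \<mu> \<Longrightarrow> 0 \<le> f \<theta> x"
    and S: "S \<subseteq> space T" and fin: "\<And>\<theta>. \<theta> \<in> S \<Longrightarrow> (\<integral>\<^sup>+ x. ennreal (f \<theta> x) \<partial>\<mu>) < \<infinity>"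
  obtains D where "countable D" "D \<subseteq> S"
    "\<And>\<theta> e. \<theta> \<in> S \<Longrightarrow> 0 < e \<Longrightarrow> \<exists>d\<in>D. (\<integral>\<^sup>+ x. ennreal \<bar>f \<theta> x - f d x\<bar> \<partial>\<mu>) \<le> ennreal e"
proof -
  interpret sigma_finite_measure \<mu> by fact
  obtain h where [measurable]: "h \<in> borel_measurable \<mu>" and hfin: "(\<integral>\<^sup>+ x. h x \<partial>\<mu>) \<noteq> \<infinity>"
    and h: "\<And>x. x \<in> space \<mu> \<Longrightarrow> 0 < h x \<and> h x < \<infinity>"
    using Ex_finite_integrable_function by blast
  define \<nu> where "\<nu> = density \<mu> h"
  have sets\<nu>[measurable_cong]: "sets \<nu> = sets \<mu>" and space\<nu>: "space \<nu> = space \<mu>" by (auto simp: \<nu>_def)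
  have "finite_measure \<nu>"
    using hfin by (intro finite_measureI) (simp add: \<nu>_def emeasure_density cong: nn_integral_cong)
  (* The maximum makes u nonnegative everywhere, not only on the product space. *)
  define u where "u = (\<lambda>(\<theta>, x). max 0 (f \<theta> x) / enn2real (h x))"
  have u: "u \<in> borel_measurable (T \<Otimes>\<^sub>M \<nu>)" "0 \<le> u z" for z
    unfolding u_def by (auto split: prod.split)
  have hr: "h x = ennreal (enn2real (h x))" "0 < enn2real (h x)" if "x \<in> space \<mu>" for x
    using h[OF that] by (auto simp: enn2real_positive_iff)
  have [measurable]: "f \<theta> \<in> borel_measurable \<mu>" if "\<theta> \<in> S" for \<theta>
    using that S measurable_Pair2[OF f, of \<theta>] by auto
  have mu: "(\<lambda>x. u (\<theta>, x)) \<in> borel_measurable \<mu>" if "\<theta> \<in> S" for \<theta>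
    using that unfolding u_def by simp
  have dist: "(\<integral>\<^sup>+ x. ennreal \<bar>u (\<theta>, x) - u (\<theta>', x)\<bar> \<partial>\<nu>) = (\<integral>\<^sup>+ x. ennreal \<bar>f \<theta> x - f \<theta>' x\<bar> \<partial>\<mu>)"
    if *: "\<theta> \<in> S" "\<theta>' \<in> S" for \<theta> \<theta>'
  proof -
    note [measurable] = mu[OF *(1)] mu[OF *(2)]
    have "(\<integral>\<^sup>+ x. ennreal \<bar>u (\<theta>, x) - u (\<theta>', x)\<bar> \<partial>\<nu>) = (\<integral>\<^sup>+ x. h x * ennreal \<bar>u (\<theta>, x) - u (\<theta>', x)\<bar> \<partial>\<mu>)"
      unfolding \<nu>_def by (intro nn_integral_density) auto
    also have "\<dots> = (\<integral>\<^sup>+ x. ennreal \<bar>f \<theta> x - f \<theta>' x\<bar> \<partial>\<mu>)"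
    proof (rule nn_integral_cong)
      fix x assume x: "x \<in> space \<mu>"
      have "h x * ennreal \<bar>u (\<theta>, x) - u (\<theta>', x)\<bar> = ennreal (enn2real (h x) * \<bar>u (\<theta>, x) - u (\<theta>', x)\<bar>)"
        using hr[OF x] by (metis abs_ge_zero ennreal_mult less_imp_le)
      also have "enn2real (h x) * \<bar>u (\<theta>, x) - u (\<theta>', x)\<bar> = \<bar>f \<theta> x - f \<theta>' x\<bar>"
        using hr(2)[OF x] nonneg[OF _ x, of \<theta>] nonneg[OF _ x, of \<theta>'] * S
        by (auto simp: u_def abs_mult_pos' right_diff_distrib subset_iff)
      finally show "h x * ennreal \<bar>u (\<theta>, x) - u (\<theta>', x)\<bar> = ennreal \<bar>f \<theta> x - f \<theta>' x\<bar>" .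
    qed
    finally show ?thesis .
  qed
  have "(\<integral>\<^sup>+ x. ennreal (u (\<theta>, x)) \<partial>\<nu>) < \<infinity>" if \<theta>: "\<theta> \<in> S" for \<theta>
  proof -
    have "(\<integral>\<^sup>+ x. ennreal (u (\<theta>, x)) \<partial>\<nu>) = (\<integral>\<^sup>+ x. h x * ennreal (u (\<theta>, x)) \<partial>\<mu>)"
      unfolding \<nu>_def using mu[OF \<theta>] by (intro nn_integral_density) auto
    also have "\<dots> = (\<integral>\<^sup>+ x. ennreal (f \<theta> x) \<partial>\<mu>)"
    proof (rule nn_integral_cong)
      fix x assume x: "x \<in> space \<mu>"
      have "h x * ennreal (u (\<theta>, x)) = ennreal (enn2real (h x) * u (\<theta>, x))"
        using hr[OF x] u(2) by (metis ennreal_mult less_imp_le)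
      also have "enn2real (h x) * u (\<theta>, x) = f \<theta> x"
        using hr(2)[OF x] nonneg[OF _ x, of \<theta>] \<theta> S by (auto simp: u_def subset_iff)
      finally show "h x * ennreal (u (\<theta>, x)) = ennreal (f \<theta> x)" .
    qed
    finally show ?thesis using fin[OF \<theta>] by simp
  qed
  then have small: "small_fibres \<nu> S (\<lambda>\<theta> x. u (\<theta>, x))"
    using small_fibres_finite_measure[OF \<open>finite_measure \<nu>\<close> u S] by blast
  have "\<forall>n. \<exists>k :: 'p \<Rightarrow> nat. \<forall>\<theta>\<in>S. \<forall>\<theta>'\<in>S. k \<theta> = k \<theta>' \<longrightarrow>
        (\<integral>\<^sup>+ x. ennreal \<bar>u (\<theta>, x) - u (\<theta>', x)\<bar> \<partial>\<nu>) \<le> ennreal (inverse (Suc n))"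
    using small unfolding small_fibres_def by (metis inverse_Suc)
  then obtain k :: "nat \<Rightarrow> 'p \<Rightarrow> nat" where k: "\<And>n \<theta> \<theta>'. \<theta> \<in> S \<Longrightarrow> \<theta>' \<in> S \<Longrightarrow> k n \<theta> = k n \<theta>' \<Longrightarrow>
        (\<integral>\<^sup>+ x. ennreal \<bar>f \<theta> x - f \<theta>' x\<bar> \<partial>\<mu>) \<le> ennreal (inverse (Suc n))"
    using dist by metis
  define pick where "pick = (\<lambda>(n, m). SOME \<theta>. \<theta> \<in> S \<and> k n \<theta> = m)"
  have pick: "pick (n, k n \<theta>) \<in> S \<and> k n (pick (n, k n \<theta>)) = k n \<theta>" if "\<theta> \<in> S" for n \<theta>
    using someI[of "\<lambda>\<theta>'. \<theta>' \<in> S \<and> k n \<theta>' = k n \<theta>" \<theta>] that by (auto simp: pick_def)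
  show thesis
  proof (rule that[of "pick ` {(n, m). \<exists>\<theta>\<in>S. k n \<theta> = m}"])
    show "countable (pick ` {(n, m). \<exists>\<theta>\<in>S. k n \<theta> = m})" by (rule countable_image) auto
    show "pick ` {(n, m). \<exists>\<theta>\<in>S. k n \<theta> = m} \<subseteq> S" using pick by auto
    fix \<theta> and e :: real assume \<theta>: "\<theta> \<in> S" and "0 < e"
    then obtain n where n: "inverse (real (Suc n)) < e" using reals_Archimedean by blast
    have "(\<integral>\<^sup>+ x. ennreal \<bar>f \<theta> x - f (pick (n, k n \<theta>)) x\<bar> \<partial>\<mu>) \<le> ennreal (inverse (Suc n))"
      using pick[OF \<theta>] \<theta> by (intro k) auto
    also have "\<dots> \<le> ennreal e" using n by (intro ennreal_leI) simp
    finally show "\<exists>d\<in>pick ` {(n, m). \<exists>\<theta>\<in>S. k n \<theta> = m}. (\<integral>\<^sup>+ x. ennreal \<bar>f \<theta> x - f d x\<bar> \<partial>\<mu>) \<le> ennreal e"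
      using \<theta> by (intro bexI[of _ "pick (n, k n \<theta>)"]) auto
  qed
qed

text \<open>
  For a bounded \<open>g\<close> the integral is continuous in the density with respect to the \<open>L\<^sup>1\<close> distance; an
  unbounded \<open>g\<close> is the supremum of its truncations.
\<close>

lemma nn_integral_le_of_dense:
  fixes g :: "'x \<Rightarrow> ennreal" and f :: "'p \<Rightarrow> 'x \<Rightarrow> real"
  assumes [measurable]: "g \<in> borel_measurable M"
    and f\<theta>[measurable]: "f \<theta> \<in> borel_measurable M" and fD: "\<And>d. d \<in> D \<Longrightarrow> f d \<in> borel_measurable M"
    and nonneg: "\<And>x. x \<in> space M \<Longrightarrow> 0 \<le> f \<theta> x" "\<And>d x. d \<in> D \<Longrightarrow> x \<in> space M \<Longrightarrow> 0 \<le> f d x"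
    and le: "\<And>d. d \<in> D \<Longrightarrow> (\<integral>\<^sup>+ x. g x * ennreal (f d x) \<partial>M) \<le> c"
    and dense: "\<And>e. 0 < e \<Longrightarrow> \<exists>d\<in>D. (\<integral>\<^sup>+ x. ennreal \<bar>f \<theta> x - f d x\<bar> \<partial>M) \<le> ennreal e"
  shows "(\<integral>\<^sup>+ x. g x * ennreal (f \<theta> x) \<partial>M) \<le> c"
proof -
  have trunc: "(\<integral>\<^sup>+ x. min (g x) (of_nat k) * ennreal (f \<theta> x) \<partial>M) \<le> c" for k :: nat
  proof (rule ennreal_le_epsilon)
    fix e :: real assume "0 < e"
    then have "0 < e / (real k + 1)" by simp
    then obtain d where d: "d \<in> D" "(\<integral>\<^sup>+ x. ennreal \<bar>f \<theta> x - f d x\<bar> \<partial>M) \<le> ennreal (e / (real k + 1))"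
      using dense by blast
    note [measurable] = fD[OF d(1)]
    have "(\<integral>\<^sup>+ x. min (g x) (of_nat k) * ennreal (f \<theta> x) \<partial>M)
        \<le> (\<integral>\<^sup>+ x. g x * ennreal (f d x) + of_nat k * ennreal \<bar>f \<theta> x - f d x\<bar> \<partial>M)"
    proof (rule nn_integral_mono)
      fix x assume x: "x \<in> space M"
      have "ennreal (f \<theta> x) \<le> ennreal (f d x) + ennreal \<bar>f \<theta> x - f d x\<bar>"
        using nonneg(1)[OF x] nonneg(2)[OF d(1) x] by (simp flip: ennreal_plus)
      then have "min (g x) (of_nat k) * ennreal (f \<theta> x) \<le> min (g x) (of_nat k) * (ennreal (f d x) + ennreal \<bar>f \<theta> x - f d x\<bar>)"
        by (rule mult_left_mono) simp
      also have "\<dots> = min (g x) (of_nat k) * ennreal (f d x) + min (g x) (of_nat k) * ennreal \<bar>f \<theta> x - f d x\<bar>"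
        by (simp add: distrib_left)
      also have "\<dots> \<le> g x * ennreal (f d x) + of_nat k * ennreal \<bar>f \<theta> x - f d x\<bar>"
        by (intro add_mono mult_right_mono) auto
      finally show "min (g x) (of_nat k) * ennreal (f \<theta> x) \<le> g x * ennreal (f d x) + of_nat k * ennreal \<bar>f \<theta> x - f d x\<bar>" .
    qed
    also have "\<dots> = (\<integral>\<^sup>+ x. g x * ennreal (f d x) \<partial>M) + of_nat k * (\<integral>\<^sup>+ x. ennreal \<bar>f \<theta> x - f d x\<bar> \<partial>M)"
      by (simp add: nn_integral_add nn_integral_cmult)
    also have "\<dots> \<le> c + of_nat k * ennreal (e / (real k + 1))"
      by (intro add_mono le[OF d(1)] mult_left_mono d(2)) simp
    also have "of_nat k * ennreal (e / (real k + 1)) = ennreal (real k * (e / (real k + 1)))"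
      using \<open>0 < e\<close> by (subst ennreal_mult) (auto simp: ennreal_of_nat_eq_real_of_nat)
    also have "\<dots> \<le> ennreal e"
      using \<open>0 < e\<close> by (intro ennreal_leI) (simp add: field_simps)
    finally show "(\<integral>\<^sup>+ x. min (g x) (of_nat k) * ennreal (f \<theta> x) \<partial>M) \<le> c + ennreal e" by (simp add: add_left_mono)
  qed
  have "(\<integral>\<^sup>+ x. g x * ennreal (f \<theta> x) \<partial>M) = (\<integral>\<^sup>+ x. (SUP k. min (g x) (of_nat k) * ennreal (f \<theta> x)) \<partial>M)"
  proof (rule nn_integral_cong)
    fix x
    have "(SUP k. min (g x) (of_nat k)) = g x"
    proof (cases "g x = top")
      case True
      then show ?thesis by (simp add: ennreal_SUP_of_nat_eq_top)
    next
      case False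
      then obtain r where r: "0 \<le> r" "g x = ennreal r" by (cases "g x") auto
      obtain n where "r \<le> real n" using real_arch_simple by blast
      then have "g x \<le> of_nat n" using r by (simp add: ennreal_leI flip: ennreal_of_nat_eq_real_of_nat)
      then show ?thesis
        by (intro antisym SUP_least SUP_upper2[of n]) auto
    qed
    then show "g x * ennreal (f \<theta> x) = (SUP k. min (g x) (of_nat k) * ennreal (f \<theta> x))"
      using SUP_mult_right_ennreal[of "\<lambda>k. min (g x) (of_nat k)" UNIV "ennreal (f \<theta> x)"] by simp
  qed
  also have "\<dots> = (SUP k. \<integral>\<^sup>+ x. min (g x) (of_nat k) * ennreal (f \<theta> x) \<partial>M)"
    by (intro nn_integral_monotone_convergence_SUP)
       (auto simp: incseq_def le_fun_def intro!: mult_right_mono min.mono)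
  also have "\<dots> \<le> c" using trunc by (intro SUP_least)
  finally show ?thesis .
qed

section \<open>Sequences of observations and stopped processes\<close>

lemma nn_integral_PiM_lessThan_Suc:
  assumes "sigma_finite_measure M" and g: "g \<in> borel_measurable (\<Pi>\<^sub>M i\<in>{..<Suc t}. M)"
  shows "(\<integral>\<^sup>+ xs. g xs \<partial>(\<Pi>\<^sub>M i\<in>{..<Suc t}. M)) = (\<integral>\<^sup>+ xs. \<integral>\<^sup>+ x. g (xs(t := x)) \<partial>M \<partial>(\<Pi>\<^sub>M i\<in>{..<t}. M))"
proof -
  interpret product_sigma_finite "\<lambda>_. M"
    using assms(1) by (simp add: product_sigma_finite_def)
  show ?thesis
    using product_nn_integral_insert[of "{..<t}" t g] g by (simp add: lessThan_Suc)
qed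

lemma measurable_fun_upd_last:
  "(\<lambda>(xs, x). xs(t := x)) \<in> (\<Pi>\<^sub>M i\<in>{..<t}. M) \<Otimes>\<^sub>M M \<rightarrow>\<^sub>M (\<Pi>\<^sub>M i\<in>{..<Suc t}. M)"
  using measurable_add_dim[of t "{..<t}" "\<lambda>_. M"] by (simp add: lessThan_Suc)

lemma measurable_next_section:
  assumes g: "g \<in> borel_measurable (\<Pi>\<^sub>M i\<in>{..<Suc t}. M)"
  shows "(\<lambda>(xs, x). g (xs(t := x))) \<in> borel_measurable ((\<Pi>\<^sub>M i\<in>{..<t}. M) \<Otimes>\<^sub>M M)"
  using measurable_compose[OF measurable_fun_upd_last g] by (simp add: case_prod_beta')

lemma measurable_first_obs:
  "first_obs t \<in> (\<Pi>\<^sub>M i\<in>UNIV. M) \<rightarrow>\<^sub>M (\<Pi>\<^sub>M i\<in>{..<t}. M)"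
  unfolding first_obs_def by (intro measurable_restrict_subset) auto

lemma measurable_first_obs_le:
  "s \<le> t \<Longrightarrow> first_obs s \<in> (\<Pi>\<^sub>M i\<in>{..<t}. M) \<rightarrow>\<^sub>M (\<Pi>\<^sub>M i\<in>{..<s}. M)"
  unfolding first_obs_def by (intro measurable_restrict_subset) auto

lemma first_obs_first_obs: "s \<le> t \<Longrightarrow> first_obs s (first_obs t \<omega>) = first_obs s \<omega>"
  by (auto simp: first_obs_def restrict_def fun_eq_iff)

lemma first_obs_upd: "first_obs t (xs(t := x)) = first_obs t xs"
  by (auto simp: first_obs_def restrict_def fun_eq_iff)

lemma first_obs_id: "xs \<in> space (\<Pi>\<^sub>M i\<in>{..<t}. M) \<Longrightarrow> first_obs t xs = xs"
  by (simp add: first_obs_def space_PiM)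

lemma obs_filtration_enat:
  "obs_filtration M (enat t) = vimage_algebra (space (\<Pi>\<^sub>M i\<in>UNIV. M)) (first_obs t) (\<Pi>\<^sub>M i\<in>{..<t}. M)"
  by (simp add: obs_filtration_def first_obs_def[abs_def] lessThan_def)

lemma space_obs_filtration: "space (obs_filtration M (enat t)) = space (\<Pi>\<^sub>M i\<in>UNIV. M)"
  by (simp add: obs_filtration_enat)

lemma sets_obs_filtration:
  "sets (obs_filtration M (enat t)) = {first_obs t -` B \<inter> space (\<Pi>\<^sub>M i\<in>UNIV. M) | B. B \<in> sets (\<Pi>\<^sub>M i\<in>{..<t}. M)}"
  unfolding obs_filtration_enat
  using measurable_space[OF measurable_first_obs[of t M]] by (subst sets_vimage_algebra2) auto

lemma measurable_first_obs_filtration: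
  "first_obs t \<in> obs_filtration M (enat t) \<rightarrow>\<^sub>M (\<Pi>\<^sub>M i\<in>{..<t}. M)"
  unfolding obs_filtration_enat
  using measurable_space[OF measurable_first_obs[of t M]] by (intro measurable_vimage_algebra1) auto

lemma subalgebra_obs_filtration: "subalgebra (\<Pi>\<^sub>M i\<in>UNIV. M) (obs_filtration M (enat t))"
  unfolding subalgebra_def
proof
  show "sets (obs_filtration M (enat t)) \<subseteq> sets (\<Pi>\<^sub>M i\<in>UNIV. M)"
    unfolding sets_obs_filtration using measurable_sets[OF measurable_first_obs] by blast
qed (simp add: space_obs_filtration)

lemma subalgebra_obs_filtration_mono:
  assumes "s \<le> t" shows "subalgebra (obs_filtration M (enat t)) (obs_filtration M (enat s))"
  unfolding subalgebra_def
proof (intro conjI subsetI)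
  fix A assume "A \<in> sets (obs_filtration M (enat s))"
  then obtain B where B: "B \<in> sets (\<Pi>\<^sub>M i\<in>{..<s}. M)" "A = first_obs s -` B \<inter> space (\<Pi>\<^sub>M i\<in>UNIV. M)"
    by (auto simp: sets_obs_filtration)
  have "A = first_obs t -` (first_obs s -` B \<inter> space (\<Pi>\<^sub>M i\<in>{..<t}. M)) \<inter> space (\<Pi>\<^sub>M i\<in>UNIV. M)"
    using B(2) measurable_space[OF measurable_first_obs[of t M]] by (auto simp: first_obs_first_obs[OF assms])
  then show "A \<in> sets (obs_filtration M (enat t))"
    using measurable_sets[OF measurable_first_obs_le[OF assms] B(1)] unfolding sets_obs_filtration by blast
qed (simp add: space_obs_filtration)

lemma distr_first_obs:
  assumes "prob_space P"
  shows "distr (\<Pi>\<^sub>M i\<in>UNIV. P) (\<Pi>\<^sub>M i\<in>{..<t}. P) (first_obs t) = (\<Pi>\<^sub>M i\<in>{..<t}. P)"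
  unfolding first_obs_def[abs_def]
  using assms by (intro product_prob_space.distr_PiM_restrict_finite product_prob_spaceI) auto

lemma nn_integral_first_obs:
  assumes "prob_space P" "g \<in> borel_measurable (\<Pi>\<^sub>M i\<in>{..<t}. P)"
  shows "(\<integral>\<^sup>+ \<omega>. g (first_obs t \<omega>) \<partial>(\<Pi>\<^sub>M i\<in>UNIV. P)) = (\<integral>\<^sup>+ xs. g xs \<partial>(\<Pi>\<^sub>M i\<in>{..<t}. P))"
  by (subst distr_first_obs[OF assms(1), symmetric], subst nn_integral_distr)
     (use assms(2) measurable_first_obs in auto)

text \<open>
  By independence, conditioning on the past amounts to integrating out the next observation.
\<close>

lemma nn_cond_exp_next_obs:
  assumes P: "prob_space P" and sets: "sets P = sets M" and g: "g \<in> borel_measurable (\<Pi>\<^sub>M i\<in>{..<Suc t}. M)"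
  shows "AE \<omega> in (\<Pi>\<^sub>M i\<in>UNIV. P). nn_cond_exp (\<Pi>\<^sub>M i\<in>UNIV. P) (obs_filtration M (enat t))
      (\<lambda>\<omega>'. g (first_obs (Suc t) \<omega>')) \<omega> = (\<integral>\<^sup>+ x. g ((first_obs t \<omega>)(t := x)) \<partial>P)"
proof -
  interpret P: prob_space P by fact
  have setsI: "sets (\<Pi>\<^sub>M i\<in>I. P) = sets (\<Pi>\<^sub>M i\<in>I. M)" for I :: "nat set"
    by (intro sets_PiM_cong refl sets)
  have spI: "space (\<Pi>\<^sub>M i\<in>I. P) = space (\<Pi>\<^sub>M i\<in>I. M)" for I :: "nat set"
    using sets_eq_imp_space_eq[OF setsI] .
  interpret prob_space "\<Pi>\<^sub>M i\<in>(UNIV::nat set). P" by (intro prob_space_PiM P)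
  have sub: "subalgebra (\<Pi>\<^sub>M i\<in>UNIV. P) (obs_filtration M (enat t))"
    using subalgebra_obs_filtration[of M t] by (simp add: subalgebra_def setsI spI)
  interpret finite_measure_subalgebra "\<Pi>\<^sub>M i\<in>(UNIV::nat set). P" "obs_filtration M (enat t)"
    by unfold_locales fact
  have gP: "g \<in> borel_measurable (\<Pi>\<^sub>M i\<in>{..<Suc t}. P)" using g by (simp cong: measurable_cong_sets add: setsI)
  define G where "G xs = (\<integral>\<^sup>+ x. g (xs(t := x)) \<partial>P)" for xs
  have GP: "G \<in> borel_measurable (\<Pi>\<^sub>M i\<in>{..<t}. P)"
    unfolding G_def using P.borel_measurable_nn_integral[OF measurable_next_section[OF gP]] by simp
  then have G: "G \<in> borel_measurable (\<Pi>\<^sub>M i\<in>{..<t}. M)" by (simp cong: measurable_cong_sets add: setsI)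
  have "AE \<omega> in (\<Pi>\<^sub>M i\<in>UNIV. P). G (first_obs t \<omega>) = nn_cond_exp (\<Pi>\<^sub>M i\<in>UNIV. P) (obs_filtration M (enat t))
      (\<lambda>\<omega>'. g (first_obs (Suc t) \<omega>')) \<omega>"
  proof (rule nn_cond_exp_charact)
    fix A assume "A \<in> sets (obs_filtration M (enat t))"
    then obtain B where B: "B \<in> sets (\<Pi>\<^sub>M i\<in>{..<t}. P)" "A = first_obs t -` B \<inter> space (\<Pi>\<^sub>M i\<in>UNIV. M)"
      by (auto simp: sets_obs_filtration setsI)
    have B'[measurable]: "(\<lambda>xs. indicator B (first_obs t xs) :: ennreal) \<in> borel_measurable (\<Pi>\<^sub>M i\<in>{..<Suc t}. P)"
      using measurable_compose[OF measurable_first_obs_le[of t "Suc t" P] borel_measurable_indicator[OF B(1)]] by simp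
    note [measurable] = gP GP B(1)
    have ind: "indicator A \<omega> = (indicator B (first_obs t \<omega>) :: ennreal)" if "\<omega> \<in> space (\<Pi>\<^sub>M i\<in>UNIV. P)" for \<omega>
      using that B(2) by (auto simp: spI indicator_def)
    have "(\<integral>\<^sup>+\<omega>\<in>A. g (first_obs (Suc t) \<omega>) \<partial>(\<Pi>\<^sub>M i\<in>UNIV. P))
       = (\<integral>\<^sup>+\<omega>. g (first_obs (Suc t) \<omega>) * indicator B (first_obs t (first_obs (Suc t) \<omega>)) \<partial>(\<Pi>\<^sub>M i\<in>UNIV. P))"
      by (intro nn_integral_cong) (simp add: ind first_obs_first_obs)
    also have "\<dots> = (\<integral>\<^sup>+xs. g xs * indicator B (first_obs t xs) \<partial>(\<Pi>\<^sub>M i\<in>{..<Suc t}. P))"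
      by (rule nn_integral_first_obs[OF P]) measurable
    also have "\<dots> = (\<integral>\<^sup>+xs. \<integral>\<^sup>+x. g (xs(t := x)) * indicator B (first_obs t (xs(t := x))) \<partial>P \<partial>(\<Pi>\<^sub>M i\<in>{..<t}. P))"
      by (rule nn_integral_PiM_lessThan_Suc[OF P.sigma_finite_measure_axioms]) measurable
    also have "\<dots> = (\<integral>\<^sup>+xs. G xs * indicator B xs \<partial>(\<Pi>\<^sub>M i\<in>{..<t}. P))"
    proof (rule nn_integral_cong)
      fix xs assume xs: "xs \<in> space (\<Pi>\<^sub>M i\<in>{..<t}. P)"
      have [measurable]: "(\<lambda>x. g (xs(t := x))) \<in> borel_measurable P"
        using measurable_compose[OF measurable_Pair1'[OF xs] measurable_next_section[OF gP]] by simp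
      show "(\<integral>\<^sup>+x. g (xs(t := x)) * indicator B (first_obs t (xs(t := x))) \<partial>P) = G xs * indicator B xs"
        unfolding first_obs_upd first_obs_id[OF xs] G_def by (rule nn_integral_multc) measurable
    qed
    also have "\<dots> = (\<integral>\<^sup>+\<omega>. G (first_obs t \<omega>) * indicator B (first_obs t \<omega>) \<partial>(\<Pi>\<^sub>M i\<in>UNIV. P))"
      by (rule nn_integral_first_obs[OF P, symmetric]) measurable
    also have "\<dots> = (\<integral>\<^sup>+\<omega>\<in>A. G (first_obs t \<omega>) \<partial>(\<Pi>\<^sub>M i\<in>UNIV. P))"
      by (intro nn_integral_cong) (simp add: ind)
    finally show "(\<integral>\<^sup>+\<omega>\<in>A. g (first_obs (Suc t) \<omega>) \<partial>(\<Pi>\<^sub>M i\<in>UNIV. P)) = (\<integral>\<^sup>+\<omega>\<in>A. G (first_obs t \<omega>) \<partial>(\<Pi>\<^sub>M i\<in>UNIV. P))" .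
  next
    show "(\<lambda>\<omega>. g (first_obs (Suc t) \<omega>)) \<in> borel_measurable (\<Pi>\<^sub>M i\<in>UNIV. P)"
      by (rule measurable_compose[OF measurable_first_obs gP])
    show "(\<lambda>\<omega>. G (first_obs t \<omega>)) \<in> borel_measurable (obs_filtration M (enat t))"
      by (rule measurable_compose[OF measurable_first_obs_filtration G])
  qed
  then show ?thesis by eventually_elim (simp add: G_def)
qed

text \<open>
  This turns the condition on conditional expectations over infinite sequences into one on finite
  pasts, where it can be handled with densities.
\<close>

lemma supermartingale_step_iff:
  assumes P: "prob_space P" and sets: "sets P = sets M" and g: "g \<in> borel_measurable (\<Pi>\<^sub>M i\<in>{..<Suc t}. M)"
    and f: "f \<in> borel_measurable (\<Pi>\<^sub>M i\<in>{..<t}. M)"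
  shows "(AE \<omega> in (\<Pi>\<^sub>M i\<in>UNIV. P). nn_cond_exp (\<Pi>\<^sub>M i\<in>UNIV. P) (obs_filtration M (enat t))
      (\<lambda>\<omega>'. g (first_obs (Suc t) \<omega>')) \<omega> \<le> f (first_obs t \<omega>)) \<longleftrightarrow>
     (AE xs in (\<Pi>\<^sub>M i\<in>{..<t}. P). (\<integral>\<^sup>+ x. g (xs(t := x)) \<partial>P) \<le> f xs)" (is "?L \<longleftrightarrow> _")
proof -
  interpret P: prob_space P by fact
  have setsI: "sets (\<Pi>\<^sub>M i\<in>I. P) = sets (\<Pi>\<^sub>M i\<in>I. M)" for I :: "nat set"
    by (intro sets_PiM_cong refl sets)
  have gP: "g \<in> borel_measurable (\<Pi>\<^sub>M i\<in>{..<Suc t}. P)" and fP[measurable]: "f \<in> borel_measurable (\<Pi>\<^sub>M i\<in>{..<t}. P)"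
    using g f by (simp_all cong: measurable_cong_sets add: setsI)
  have [measurable]: "(\<lambda>xs. \<integral>\<^sup>+ x. g (xs(t := x)) \<partial>P) \<in> borel_measurable (\<Pi>\<^sub>M i\<in>{..<t}. P)"
    using P.borel_measurable_nn_integral[OF measurable_next_section[OF gP]] by simp
  have "?L \<longleftrightarrow> (AE \<omega> in (\<Pi>\<^sub>M i\<in>UNIV. P). (\<integral>\<^sup>+ x. g ((first_obs t \<omega>)(t := x)) \<partial>P) \<le> f (first_obs t \<omega>))"
    using nn_cond_exp_next_obs[OF P sets g] by (intro eventually_subst, eventually_elim) simp
  also have "\<dots> \<longleftrightarrow> (AE xs in distr (\<Pi>\<^sub>M i\<in>UNIV. P) (\<Pi>\<^sub>M i\<in>{..<t}. P) (first_obs t). (\<integral>\<^sup>+ x. g (xs(t := x)) \<partial>P) \<le> f xs)"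
    by (subst AE_distr_iff) (auto intro: measurable_first_obs)
  finally show ?thesis unfolding distr_first_obs[OF P] .
qed

text \<open>
  The factor \<open>g\<close> evaluates \<open>h\<close> at the completion of a past by a constant sequence; this does not change
  the value, because the preimages of points under \<open>h\<close> are events of the past.
\<close>

lemma obs_measurable_factor:
  fixes h :: "(nat \<Rightarrow> 'x) \<Rightarrow> ennreal"
  assumes h: "h \<in> borel_measurable (obs_filtration M (enat t))" and ne: "space M \<noteq> {}"
  obtains g where "g \<in> borel_measurable (\<Pi>\<^sub>M i\<in>{..<t}. M)"
    "\<And>\<omega>. \<omega> \<in> space (\<Pi>\<^sub>M i\<in>UNIV. M) \<Longrightarrow> h \<omega> = g (first_obs t \<omega>)"
proof -
  obtain x0 where x0: "x0 \<in> space M" using ne by blast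
  define ext where "ext xs = (\<lambda>i. if i < t then xs i else x0)" for xs :: "nat \<Rightarrow> 'x"
  have ext: "ext \<in> (\<Pi>\<^sub>M i\<in>{..<t}. M) \<rightarrow>\<^sub>M (\<Pi>\<^sub>M i\<in>UNIV. M)"
    unfolding ext_def
  proof (rule measurable_PiM_single')
    fix i :: nat
    show "(\<lambda>xs. if i < t then xs i else x0) \<in> (\<Pi>\<^sub>M i\<in>{..<t}. M) \<rightarrow>\<^sub>M M"
      using x0 by (cases "i < t") simp_all
  next
    show "(\<lambda>xs i. if i < t then xs i else x0) \<in> space (\<Pi>\<^sub>M i\<in>{..<t}. M) \<rightarrow> (\<Pi>\<^sub>E i\<in>UNIV. space M)"
      using x0 by (simp add: space_PiM Pi_iff PiE_iff)
  qed
  have const: "h \<omega> = h \<omega>'"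
    if "\<omega> \<in> space (\<Pi>\<^sub>M i\<in>UNIV. M)" "\<omega>' \<in> space (\<Pi>\<^sub>M i\<in>UNIV. M)" "first_obs t \<omega> = first_obs t \<omega>'" for \<omega> \<omega>'
  proof -
    have "h -` {h \<omega>} \<inter> space (\<Pi>\<^sub>M i\<in>UNIV. M) \<in> sets (obs_filtration M (enat t))"
      using measurable_sets[OF h borel_singleton[OF sets.empty_sets], of "h \<omega>"] unfolding space_obs_filtration .
    then obtain B where B: "h -` {h \<omega>} \<inter> space (\<Pi>\<^sub>M i\<in>UNIV. M) = first_obs t -` B \<inter> space (\<Pi>\<^sub>M i\<in>UNIV. M)"
      unfolding sets_obs_filtration by blast
    have "\<omega> \<in> h -` {h \<omega>} \<inter> space (\<Pi>\<^sub>M i\<in>UNIV. M)" using that(1) by simp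
    then have "\<omega>' \<in> first_obs t -` B \<inter> space (\<Pi>\<^sub>M i\<in>UNIV. M)" unfolding B using that(2,3) by simp
    then show ?thesis unfolding B[symmetric] by simp
  qed
  show thesis
  proof (rule that)
    show "(\<lambda>xs. h (ext xs)) \<in> borel_measurable (\<Pi>\<^sub>M i\<in>{..<t}. M)"
      by (rule measurable_compose[OF ext measurable_from_subalg[OF subalgebra_obs_filtration h]])
    fix \<omega> :: "nat \<Rightarrow> 'x" assume \<omega>: "\<omega> \<in> space (\<Pi>\<^sub>M i\<in>UNIV. M)"
    show "h \<omega> = h (ext (first_obs t \<omega>))"
    proof (rule const[OF \<omega>])
      show "ext (first_obs t \<omega>) \<in> space (\<Pi>\<^sub>M i\<in>UNIV. M)"
        using measurable_space[OF ext] measurable_space[OF measurable_first_obs \<omega>] by blast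
      show "first_obs t \<omega> = first_obs t (ext (first_obs t \<omega>))"
        by (auto simp: ext_def first_obs_def restrict_def fun_eq_iff)
    qed
  qed
qed

lemma stopped_0: "stopped E \<tau> 0 \<omega> = E 0 (first_obs 0 \<omega>)"
  by (cases "\<tau> \<omega>") (simp_all add: stopped_def)

lemma stopped_running: "enat t \<le> \<tau> \<omega> \<Longrightarrow> stopped E \<tau> t \<omega> = E t (first_obs t \<omega>)"
  by (simp add: stopped_def min_absorb1)

lemma stopped_Suc:
  "stopped E \<tau> (Suc t) \<omega> = (if \<tau> \<omega> \<le> enat t then stopped E \<tau> t \<omega> else E (Suc t) (first_obs (Suc t) \<omega>))"
proof (cases "\<tau> \<omega> \<le> enat t")
  case True
  then have "\<tau> \<omega> \<le> enat (Suc t)" by (rule order_trans) simp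
  with True show ?thesis by (simp add: stopped_def min_absorb2)
next
  case False
  then have "enat (Suc t) \<le> \<tau> \<omega>" by (cases "\<tau> \<omega>") auto
  with False show ?thesis by (simp add: stopped_running)
qed

lemma stopped_measurable:
  assumes \<tau>: "stopping_time (obs_filtration M) \<tau>" and E: "\<And>t. E t \<in> borel_measurable (\<Pi>\<^sub>M i\<in>{..<t}. M)"
  shows "stopped E \<tau> t \<in> borel_measurable (obs_filtration M (enat t))"
proof (induction t)
  case 0
  show ?case unfolding stopped_0[abs_def] by (rule measurable_compose[OF measurable_first_obs_filtration E])
next
  case (Suc t)
  have sub: "subalgebra (obs_filtration M (enat (Suc t))) (obs_filtration M (enat t))"
    by (rule subalgebra_obs_filtration_mono) simp
  have "Measurable.pred (obs_filtration M (enat t)) (\<lambda>\<omega>. \<tau> \<omega> \<le> enat t)"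
    using \<tau> by (auto simp: stopping_time_def)
  then have 1: "Measurable.pred (obs_filtration M (enat (Suc t))) (\<lambda>\<omega>. \<tau> \<omega> \<le> enat t)"
    by (rule measurable_from_subalg[OF sub])
  show ?case unfolding stopped_Suc[abs_def]
    by (intro measurable_If 1 measurable_from_subalg[OF sub Suc] measurable_compose[OF measurable_first_obs_filtration E])
       (use 1 in \<open>auto simp: pred_def\<close>)
qed

section \<open>Logarithms and expectations with infinite values\<close>

lemma ratio_rearrange:
  fixes a e z i q s :: ennreal
  assumes "0 < e" "e < \<infinity>" "0 < q" "q < \<infinity>" "0 < s" "s < \<infinity>"
  shows "a / (e * (q / s)) * i * (z * q) = (i * z / e) * (a * s)"
proof -
  obtain e' q' s' where r: "e = ennreal e'" "q = ennreal q'" "s = ennreal s'" "0 < e'" "0 < q'" "0 < s'"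
    using assms by (cases e; cases q; cases s) auto
  have inv: "inverse (e * (q / s)) * q = inverse e * s"
    using r by (simp add: divide_ennreal inverse_ennreal flip: ennreal_mult) (simp add: field_simps)
  have "a / (e * (q / s)) * i * (z * q) = a * i * z * (inverse (e * (q / s)) * q)"
    by (simp add: divide_ennreal_def ac_simps)
  also have "\<dots> = (i * z / e) * (a * s)"
    unfolding inv by (simp add: divide_ennreal_def ac_simps)
  finally show ?thesis .
qed

lemma elog_measurable[measurable]: "elog \<in> borel_measurable borel"
  unfolding elog_def by measurable

lemma e2ennreal_MInfty: "e2ennreal (- \<infinity>) = 0"
  by (simp add: e2ennreal_neg)

text \<open>
  Versions of \<open>ln (y / z) \<le> y / z - 1\<close> that avoid subtraction by separating positive and negative
  parts, so that they remain meaningful for infinite values and can be integrated termwise.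
\<close>

lemma elog_ratio_bounds:
  assumes z: "0 < z" "z < \<infinity>"
  shows "e2ennreal (elog y) + e2ennreal (- elog z) + 1 \<le> e2ennreal (elog z) + e2ennreal (- elog y) + y / z"
    and "e2ennreal (elog y) \<le> e2ennreal (elog z) + y / z"
    and "e2ennreal (- elog z) \<le> 1 / z"
proof -
  obtain c where c: "z = ennreal c" "0 < c" using z by (cases z) auto
  have ez: "elog z = ereal (ln c)" using c by (simp add: elog_def)
  have pn: "e2ennreal (ereal r) = ennreal r" "e2ennreal (- ereal r) = ennreal (- r)" for r
    by (simp_all add: e2ennreal_ereal)
  consider "y = 0" | "y = \<infinity>" | b where "y = ennreal b" "0 < b"
    by (cases y) (auto simp: less_le)
  note cases = this
  show "e2ennreal (elog y) + e2ennreal (- elog z) + 1 \<le> e2ennreal (elog z) + e2ennreal (- elog y) + y / z"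
  proof (cases rule: cases)
    case 1
    then show ?thesis by (simp add: elog_def e2ennreal_MInfty)
  next
    case 2
    then show ?thesis using c by (simp add: elog_def ennreal_top_divide e2ennreal_MInfty)
  next
    case (3 b)
    have "ln b - ln c \<le> b / c - 1" using ln_le_minus_one[of "b / c"] 3 c by (simp add: ln_div)
    then have "max 0 (ln b) + max 0 (- ln c) + 1 \<le> max 0 (ln c) + max 0 (- ln b) + b / c" by linarith
    then have "ennreal (max 0 (ln b) + max 0 (- ln c) + 1) \<le> ennreal (max 0 (ln c) + max 0 (- ln b) + b / c)"
      by (rule ennreal_leI)
    moreover have "elog y = ereal (ln b)" using 3 by (simp add: elog_def)
    ultimately show ?thesis
      using 3 c unfolding ez by (simp only: pn) (simp add: divide_ennreal ennreal_plus flip: max_def)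
  qed
  show "e2ennreal (elog y) \<le> e2ennreal (elog z) + y / z"
  proof (cases rule: cases)
    case 1
    then show ?thesis by (simp add: elog_def e2ennreal_MInfty)
  next
    case 2
    then show ?thesis using c by (simp add: elog_def ennreal_top_divide e2ennreal_MInfty)
  next
    case (3 b)
    have "ln b - ln c \<le> b / c - 1" using ln_le_minus_one[of "b / c"] 3 c by (simp add: ln_div)
    moreover have "0 \<le> b / c" using 3 c by simp
    ultimately have "max 0 (ln b) \<le> max 0 (ln c) + b / c" by linarith
    then have "ennreal (max 0 (ln b)) \<le> ennreal (max 0 (ln c) + b / c)"
      by (rule ennreal_leI)
    moreover have "elog y = ereal (ln b)" using 3 by (simp add: elog_def)
    ultimately show ?thesis
      using 3 c unfolding ez by (simp only: pn) (simp add: divide_ennreal ennreal_plus flip: max_def)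
  qed
  have "- ln c \<le> 1 / c" using ln_le_minus_one[of "1 / c"] c by (simp add: ln_div)
  then show "e2ennreal (- elog z) \<le> 1 / z"
    unfolding ez pn using c divide_ennreal[of 1 c] by (simp add: ennreal_leI)
qed

lemma eexpect_cong_AE: "AE x in M. f x = g x \<Longrightarrow> eexpect M f = eexpect M g"
proof -
  assume eq: "AE x in M. f x = g x"
  have "(\<integral>\<^sup>+ x. e2ennreal (f x) \<partial>M) = (\<integral>\<^sup>+ x. e2ennreal (g x) \<partial>M)"
    "(\<integral>\<^sup>+ x. e2ennreal (- f x) \<partial>M) = (\<integral>\<^sup>+ x. e2ennreal (- g x) \<partial>M)"
    using eq by (auto intro!: nn_integral_cong_AE)
  then show ?thesis by (simp add: eexpect_def)
qed

text \<open>
  An integral with extended values is a difference of two nonnegative integrals.  These relate the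
  positive and the negative part of such a difference to its two terms.
\<close>

lemma pos_part_diff_le: "a \<le> e2ennreal (enn2ereal a - enn2ereal b) + b"
  and pos_part_diff_le': "a < \<infinity> \<Longrightarrow> e2ennreal (enn2ereal a - enn2ereal b) \<le> a"
  and pos_neg_part_diff: "a < \<infinity> \<Longrightarrow>
    e2ennreal (enn2ereal a - enn2ereal b) + b = e2ennreal (- (enn2ereal a - enn2ereal b)) + a"
proof -
  have *: "(a \<le> e2ennreal (enn2ereal a - enn2ereal b) + b) \<and> (a < \<infinity> \<longrightarrow> e2ennreal (enn2ereal a - enn2ereal b) \<le> a
    \<and> e2ennreal (enn2ereal a - enn2ereal b) + b = e2ennreal (- (enn2ereal a - enn2ereal b)) + a)"
  proof (cases a)
    case a: (real r)
    show ?thesis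
    proof (cases b)
      case b: (real r')
      have 1: "enn2ereal a - enn2ereal b = ereal (r - r')" using a b by (simp add: enn2ereal_ennreal)
      have pn: "e2ennreal (ereal u) = ennreal u" "e2ennreal (- ereal u) = ennreal (- u)" for u
        by (simp_all add: e2ennreal_ereal)
      show ?thesis unfolding 1 pn using a b
        by (cases "r \<le> r'") (auto simp: ennreal_neg simp flip: ennreal_plus)
    next
      case top
      with a show ?thesis by (simp add: enn2ereal_ennreal e2ennreal_MInfty)
    qed
  next
    case top
    then show ?thesis by (cases b) (auto simp: enn2ereal_ennreal e2ennreal_MInfty)
  qed
  show "a \<le> e2ennreal (enn2ereal a - enn2ereal b) + b" using * by blast
  show "e2ennreal (enn2ereal a - enn2ereal b) \<le> a" if "a < \<infinity>" using * that by blast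
  show "e2ennreal (enn2ereal a - enn2ereal b) + b = e2ennreal (- (enn2ereal a - enn2ereal b)) + a"
    if "a < \<infinity>" using * that by blast
qed

text \<open>
  With \<open>eexpect_difference\<close> below, this is Fubini's theorem for the iterated expectation in the growth:
  \<open>a\<close> and \<open>b\<close> are the inner integrals of the positive and the negative part.
\<close>

lemma eexpect_difference_infinite:
  assumes [measurable]: "a \<in> borel_measurable M" "b \<in> borel_measurable M"
    and a: "(\<integral>\<^sup>+ x. a x \<partial>M) = \<infinity>" and b: "(\<integral>\<^sup>+ x. b x \<partial>M) < \<infinity>"
  shows "eexpect M (\<lambda>x. enn2ereal (a x) - enn2ereal (b x)) = \<infinity>"
proof -
  have "(\<integral>\<^sup>+ x. a x \<partial>M) \<le> (\<integral>\<^sup>+ x. e2ennreal (enn2ereal (a x) - enn2ereal (b x)) + b x \<partial>M)"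
    by (intro nn_integral_mono pos_part_diff_le)
  also have "\<dots> = (\<integral>\<^sup>+ x. e2ennreal (enn2ereal (a x) - enn2ereal (b x)) \<partial>M) + (\<integral>\<^sup>+ x. b x \<partial>M)"
    by (intro nn_integral_add) measurable
  finally have "(\<integral>\<^sup>+ x. e2ennreal (enn2ereal (a x) - enn2ereal (b x)) \<partial>M) = \<infinity>"
    using a b by (auto simp: top_unique)
  then show ?thesis by (simp add: eexpect_def)
qed

lemma enn2ereal_diff_le_iff:
  assumes "a < \<infinity>" "c < \<infinity>" "a + d \<le> c + b" "d < \<infinity>"
  shows "enn2ereal a - enn2ereal b \<le> enn2ereal c - enn2ereal d"
proof -
  obtain r s u where r: "a = ennreal r" "c = ennreal s" "d = ennreal u" "0 \<le> r" "0 \<le> s" "0 \<le> u"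
    using assms by (cases a; cases c; cases d) auto
  show ?thesis
  proof (cases b)
    case (real v)
    then have "r + u \<le> s + v" using assms(3) r by (simp flip: ennreal_plus)
    then show ?thesis using r real by (simp add: enn2ereal_ennreal)
  next
    case top
    then show ?thesis using r by (simp add: enn2ereal_ennreal)
  qed
qed

lemma eexpect_difference:
  assumes [measurable]: "a \<in> borel_measurable M" "b \<in> borel_measurable M"
    and a: "(\<integral>\<^sup>+ x. a x \<partial>M) < \<infinity>"
  shows "eexpect M (\<lambda>x. enn2ereal (a x) - enn2ereal (b x)) = enn2ereal (\<integral>\<^sup>+ x. a x \<partial>M) - enn2ereal (\<integral>\<^sup>+ x. b x \<partial>M)"
proof -
  define u where "u x = e2ennreal (enn2ereal (a x) - enn2ereal (b x))" for x
  define v where "v x = e2ennreal (- (enn2ereal (a x) - enn2ereal (b x)))" for x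
  have [measurable]: "u \<in> borel_measurable M" "v \<in> borel_measurable M" unfolding u_def v_def by measurable
  have fin: "AE x in M. a x \<noteq> \<infinity>" using a by (intro nn_integral_noteq_infinite) auto
  have "(\<integral>\<^sup>+ x. u x \<partial>M) \<le> (\<integral>\<^sup>+ x. a x \<partial>M)"
    using fin by (intro nn_integral_mono_AE, eventually_elim) (simp add: u_def pos_part_diff_le' less_top)
  then have u: "(\<integral>\<^sup>+ x. u x \<partial>M) < \<infinity>" using a by (rule le_less_trans)
  have "(\<integral>\<^sup>+ x. u x + b x \<partial>M) = (\<integral>\<^sup>+ x. v x + a x \<partial>M)"
    using fin by (intro nn_integral_cong_AE, eventually_elim)
      (unfold u_def v_def, rule pos_neg_part_diff, simp add: less_top)
  then have eq: "(\<integral>\<^sup>+ x. u x \<partial>M) + (\<integral>\<^sup>+ x. b x \<partial>M) = (\<integral>\<^sup>+ x. v x \<partial>M) + (\<integral>\<^sup>+ x. a x \<partial>M)"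
    by (simp add: nn_integral_add)
  obtain r s where r: "(\<integral>\<^sup>+ x. u x \<partial>M) = ennreal r" "(\<integral>\<^sup>+ x. a x \<partial>M) = ennreal s" "0 \<le> r" "0 \<le> s"
    using u a by (cases "\<integral>\<^sup>+ x. u x \<partial>M"; cases "\<integral>\<^sup>+ x. a x \<partial>M") auto
  have "enn2ereal (\<integral>\<^sup>+ x. u x \<partial>M) - enn2ereal (\<integral>\<^sup>+ x. v x \<partial>M) = enn2ereal (\<integral>\<^sup>+ x. a x \<partial>M) - enn2ereal (\<integral>\<^sup>+ x. b x \<partial>M)"
    using eq unfolding r
    by (cases "\<integral>\<^sup>+ x. v x \<partial>M"; cases "\<integral>\<^sup>+ x. b x \<partial>M")
       (use r(3,4) in \<open>auto simp: enn2ereal_ennreal simp flip: ennreal_plus\<close>)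
  then show ?thesis by (simp add: eexpect_def u_def v_def)
qed

section \<open>Priors, predictive densities and their projections\<close>

text \<open>
  Draw from one of the two priors according to the outcome of a coin toss.
\<close>

lemma convex_combination_prior:
  assumes W: "W \<in> priors T A" and V: "V \<in> priors T A" and A: "A \<in> sets T" and a: "0 \<le> a" "a \<le> 1"
  obtains U where "U \<in> priors T A"
    "\<And>f. f \<in> borel_measurable T \<Longrightarrow>
      (\<integral>\<^sup>+ \<theta>. f \<theta> \<partial>U) = ennreal (1 - a) * (\<integral>\<^sup>+ \<theta>. f \<theta> \<partial>W) + ennreal a * (\<integral>\<^sup>+ \<theta>. f \<theta> \<partial>V)"
proof -
  define K where "K b = (if b then V else W)" for b
  define N where "N = measure_pmf (bernoulli_pmf a)"
  interpret N: prob_space N unfolding N_def by (rule measure_pmf.prob_space_axioms)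
  have K: "K b \<in> priors T A" for b using W V by (simp add: K_def)
  have Km: "K \<in> N \<rightarrow>\<^sub>M subprob_algebra T"
    using K by (auto simp: N_def priors_def space_subprob_algebra intro: prob_space_imp_subprob_space)
  show thesis
  proof (rule that)
    have "prob_space (N \<bind> K)"
      using K by (intro N.prob_space_bind[OF _ Km]) (simp add: priors_def)
    moreover have "sets (N \<bind> K) = sets T"
      using K by (intro sets_bind) (auto simp: priors_def N.not_empty)
    moreover have "AE \<theta> in N \<bind> K. \<theta> \<in> A"
      using K A by (subst AE_bind[OF Km]) (auto simp: priors_def)
    ultimately show "N \<bind> K \<in> priors T A" by (simp add: priors_def)
    show "(\<integral>\<^sup>+ \<theta>. f \<theta> \<partial>(N \<bind> K)) = ennreal (1 - a) * (\<integral>\<^sup>+ \<theta>. f \<theta> \<partial>W) + ennreal a * (\<integral>\<^sup>+ \<theta>. f \<theta> \<partial>V)"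
      if "f \<in> borel_measurable T" for f
      using a by (subst nn_integral_bind[OF that Km]) (simp add: N_def K_def mult.commute add.commute)
  qed
qed

lemma return_prior:
  "\<theta> \<in> A \<Longrightarrow> A \<in> sets T \<Longrightarrow> return T \<theta> \<in> priors T A"
  using sets.sets_into_space[of A T] by (auto simp: priors_def AE_return intro!: prob_space_return)

locale poe_setting =
  fixes \<mu> :: "'x measure" and T :: "'p measure" and p :: "'p \<Rightarrow> 'x \<Rightarrow> real"
    and \<Theta>\<^sub>0 \<Theta>\<^sub>1 :: "'p set" and \<pi> :: "'p measure"
    and W\<^sub>0 :: "nat \<Rightarrow> (nat \<Rightarrow> 'x) \<Rightarrow> 'p measure"
  assumes reference: "sigma_finite_measure \<mu>"
    and density_measurable: "(\<lambda>(\<theta>, x). p \<theta> x) \<in> borel_measurable (T \<Otimes>\<^sub>M \<mu>)"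
    and density_nonneg: "\<And>\<theta> x. \<theta> \<in> space T \<Longrightarrow> x \<in> space \<mu> \<Longrightarrow> 0 \<le> p \<theta> x"
    and distributions: "\<And>\<theta>. \<theta> \<in> space T \<Longrightarrow> prob_space (density \<mu> (\<lambda>x. ennreal (p \<theta> x)))"
    and hypotheses: "\<Theta>\<^sub>0 \<in> sets T" "\<Theta>\<^sub>1 \<in> sets T"
    and prior: "\<pi> \<in> priors T \<Theta>\<^sub>1"
    and full_support: "\<And>t xs x. xs \<in> space (\<Pi>\<^sub>M i\<in>{..<t}. \<mu>) \<Longrightarrow> x \<in> space \<mu> \<Longrightarrow>
          0 < mix_density p (posterior p \<pi> t xs) x"
    and finite_inf: "\<And>t xs. xs \<in> space (\<Pi>\<^sub>M i\<in>{..<t}. \<mu>) \<Longrightarrow>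
          (INF W\<in>priors T \<Theta>\<^sub>0. KL (mixture \<mu> p (posterior p \<pi> t xs)) (mixture \<mu> p W)) < \<infinity>"
    and projection: "\<And>t xs. xs \<in> space (\<Pi>\<^sub>M i\<in>{..<t}. \<mu>) \<Longrightarrow>
          is_arg_min (\<lambda>W. KL (mixture \<mu> p (posterior p \<pi> t xs)) (mixture \<mu> p W))
            (\<lambda>W. W \<in> priors T \<Theta>\<^sub>0) (W\<^sub>0 t xs)"
    and projection_measurable: "\<And>t. (\<lambda>(xs, x). mix_density p (W\<^sub>0 t xs) x)
          \<in> borel_measurable ((\<Pi>\<^sub>M i\<in>{..<t}. \<mu>) \<Otimes>\<^sub>M \<mu>)"
    and KL_finite: "\<And>\<theta> \<theta>'. \<theta> \<in> \<Theta>\<^sub>0 \<union> \<Theta>\<^sub>1 \<Longrightarrow> \<theta>' \<in> \<Theta>\<^sub>0 \<union> \<Theta>\<^sub>1 \<Longrightarrow>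
          KL (density \<mu> (\<lambda>x. ennreal (p \<theta> x))) (density \<mu> (\<lambda>x. ennreal (p \<theta>' x))) < \<infinity>"
begin

abbreviation P :: "'p \<Rightarrow> 'x measure" where "P \<theta> \<equiv> density \<mu> (\<lambda>x. ennreal (p \<theta> x))"

abbreviation past :: "nat \<Rightarrow> (nat \<Rightarrow> 'x) measure" where "past t \<equiv> (\<Pi>\<^sub>M i\<in>{..<t}. \<mu>)"

definition predictive :: "nat \<Rightarrow> (nat \<Rightarrow> 'x) \<Rightarrow> 'x \<Rightarrow> ennreal" where
  "predictive t xs x = mix_density p (posterior p \<pi> t xs) x"

definition projected :: "nat \<Rightarrow> (nat \<Rightarrow> 'x) \<Rightarrow> 'x \<Rightarrow> ennreal" where
  "projected t xs x = mix_density p (W\<^sub>0 t xs) x"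

definition lik :: "nat \<Rightarrow> 'p \<Rightarrow> (nat \<Rightarrow> 'x) \<Rightarrow> ennreal" where
  "lik t \<theta> xs = ennreal (\<Prod>i<t. p \<theta> (xs i))"

text \<open>
  The density of the past under the Bayesian mixture, that is, the normalising constant of the
  posterior.
\<close>

definition evidence :: "nat \<Rightarrow> (nat \<Rightarrow> 'x) \<Rightarrow> ennreal" where
  "evidence t xs = (\<integral>\<^sup>+ \<theta>. lik t \<theta> xs \<partial>\<pi>)"

definition E :: "nat \<Rightarrow> (nat \<Rightarrow> 'x) \<Rightarrow> ennreal" where
  "E t xs = (\<Prod>i<t. predictive i (first_obs i xs) (xs i) / projected i (first_obs i xs) (xs i))"

sublocale \<mu>: sigma_finite_measure \<mu> by (rule reference)
sublocale pasts: product_sigma_finite "\<lambda>_. \<mu>" by (simp add: product_sigma_finite_def reference)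
sublocale \<pi>: prob_space \<pi> using prior by (simp add: priors_def)

lemma past_sigma_finite: "sigma_finite_measure (past t)"
  by (rule pasts.sigma_finite) simp

lemma sets_\<pi>[measurable_cong]: "sets \<pi> = sets T" using prior by (simp add: priors_def)
lemma space_\<pi>: "space \<pi> = space T" using sets_\<pi> by (rule sets_eq_imp_space_eq)

lemma prior_in: "AE \<theta> in \<pi>. \<theta> \<in> \<Theta>\<^sub>1" using prior by (simp add: priors_def)

lemma \<Theta>_space: "\<theta> \<in> \<Theta>\<^sub>0 \<union> \<Theta>\<^sub>1 \<Longrightarrow> \<theta> \<in> space T"
  using hypotheses sets.sets_into_space by blast

lemma space_T_nonempty: "space T \<noteq> {}" using \<pi>.not_empty by (simp add: space_\<pi>)

lemma space_\<mu>_nonempty: "space \<mu> \<noteq> {}"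
proof -
  obtain \<theta> where "\<theta> \<in> space T" using space_T_nonempty by blast
  from prob_space.not_empty[OF distributions[OF this]] show ?thesis by simp
qed

lemma ennreal_density_measurable[measurable]:
  "(\<lambda>(\<theta>, x). ennreal (p \<theta> x)) \<in> borel_measurable (T \<Otimes>\<^sub>M \<mu>)"
  using measurable_compose[OF density_measurable measurable_ennreal] by (simp add: case_prod_beta')

lemma density_section[measurable (raw)]:
  "\<theta> \<in> space T \<Longrightarrow> (\<lambda>x. ennreal (p \<theta> x)) \<in> borel_measurable \<mu>"
  using measurable_compose[OF measurable_Pair1' ennreal_density_measurable] by simp

lemma density_section_\<theta>:
  "x \<in> space \<mu> \<Longrightarrow> (\<lambda>\<theta>. ennreal (p \<theta> x)) \<in> borel_measurable T"
  using measurable_compose[OF measurable_Pair2' ennreal_density_measurable] by simp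

lemma density_integral: "\<theta> \<in> space T \<Longrightarrow> (\<integral>\<^sup>+ x. ennreal (p \<theta> x) \<partial>\<mu>) = 1"
  using prob_space.emeasure_space_1[OF distributions] by (simp add: emeasure_density cong: nn_integral_cong)

lemma lik_0: "lik 0 \<theta> xs = 1" by (simp add: lik_def)

lemma lik_prod:
  assumes "\<theta> \<in> space T" "xs \<in> space (past t)"
  shows "lik t \<theta> xs = (\<Prod>i<t. ennreal (p \<theta> (xs i)))"
  unfolding lik_def using assms density_nonneg by (subst prod_ennreal) (auto simp: space_PiM)

lemma lik_Suc:
  assumes "\<theta> \<in> space T" "xs \<in> space (past t)" "x \<in> space \<mu>"
  shows "lik (Suc t) \<theta> (xs(t := x)) = lik t \<theta> xs * ennreal (p \<theta> x)"
proof -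
  have "0 \<le> (\<Prod>i<t. p \<theta> (xs i))"
    using assms density_nonneg by (intro prod_nonneg) (auto simp: space_PiM)
  then show ?thesis using assms density_nonneg by (simp add: lik_def ennreal_mult)
qed

lemma lik_measurable: "(\<lambda>(xs, \<theta>). lik t \<theta> xs) \<in> borel_measurable (past t \<Otimes>\<^sub>M T)"
proof -
  have "(\<lambda>z. p (snd z) (fst z i)) \<in> borel_measurable (past t \<Otimes>\<^sub>M T)" if "i < t" for i
  proof -
    have "(\<lambda>z. (snd z, fst z i)) \<in> past t \<Otimes>\<^sub>M T \<rightarrow>\<^sub>M T \<Otimes>\<^sub>M \<mu>"
      using that by (intro measurable_Pair measurable_snd measurable_compose[OF measurable_fst] measurable_component_singleton) auto
    from measurable_compose[OF this density_measurable] show ?thesis by simp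
  qed
  then show ?thesis unfolding lik_def case_prod_beta'
    by (intro measurable_compose[OF _ measurable_ennreal] borel_measurable_prod) auto
qed

lemma lik_section: "\<theta> \<in> space T \<Longrightarrow> lik t \<theta> \<in> borel_measurable (past t)"
  using measurable_compose[OF measurable_Pair2' lik_measurable] by simp

lemma lik_section_\<theta>: "xs \<in> space (past t) \<Longrightarrow> (\<lambda>\<theta>. lik t \<theta> xs) \<in> borel_measurable \<pi>"
  using measurable_compose[OF measurable_Pair1' lik_measurable] by (simp cong: measurable_cong_sets add: sets_\<pi>)

lemma evidence_measurable[measurable]: "evidence t \<in> borel_measurable (past t)"
proof -
  have "(\<lambda>(xs, \<theta>). lik t \<theta> xs) \<in> borel_measurable (past t \<Otimes>\<^sub>M \<pi>)"
    using lik_measurable by (simp cong: measurable_cong_sets sets_pair_measure_cong add: sets_\<pi>)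
  from \<pi>.borel_measurable_nn_integral[OF this] show ?thesis by (simp add: evidence_def[abs_def])
qed

lemma upd_in_past: "xs \<in> space (past t) \<Longrightarrow> x \<in> space \<mu> \<Longrightarrow> xs(t := x) \<in> space (past (Suc t))"
  by (auto simp: space_PiM PiE_iff extensional_def less_Suc_eq)

text \<open>
  Along a path these quotients telescope to the density of the data.
\<close>

lemma predictive_eq:
  assumes xs: "xs \<in> space (past t)" and x: "x \<in> space \<mu>"
  shows "predictive t xs x = evidence (Suc t) (xs(t := x)) / evidence t xs"
proof -
  note [measurable] = lik_section_\<theta>[OF xs] density_section_\<theta>[OF x]
  have "predictive t xs x = (\<integral>\<^sup>+ \<theta>. lik t \<theta> xs / evidence t xs * ennreal (p \<theta> x) \<partial>\<pi>)"
    unfolding predictive_def mix_density_def posterior_def evidence_def[symmetric, unfolded lik_def] lik_def[symmetric]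
    by (subst nn_integral_density) (auto simp: evidence_def)
  also have "\<dots> = (\<integral>\<^sup>+ \<theta>. lik (Suc t) \<theta> (xs(t := x)) * inverse (evidence t xs) \<partial>\<pi>)"
    using assms by (intro nn_integral_cong) (simp add: lik_Suc space_\<pi> divide_ennreal_def ac_simps)
  also have "\<dots> = evidence (Suc t) (xs(t := x)) / evidence t xs"
    using lik_section_\<theta>[OF upd_in_past[OF assms]] by (simp add: nn_integral_multc evidence_def divide_ennreal_def)
  finally show ?thesis .
qed

text \<open>
  Otherwise the posterior would be the null measure, contrary to full support.
\<close>

lemma evidence_pos_finite:
  assumes xs: "xs \<in> space (past t)"
  shows "0 < evidence t xs" "evidence t xs < \<infinity>"
proof -
  obtain x where x: "x \<in> space \<mu>" using space_\<mu>_nonempty by blast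
  have pos: "0 < evidence (Suc t) (xs(t := x)) / evidence t xs"
    using full_support[OF xs x] by (simp add: predictive_eq[OF xs x, symmetric] predictive_def)
  then show "evidence t xs < \<infinity>" by (cases "evidence t xs = \<infinity>") (auto simp: less_top)
  show "0 < evidence t xs"
  proof (rule ccontr)
    assume "\<not> 0 < evidence t xs"
    then have "AE \<theta> in \<pi>. lik t \<theta> xs = 0"
      using lik_section_\<theta>[OF xs] by (simp add: evidence_def nn_integral_0_iff_AE zero_less_iff_neq_zero)
    then have "AE \<theta> in \<pi>. lik (Suc t) \<theta> (xs(t := x)) = 0"
      using AE_space by eventually_elim (simp add: lik_Suc[OF _ xs x] space_\<pi>)
    then have "evidence (Suc t) (xs(t := x)) = 0"
      using lik_section_\<theta>[OF upd_in_past[OF xs x]] by (simp add: evidence_def nn_integral_0_iff_AE)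
    with pos show False by simp
  qed
qed

lemma evidence_Suc:
  assumes xs: "xs \<in> space (past t)" and x: "x \<in> space \<mu>"
  shows "evidence (Suc t) (xs(t := x)) = evidence t xs * predictive t xs x"
  unfolding predictive_eq[OF assms]
  using evidence_pos_finite[OF xs] by (simp add: ennreal_mult_divide_cancel)

lemma predictive_pos_finite:
  assumes xs: "xs \<in> space (past t)" and x: "x \<in> space \<mu>"
  shows "0 < predictive t xs x" "predictive t xs x < \<infinity>"
proof -
  show "0 < predictive t xs x" using full_support[OF assms] by (simp add: predictive_def)
  show "predictive t xs x < \<infinity>"
    unfolding predictive_eq[OF assms]
    using evidence_pos_finite[OF xs] evidence_pos_finite[OF upd_in_past[OF assms]]
    by (simp add: ennreal_divide_eq_top_iff zero_less_iff_neq_zero flip: less_top)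
qed

lemma predictive_measurable:
  "(\<lambda>(xs, x). predictive t xs x) \<in> borel_measurable (past t \<Otimes>\<^sub>M \<mu>)"
proof -
  have [measurable]: "(\<lambda>(xs, x). evidence (Suc t) (xs(t := x))) \<in> borel_measurable (past t \<Otimes>\<^sub>M \<mu>)"
    by (rule measurable_next_section) measurable
  have "(\<lambda>z. (case z of (xs, x) \<Rightarrow> evidence (Suc t) (xs(t := x))) / evidence t (fst z)) \<in> borel_measurable (past t \<Otimes>\<^sub>M \<mu>)"
    by measurable
  moreover have "(\<lambda>z. (case z of (xs, x) \<Rightarrow> evidence (Suc t) (xs(t := x))) / evidence t (fst z)) \<in> borel_measurable (past t \<Otimes>\<^sub>M \<mu>)
      \<longleftrightarrow> (\<lambda>(xs, x). predictive t xs x) \<in> borel_measurable (past t \<Otimes>\<^sub>M \<mu>)"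
    by (intro measurable_cong) (auto simp: predictive_eq space_pair_measure)
  ultimately show ?thesis by blast
qed

lemma projected_measurable:
  "(\<lambda>(xs, x). projected t xs x) \<in> borel_measurable (past t \<Otimes>\<^sub>M \<mu>)"
  using projection_measurable by (simp add: projected_def)

lemma predictive_section[measurable (raw)]: "xs \<in> space (past t) \<Longrightarrow> predictive t xs \<in> borel_measurable \<mu>"
  using measurable_compose[OF measurable_Pair1' predictive_measurable] by simp

lemma projected_section[measurable (raw)]: "xs \<in> space (past t) \<Longrightarrow> projected t xs \<in> borel_measurable \<mu>"
  using measurable_compose[OF measurable_Pair1' projected_measurable] by simp

text \<open>
  Fubini's theorem: a bound for each \<open>\<theta>\<close> passes to every mixture.
\<close>

lemma mix_density_nn_integral:
  assumes W: "W \<in> priors T A" and [measurable]: "h \<in> borel_measurable \<mu>"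
  shows "(\<integral>\<^sup>+ x. h x * mix_density p W x \<partial>\<mu>) = (\<integral>\<^sup>+ \<theta>. \<integral>\<^sup>+ x. h x * ennreal (p \<theta> x) \<partial>\<mu> \<partial>W)"
proof -
  interpret W: prob_space W using W by (simp add: priors_def)
  have sets_W[measurable_cong]: "sets W = sets T" using W by (simp add: priors_def)
  interpret pair_sigma_finite W \<mu> by unfold_locales
  have [measurable]: "(\<lambda>(\<theta>, x). ennreal (p \<theta> x)) \<in> borel_measurable (W \<Otimes>\<^sub>M \<mu>)"
    using ennreal_density_measurable by (simp cong: measurable_cong_sets sets_pair_measure_cong add: sets_W)
  have "(\<integral>\<^sup>+ x. h x * mix_density p W x \<partial>\<mu>) = (\<integral>\<^sup>+ x. \<integral>\<^sup>+ \<theta>. h x * ennreal (p \<theta> x) \<partial>W \<partial>\<mu>)"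
    unfolding mix_density_def using density_section_\<theta>
    by (intro nn_integral_cong nn_integral_cmult[symmetric]) (simp cong: measurable_cong_sets add: sets_W)
  also have "\<dots> = (\<integral>\<^sup>+ \<theta>. \<integral>\<^sup>+ x. h x * ennreal (p \<theta> x) \<partial>\<mu> \<partial>W)"
    by (rule Fubini') measurable
  finally show ?thesis .
qed

lemma mix_density_integral:
  assumes W: "W \<in> priors T A"
  shows "(\<integral>\<^sup>+ x. mix_density p W x \<partial>\<mu>) = 1"
proof -
  interpret W: prob_space W using W by (simp add: priors_def)
  have "space W = space T" using W by (auto simp: priors_def dest: sets_eq_imp_space_eq)
  then have "(\<integral>\<^sup>+ \<theta>. \<integral>\<^sup>+ x. ennreal (p \<theta> x) \<partial>\<mu> \<partial>W) = (\<integral>\<^sup>+ \<theta>. 1 \<partial>W)"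
    by (intro nn_integral_cong) (simp add: density_integral)
  then show ?thesis using mix_density_nn_integral[OF W, of "\<lambda>_. 1"] by (simp add: W.emeasure_space_1)
qed

lemma posterior_prior:
  assumes xs: "xs \<in> space (past t)"
  shows "posterior p \<pi> t xs \<in> priors T \<Theta>\<^sub>1"
proof -
  note [measurable] = lik_section_\<theta>[OF xs]
  have eq: "posterior p \<pi> t xs = density \<pi> (\<lambda>\<theta>. lik t \<theta> xs / evidence t xs)"
    unfolding posterior_def evidence_def lik_def ..
  have "emeasure (posterior p \<pi> t xs) (space \<pi>) = (\<integral>\<^sup>+ \<theta>. lik t \<theta> xs * inverse (evidence t xs) \<partial>\<pi>)"
    unfolding eq by (simp add: emeasure_density divide_ennreal_def cong: nn_integral_cong)
  also have "\<dots> = evidence t xs * inverse (evidence t xs)"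
    by (simp add: nn_integral_multc evidence_def)
  also have "\<dots> = 1"
    using evidence_pos_finite[OF xs] ennreal_divide_self[of "evidence t xs"] by (simp add: divide_ennreal_def)
  finally have "prob_space (posterior p \<pi> t xs)" by (intro prob_spaceI) (simp add: eq)
  moreover have "AE \<theta> in posterior p \<pi> t xs. \<theta> \<in> \<Theta>\<^sub>1"
    unfolding eq using prior_in by (subst AE_density) auto
  ultimately show ?thesis unfolding priors_def eq by (simp add: sets_\<pi>)
qed

lemma predictive_integral: "xs \<in> space (past t) \<Longrightarrow> (\<integral>\<^sup>+ x. predictive t xs x \<partial>\<mu>) = 1"
  unfolding predictive_def by (rule mix_density_integral[OF posterior_prior])

lemma W\<^sub>0_prior: "xs \<in> space (past t) \<Longrightarrow> W\<^sub>0 t xs \<in> priors T \<Theta>\<^sub>0"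
  using projection by (simp add: is_arg_min_def)

lemma projected_integral: "xs \<in> space (past t) \<Longrightarrow> (\<integral>\<^sup>+ x. projected t xs x \<partial>\<mu>) = 1"
  unfolding projected_def by (rule mix_density_integral[OF W\<^sub>0_prior])

lemma KL_projected_le:
  assumes xs: "xs \<in> space (past t)" and W: "W \<in> priors T \<Theta>\<^sub>0"
  shows "KL (density \<mu> (predictive t xs)) (density \<mu> (projected t xs)) \<le> KL (density \<mu> (predictive t xs)) (density \<mu> (mix_density p W))"
proof -
  have "\<not> KL (mixture \<mu> p (posterior p \<pi> t xs)) (mixture \<mu> p W) < KL (mixture \<mu> p (posterior p \<pi> t xs)) (mixture \<mu> p (W\<^sub>0 t xs))"
    using projection[OF xs] W by (simp add: is_arg_min_def)
  then show ?thesis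
    by (simp add: mixture_def predictive_def[abs_def] projected_def[abs_def] not_less)
qed

lemma KL_projected_finite:
  assumes xs: "xs \<in> space (past t)"
  shows "KL (density \<mu> (predictive t xs)) (density \<mu> (projected t xs)) < \<infinity>"
proof -
  have "KL (density \<mu> (predictive t xs)) (density \<mu> (projected t xs))
      \<le> (INF W\<in>priors T \<Theta>\<^sub>0. KL (density \<mu> (predictive t xs)) (density \<mu> (mix_density p W)))"
    by (intro INF_greatest KL_projected_le xs)
  also have "\<dots> < \<infinity>"
    using finite_inf[OF xs] by (simp add: mixture_def predictive_def[abs_def])
  finally show ?thesis .
qed

lemma projected_pos: "xs \<in> space (past t) \<Longrightarrow> AE x in \<mu>. 0 < projected t xs x"
  using KL_density_finite_iff(1)[OF reference, of "predictive t xs" "projected t xs"] KL_projected_finite[of xs t]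
    predictive_pos_finite(1)[of xs t] projected_integral[of xs t] by simp

lemma projected_finite: "xs \<in> space (past t) \<Longrightarrow> AE x in \<mu>. projected t xs x \<noteq> \<infinity>"
  using projected_integral[of xs t] by (intro nn_integral_noteq_infinite) auto

text \<open>
  The priors on the null are convex and contain the point masses, so the optimality of the projection
  applies to the perturbation towards \<open>p \<theta>\<close>.
\<close>

lemma projection_ratio_le_one:
  assumes xs: "xs \<in> space (past t)" and \<theta>: "\<theta> \<in> \<Theta>\<^sub>0"
  shows "(\<integral>\<^sup>+ x. ennreal (p \<theta> x) * (predictive t xs x / projected t xs x) \<partial>\<mu>) \<le> 1"
proof (rule reverse_projection_ratio_le_one[OF reference])
  have \<theta>T: "\<theta> \<in> space T" using \<theta> \<Theta>_space by blast
  show "(\<lambda>x. ennreal (p \<theta> x)) \<in> borel_measurable \<mu>" using \<theta>T by measurable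
  show "(\<integral>\<^sup>+ x. ennreal (p \<theta> x) \<partial>\<mu>) = 1" by (rule density_integral[OF \<theta>T])
  fix a :: real assume a: "0 < a" "a < 1"
  have R: "return T \<theta> \<in> priors T \<Theta>\<^sub>0" using \<theta> hypotheses by (intro return_prior)
  obtain U where U: "U \<in> priors T \<Theta>\<^sub>0" and
    int: "\<And>f. f \<in> borel_measurable T \<Longrightarrow>
      (\<integral>\<^sup>+ \<theta>. f \<theta> \<partial>U) = ennreal (1 - a) * (\<integral>\<^sup>+ \<theta>. f \<theta> \<partial>W\<^sub>0 t xs) + ennreal a * (\<integral>\<^sup>+ \<theta>'. f \<theta>' \<partial>return T \<theta>)"
    using convex_combination_prior[OF W\<^sub>0_prior[OF xs] R hypotheses(1), of a] a by auto
  have mix: "mix_density p U x = ennreal (1 - a) * projected t xs x + ennreal a * ennreal (p \<theta> x)" if "x \<in> space \<mu>" for x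
    using int[OF density_section_\<theta>[OF that]] density_section_\<theta>[OF that] \<theta>T
    by (simp add: mix_density_def projected_def nn_integral_return)
  have "density \<mu> (mix_density p U) = density \<mu> (\<lambda>x. ennreal (1 - a) * projected t xs x + ennreal a * ennreal (p \<theta> x))"
  proof (rule density_cong)
    show m: "(\<lambda>x. ennreal (1 - a) * projected t xs x + ennreal a * ennreal (p \<theta> x)) \<in> borel_measurable \<mu>"
      using xs \<theta>T by measurable
    then show "mix_density p U \<in> borel_measurable \<mu>"
      using mix by (simp cong: measurable_cong)
    show "AE x in \<mu>. mix_density p U x = ennreal (1 - a) * projected t xs x + ennreal a * ennreal (p \<theta> x)"
      using mix by simp
  qed
  then show "KL (density \<mu> (predictive t xs)) (density \<mu> (projected t xs))
      \<le> KL (density \<mu> (predictive t xs)) (density \<mu> (\<lambda>x. ennreal (1 - a) * projected t xs x + ennreal a * ennreal (p \<theta> x)))"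
    using KL_projected_le[OF xs U] by simp
qed (use xs KL_projected_finite[OF xs] in \<open>auto intro: predictive_pos_finite predictive_integral projected_integral\<close>)

lemma AE_past_Suc:
  assumes A: "Measurable.pred (past (Suc t)) A"
    and AE: "AE xs in past t. AE x in \<mu>. A (xs(t := x))"
  shows "AE xs in past (Suc t). A xs"
proof -
  note [measurable] = A
  have 1: "(\<lambda>xs. indicator {xs. \<not> A xs} xs :: ennreal) \<in> borel_measurable (past (Suc t))"
    by (rule borel_measurable_indicator') measurable
  have "(\<integral>\<^sup>+ xs. indicator {xs. \<not> A xs} xs \<partial>past (Suc t)) = (\<integral>\<^sup>+ xs. \<integral>\<^sup>+ x. indicator {xs. \<not> A xs} (xs(t := x)) \<partial>\<mu> \<partial>past t)"
    by (rule nn_integral_PiM_lessThan_Suc[OF reference 1])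
  also have "\<dots> = (\<integral>\<^sup>+ xs. 0 \<partial>past t)"
  proof (intro nn_integral_cong_AE, use AE in eventually_elim)
    fix xs assume "AE x in \<mu>. A (xs(t := x))"
    then have "(\<integral>\<^sup>+ x. indicator {xs. \<not> A xs} (xs(t := x)) \<partial>\<mu>) = (\<integral>\<^sup>+ x. 0 \<partial>\<mu>)"
      by (intro nn_integral_cong_AE, eventually_elim) simp
    then show "(\<integral>\<^sup>+ x. indicator {xs. \<not> A xs} (xs(t := x)) \<partial>\<mu>) = 0" by simp
  qed
  finally have "AE xs in past (Suc t). (indicator {xs. \<not> A xs} xs :: ennreal) = 0"
    using 1 by (simp add: nn_integral_0_iff_AE)
  then show ?thesis by eventually_elim (auto simp: indicator_def split: if_splits)
qed

text \<open>
  Any \<open>P \<theta>'\<close> with \<open>\<theta>' \<in> \<Theta>\<^sub>1\<close> is absolutely continuous with respect to \<open>P \<theta>\<close> since the divergence is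
  finite.  So the zero set of \<open>p \<theta>\<close> is null for every \<open>P \<theta>'\<close>, hence for the predictive distribution,
  whose density is positive everywhere.
\<close>

lemma density_pos:
  assumes \<theta>: "\<theta> \<in> \<Theta>\<^sub>0 \<union> \<Theta>\<^sub>1"
  shows "AE x in \<mu>. 0 < p \<theta> x"
proof -
  have \<theta>T[measurable]: "\<theta> \<in> space T" using \<Theta>_space[OF \<theta>] .
  (* B is null for P \<theta>, therefore for every P \<theta>' with \<theta>' in \<Theta>\<^sub>1. *)
  define B where "B = {x \<in> space \<mu>. ennreal (p \<theta> x) = 0}"
  have [measurable]: "B \<in> sets \<mu>" unfolding B_def by measurable
  have null: "(\<integral>\<^sup>+ x. indicator B x * ennreal (p \<theta>' x) \<partial>\<mu>) = 0" if \<theta>': "\<theta>' \<in> \<Theta>\<^sub>1" for \<theta>'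
  proof -
    have [measurable]: "\<theta>' \<in> space T" using \<Theta>_space \<theta>' by blast
    have "absolutely_continuous (P \<theta>) (P \<theta>')"
      using KL_finite[of \<theta>' \<theta>] \<theta> \<theta>' by (auto simp: KL_def split: if_splits)
    moreover have "B \<in> null_sets (P \<theta>)"
      by (subst null_sets_density_iff) (auto simp: B_def)
    ultimately have "B \<in> null_sets (P \<theta>')" by (auto simp: absolutely_continuous_def)
    then have "AE x in \<mu>. x \<in> B \<longrightarrow> ennreal (p \<theta>' x) = 0" by (subst (asm) null_sets_density_iff) auto
    then have "AE x in \<mu>. indicator B x * ennreal (p \<theta>' x) = 0" by eventually_elim (simp add: indicator_def)
    then show ?thesis by (subst nn_integral_0_iff_AE) auto
  qed
  (* The empty past, for which the posterior is the prior. *)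
  define xs :: "nat \<Rightarrow> 'x" where "xs = (\<lambda>_. undefined)"
  have xs: "xs \<in> space (past 0)" by (simp add: xs_def space_PiM)
  have "(\<integral>\<^sup>+ x. indicator B x * predictive 0 xs x \<partial>\<mu>) = (\<integral>\<^sup>+ \<theta>'. \<integral>\<^sup>+ x. indicator B x * ennreal (p \<theta>' x) \<partial>\<mu> \<partial>posterior p \<pi> 0 xs)"
    unfolding predictive_def by (rule mix_density_nn_integral[OF posterior_prior[OF xs]]) measurable
  also have "\<dots> = (\<integral>\<^sup>+ \<theta>'. 0 \<partial>posterior p \<pi> 0 xs)"
  proof (rule nn_integral_cong_AE)
    have "AE \<theta>' in posterior p \<pi> 0 xs. \<theta>' \<in> \<Theta>\<^sub>1" using posterior_prior[OF xs] by (simp add: priors_def)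
    then show "AE \<theta>' in posterior p \<pi> 0 xs. (\<integral>\<^sup>+ x. indicator B x * ennreal (p \<theta>' x) \<partial>\<mu>) = 0"
      by eventually_elim (rule null)
  qed
  finally have "(\<integral>\<^sup>+ x. indicator B x * predictive 0 xs x \<partial>\<mu>) = 0" by simp
  then have "AE x in \<mu>. indicator B x * predictive 0 xs x = 0"
    using xs by (subst (asm) nn_integral_0_iff_AE) measurable
  then show ?thesis using AE_space
  proof eventually_elim
    fix x assume x: "indicator B x * predictive 0 xs x = 0" "x \<in> space \<mu>"
    then have "x \<notin> B" using predictive_pos_finite(1)[OF xs x(2)] by auto
    then show "0 < p \<theta> x" using x(2) by (auto simp: B_def ennreal_eq_0_iff not_le)
  qed
qed

lemma lik_pos:
  assumes \<theta>: "\<theta> \<in> \<Theta>\<^sub>0 \<union> \<Theta>\<^sub>1"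
  shows "AE xs in past t. 0 < lik t \<theta> xs"
proof (induction t)
  case (Suc t)
  have \<theta>T: "\<theta> \<in> space T" using \<Theta>_space[OF \<theta>] .
  note [measurable] = lik_section[OF \<theta>T]
  show ?case
  proof (rule AE_past_Suc)
    show "AE xs in past t. AE x in \<mu>. 0 < lik (Suc t) \<theta> (xs(t := x))"
      using Suc AE_space
    proof eventually_elim
      fix xs assume xs: "0 < lik t \<theta> xs" "xs \<in> space (past t)"
      show "AE x in \<mu>. 0 < lik (Suc t) \<theta> (xs(t := x))"
        using density_pos[OF \<theta>] AE_space
        by eventually_elim (simp add: lik_Suc[OF \<theta>T xs(2)] xs(1) ennreal_zero_less_mult_iff)
    qed
  qed measurable
qed (simp add: lik_0)

lemma PiM_P_eq_density:
  assumes \<theta>: "\<theta> \<in> space T"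
  shows "(\<Pi>\<^sub>M i\<in>{..<t}. P \<theta>) = density (past t) (lik t \<theta>)"
proof -
  interpret P: prob_space "P \<theta>" by (rule distributions[OF \<theta>])
  interpret PP: product_sigma_finite "\<lambda>_::nat. P \<theta>" by unfold_locales
  note [measurable] = lik_section[OF \<theta>] density_section[OF \<theta>]
  show ?thesis
  proof (rule PP.PiM_eqI[symmetric])
    show "sets (density (past t) (lik t \<theta>)) = sets (\<Pi>\<^sub>M i\<in>{..<t}. P \<theta>)"
      by (simp cong: sets_PiM_cong)
    fix A assume A: "\<And>i. i \<in> {..<t} \<Longrightarrow> A i \<in> sets (P \<theta>)"
    have [measurable]: "Pi\<^sub>E {..<t} A \<in> sets (past t)" using A by (intro sets_PiM_I_finite) auto
    have "emeasure (density (past t) (lik t \<theta>)) (Pi\<^sub>E {..<t} A) = (\<integral>\<^sup>+ xs. (\<Prod>i<t. ennreal (p \<theta> (xs i)) * indicator (A i) (xs i)) \<partial>past t)"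
    proof (subst emeasure_density)
      show "(\<integral>\<^sup>+ xs. lik t \<theta> xs * indicator (Pi\<^sub>E {..<t} A) xs \<partial>past t) = (\<integral>\<^sup>+ xs. (\<Prod>i<t. ennreal (p \<theta> (xs i)) * indicator (A i) (xs i)) \<partial>past t)"
      proof (rule nn_integral_cong)
        fix xs assume xs: "xs \<in> space (past t)"
        have "indicator (Pi\<^sub>E {..<t} A) xs = (\<Prod>i<t. indicator (A i) (xs i) :: ennreal)"
        proof (cases "xs \<in> Pi\<^sub>E {..<t} A")
          case True
          then show ?thesis by (auto simp: PiE_iff intro!: prod.neutral[symmetric])
        next
          case False
          with xs obtain i where "i < t" "xs i \<notin> A i" by (auto simp: space_PiM PiE_iff)
          then have "(\<Prod>i<t. indicator (A i) (xs i) :: ennreal) = 0" by (intro prod_zero bexI[of _ i]) auto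
          with False show ?thesis by simp
        qed
        then show "lik t \<theta> xs * indicator (Pi\<^sub>E {..<t} A) xs = (\<Prod>i<t. ennreal (p \<theta> (xs i)) * indicator (A i) (xs i))"
          by (simp add: lik_prod[OF \<theta> xs] prod.distrib)
      qed
    qed auto
    also have "\<dots> = (\<Prod>i<t. \<integral>\<^sup>+ x. ennreal (p \<theta> x) * indicator (A i) x \<partial>\<mu>)"
      using A by (intro pasts.product_nn_integral_prod) auto
    also have "\<dots> = (\<Prod>i<t. emeasure (P \<theta>) (A i))"
      using A by (intro prod.cong refl emeasure_density[symmetric]) auto
    finally show "emeasure (density (past t) (lik t \<theta>)) (Pi\<^sub>E {..<t} A) = (\<Prod>i<t. emeasure (P \<theta>) (A i))" .
  qed simp
qed

lemma sets_PiM_P[simp]: "sets (\<Pi>\<^sub>M i\<in>I. P \<theta>) = sets (\<Pi>\<^sub>M i\<in>I. \<mu>)"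
  by (intro sets_PiM_cong) auto

lemma space_PiM_P: "space (\<Pi>\<^sub>M i\<in>I. P \<theta>) = space (\<Pi>\<^sub>M i\<in>I. \<mu>)"
  by (rule sets_eq_imp_space_eq) simp

text \<open>
  By \<open>density_pos\<close> the likelihood of a past is positive almost everywhere.
\<close>

lemma AE_past_P:
  assumes \<theta>: "\<theta> \<in> \<Theta>\<^sub>0 \<union> \<Theta>\<^sub>1"
  shows "(AE xs in (\<Pi>\<^sub>M i\<in>{..<t}. P \<theta>). A xs) \<longleftrightarrow> (AE xs in past t. A xs)"
proof -
  have "(AE xs in (\<Pi>\<^sub>M i\<in>{..<t}. P \<theta>). A xs) \<longleftrightarrow> (AE xs in past t. 0 < lik t \<theta> xs \<longrightarrow> A xs)"
    unfolding PiM_P_eq_density[OF \<Theta>_space[OF \<theta>]] using lik_section[OF \<Theta>_space[OF \<theta>]] by (rule AE_density)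
  also have "\<dots> \<longleftrightarrow> (AE xs in past t. A xs)"
    using lik_pos[OF \<theta>, of t] by (intro eventually_subst, eventually_elim) simp
  finally show ?thesis .
qed

lemma nn_integral_P:
  "\<theta> \<in> space T \<Longrightarrow> g \<in> borel_measurable \<mu> \<Longrightarrow> (\<integral>\<^sup>+ x. g x \<partial>P \<theta>) = (\<integral>\<^sup>+ x. g x * ennreal (p \<theta> x) \<partial>\<mu>)"
  using density_section by (simp add: nn_integral_density mult.commute)

section \<open>The product of ratios as a test supermartingale\<close>

lemma E_measurable[measurable]: "E t \<in> borel_measurable (past t)"
  unfolding E_def
proof (intro borel_measurable_prod_ennreal)
  fix i assume "i \<in> {..<t}"
  then have "(\<lambda>xs. (first_obs i xs, xs i)) \<in> past t \<rightarrow>\<^sub>M past i \<Otimes>\<^sub>M \<mu>"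
    by (intro measurable_Pair measurable_first_obs_le measurable_component_singleton) auto
  from measurable_compose[OF this predictive_measurable] measurable_compose[OF this projected_measurable]
  have [measurable]: "(\<lambda>xs. predictive i (first_obs i xs) (xs i)) \<in> borel_measurable (past t)"
    "(\<lambda>xs. projected i (first_obs i xs) (xs i)) \<in> borel_measurable (past t)" by simp_all
  show "(\<lambda>xs. predictive i (first_obs i xs) (xs i) / projected i (first_obs i xs) (xs i)) \<in> borel_measurable (past t)"
    by measurable
qed

lemma E_0: "E 0 xs = 1" by (simp add: E_def)

lemma E_Suc:
  assumes xs: "xs \<in> space (past t)"
  shows "E (Suc t) (xs(t := x)) = E t xs * (predictive t xs x / projected t xs x)"
proof -
  have "first_obs i (xs(t := x)) = first_obs i xs" if "i \<le> t" for i
    using that by (auto simp: first_obs_def restrict_def fun_eq_iff)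
  then show ?thesis using first_obs_id[OF xs] by (simp add: E_def)
qed

lemma E_step:
  assumes xs: "xs \<in> space (past t)" and \<theta>: "\<theta> \<in> \<Theta>\<^sub>0"
  shows "(\<integral>\<^sup>+ x. E (Suc t) (xs(t := x)) \<partial>P \<theta>) \<le> E t xs"
proof -
  have \<theta>T: "\<theta> \<in> space T" using \<theta> \<Theta>_space by blast
  note [measurable] = density_section[OF \<theta>T] predictive_section[OF xs] projected_section[OF xs]
  have "(\<integral>\<^sup>+ x. E (Suc t) (xs(t := x)) \<partial>P \<theta>) = (\<integral>\<^sup>+ x. E t xs * (ennreal (p \<theta> x) * (predictive t xs x / projected t xs x)) \<partial>\<mu>)"
    unfolding E_Suc[OF xs] by (subst nn_integral_P[OF \<theta>T]) (auto simp: ac_simps)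
  also have "\<dots> = E t xs * (\<integral>\<^sup>+ x. ennreal (p \<theta> x) * (predictive t xs x / projected t xs x) \<partial>\<mu>)"
    by (rule nn_integral_cmult) measurable
  also have "\<dots> \<le> E t xs * 1"
    by (intro mult_left_mono projection_ratio_le_one[OF xs \<theta>]) simp
  finally show ?thesis by simp
qed

lemma E_expectation:
  assumes \<theta>: "\<theta> \<in> \<Theta>\<^sub>0"
  shows "(\<integral>\<^sup>+ xs. E t xs \<partial>(\<Pi>\<^sub>M i\<in>{..<t}. P \<theta>)) \<le> 1"
proof (induction t)
  case 0
  interpret prob_space "\<Pi>\<^sub>M i\<in>{..<0::nat}. P \<theta>" using \<theta> \<Theta>_space by (intro prob_space_PiM distributions) blast
  show ?case using emeasure_space_1 by (simp add: E_0)
next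
  case (Suc t)
  have "prob_space (P \<theta>)" using \<theta> \<Theta>_space distributions by blast
  then have sf: "sigma_finite_measure (P \<theta>)"
    by (rule prob_space_imp_sigma_finite)
  have "(\<integral>\<^sup>+ xs. E (Suc t) xs \<partial>(\<Pi>\<^sub>M i\<in>{..<Suc t}. P \<theta>)) = (\<integral>\<^sup>+ xs. \<integral>\<^sup>+ x. E (Suc t) (xs(t := x)) \<partial>P \<theta> \<partial>(\<Pi>\<^sub>M i\<in>{..<t}. P \<theta>))"
    by (rule nn_integral_PiM_lessThan_Suc[OF sf]) (simp cong: measurable_cong_sets add: E_measurable)
  also have "\<dots> \<le> (\<integral>\<^sup>+ xs. E t xs \<partial>(\<Pi>\<^sub>M i\<in>{..<t}. P \<theta>))"
    by (intro nn_integral_mono E_step \<theta>) (simp add: space_PiM_P)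
  also note Suc
  finally show ?case .
qed

lemma test_supermartingale_E: "test_supermartingale \<mu> P \<Theta>\<^sub>0 E"
  unfolding test_supermartingale_def e_variable_def
proof (intro conjI allI ballI)
  fix t \<theta> assume \<theta>: "\<theta> \<in> \<Theta>\<^sub>0"
  then have \<theta>': "\<theta> \<in> \<Theta>\<^sub>0 \<union> \<Theta>\<^sub>1" by blast
  have "prob_space (P \<theta>)" using \<Theta>_space[OF \<theta>'] distributions by blast
  moreover have "AE xs in (\<Pi>\<^sub>M i\<in>{..<t}. P \<theta>). (\<integral>\<^sup>+ x. E (Suc t) (xs(t := x)) \<partial>P \<theta>) \<le> E t xs"
    using E_step[OF _ \<theta>] by (intro AE_I2) (simp add: space_PiM_P)
  ultimately show "AE \<omega> in (\<Pi>\<^sub>M i\<in>UNIV. P \<theta>).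
      nn_cond_exp (\<Pi>\<^sub>M i\<in>UNIV. P \<theta>) (obs_filtration \<mu> (enat t)) (\<lambda>\<omega>'. E (Suc t) (first_obs (Suc t) \<omega>')) \<omega> \<le> E t (first_obs t \<omega>)"
    by (subst supermartingale_step_iff) auto
qed (auto intro: E_expectation)

lemma E_pos_finite: "AE xs in past t. 0 < E t xs \<and> E t xs < \<infinity>"
proof (induction t)
  case (Suc t)
  show ?case
  proof (rule AE_past_Suc)
    show "AE xs in past t. AE x in \<mu>. 0 < E (Suc t) (xs(t := x)) \<and> E (Suc t) (xs(t := x)) < \<infinity>"
      using Suc AE_space
    proof eventually_elim
      fix xs assume xs: "0 < E t xs \<and> E t xs < \<infinity>" "xs \<in> space (past t)"
      show "AE x in \<mu>. 0 < E (Suc t) (xs(t := x)) \<and> E (Suc t) (xs(t := x)) < \<infinity>"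
        using projected_pos[OF xs(2)] projected_finite[OF xs(2)] AE_space
      proof eventually_elim
        fix x assume x: "0 < projected t xs x" "projected t xs x \<noteq> \<infinity>" "x \<in> space \<mu>"
        note q = predictive_pos_finite[OF xs(2) x(3)]
        have "0 < predictive t xs x / projected t xs x" "predictive t xs x / projected t xs x < \<infinity>"
          using q x by (auto simp: ennreal_zero_less_divide less_top ennreal_divide_eq_top_iff simp flip: less_top)
        then show "0 < E (Suc t) (xs(t := x)) \<and> E (Suc t) (xs(t := x)) < \<infinity>"
          using xs(1) unfolding E_Suc[OF xs(2)] by (simp add: ennreal_zero_less_mult_iff ennreal_mult_less_top)
      qed
    qed
  qed measurable
qed (simp add: E_0)

section \<open>Ratios of supermartingales under the Bayesian mixture\<close>

lemma test_supermartingale_measurable: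
  "test_supermartingale \<mu> P \<Theta>\<^sub>0 E' \<Longrightarrow> E' t \<in> borel_measurable (past t)"
  by (simp add: test_supermartingale_def e_variable_def)

lemma next_section_measurable:
  assumes "g \<in> borel_measurable (past (Suc t))" "xs \<in> space (past t)"
  shows "(\<lambda>x. g (xs(t := x))) \<in> borel_measurable \<mu>"
  using measurable_compose[OF measurable_Pair1'[OF assms(2)] measurable_next_section[OF assms(1)]] by simp

text \<open>
  The quantifier over \<open>\<theta>\<close> stands inside the almost sure statement.  Each single \<open>\<theta>\<close> comes with its own
  exceptional null set; only countably many are discarded, one for each element of a dense set.
\<close>

lemma supermartingale_constraint:
  assumes E': "test_supermartingale \<mu> P \<Theta>\<^sub>0 E'"
  shows "AE xs in past t. \<forall>\<theta>\<in>\<Theta>\<^sub>0. (\<integral>\<^sup>+ x. E' (Suc t) (xs(t := x)) * ennreal (p \<theta> x) \<partial>\<mu>) \<le> E' t xs"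
proof -
  note meas = test_supermartingale_measurable[OF E']
  have single: "AE xs in past t. (\<integral>\<^sup>+ x. E' (Suc t) (xs(t := x)) * ennreal (p \<theta> x) \<partial>\<mu>) \<le> E' t xs"
    if \<theta>: "\<theta> \<in> \<Theta>\<^sub>0" for \<theta>
  proof -
    have \<theta>': "\<theta> \<in> \<Theta>\<^sub>0 \<union> \<Theta>\<^sub>1" and \<theta>T: "\<theta> \<in> space T" using \<theta> \<Theta>_space by blast+
    have "AE xs in (\<Pi>\<^sub>M i\<in>{..<t}. P \<theta>). (\<integral>\<^sup>+ x. E' (Suc t) (xs(t := x)) \<partial>P \<theta>) \<le> E' t xs"
      using E' \<theta> supermartingale_step_iff[OF distributions[OF \<theta>T] _ meas meas]
      by (simp add: test_supermartingale_def)
    then have "AE xs in past t. (\<integral>\<^sup>+ x. E' (Suc t) (xs(t := x)) \<partial>P \<theta>) \<le> E' t xs"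
      unfolding AE_past_P[OF \<theta>'] .
    then show ?thesis using AE_space
      by eventually_elim (simp add: nn_integral_P[OF \<theta>T] next_section_measurable meas)
  qed
  have \<Theta>\<^sub>0_space: "\<Theta>\<^sub>0 \<subseteq> space T" using \<Theta>_space by blast
  have integral_finite: "(\<integral>\<^sup>+ x. ennreal (p \<theta> x) \<partial>\<mu>) < \<infinity>" if "\<theta> \<in> \<Theta>\<^sub>0" for \<theta>
    using density_integral \<Theta>_space that by simp
  obtain D where D: "countable D" "D \<subseteq> \<Theta>\<^sub>0"
    and dense: "\<And>\<theta> e. \<theta> \<in> \<Theta>\<^sub>0 \<Longrightarrow> 0 < e \<Longrightarrow> \<exists>d\<in>D. (\<integral>\<^sup>+ x. ennreal \<bar>p \<theta> x - p d x\<bar> \<partial>\<mu>) \<le> ennreal e"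
    using countable_L1_dense[OF reference density_measurable density_nonneg \<Theta>\<^sub>0_space integral_finite] by blast
  have pm: "p \<theta> \<in> borel_measurable \<mu>" if "\<theta> \<in> \<Theta>\<^sub>0" for \<theta>
    using measurable_compose[OF measurable_Pair1' density_measurable, of \<theta>] \<Theta>_space that by simp
  have "AE xs in past t. \<forall>d\<in>D. (\<integral>\<^sup>+ x. E' (Suc t) (xs(t := x)) * ennreal (p d x) \<partial>\<mu>) \<le> E' t xs"
    using D single by (subst AE_ball_countable) auto
  then show ?thesis using AE_space
  proof eventually_elim
    fix xs assume le: "\<forall>d\<in>D. (\<integral>\<^sup>+ x. E' (Suc t) (xs(t := x)) * ennreal (p d x) \<partial>\<mu>) \<le> E' t xs"
      and xs: "xs \<in> space (past t)"
    show "\<forall>\<theta>\<in>\<Theta>\<^sub>0. (\<integral>\<^sup>+ x. E' (Suc t) (xs(t := x)) * ennreal (p \<theta> x) \<partial>\<mu>) \<le> E' t xs"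
    proof
      fix \<theta> assume \<theta>: "\<theta> \<in> \<Theta>\<^sub>0"
      show "(\<integral>\<^sup>+ x. E' (Suc t) (xs(t := x)) * ennreal (p \<theta> x) \<partial>\<mu>) \<le> E' t xs"
      proof (rule nn_integral_le_of_dense[where f=p and D=D])
        show "(\<lambda>x. E' (Suc t) (xs(t := x))) \<in> borel_measurable \<mu>"
          by (rule next_section_measurable[OF meas xs])
      qed (use \<theta> D(2) le dense[OF \<theta>] pm \<Theta>_space density_nonneg in auto)
    qed
  qed
qed

text \<open>
  Averaging over the projected prior, which depends on the past.
\<close>

lemma projected_constraint:
  assumes E': "test_supermartingale \<mu> P \<Theta>\<^sub>0 E'"
  shows "AE xs in past t. (\<integral>\<^sup>+ x. E' (Suc t) (xs(t := x)) * projected t xs x \<partial>\<mu>) \<le> E' t xs"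
  using supermartingale_constraint[OF E', of t] AE_space
proof eventually_elim
  fix xs assume le: "\<forall>\<theta>\<in>\<Theta>\<^sub>0. (\<integral>\<^sup>+ x. E' (Suc t) (xs(t := x)) * ennreal (p \<theta> x) \<partial>\<mu>) \<le> E' t xs"
    and xs: "xs \<in> space (past t)"
  interpret W: prob_space "W\<^sub>0 t xs" using W\<^sub>0_prior[OF xs] by (simp add: priors_def)
  have in0: "AE \<theta> in W\<^sub>0 t xs. \<theta> \<in> \<Theta>\<^sub>0" using W\<^sub>0_prior[OF xs] by (simp add: priors_def)
  have "(\<integral>\<^sup>+ x. E' (Suc t) (xs(t := x)) * projected t xs x \<partial>\<mu>)
      = (\<integral>\<^sup>+ \<theta>. \<integral>\<^sup>+ x. E' (Suc t) (xs(t := x)) * ennreal (p \<theta> x) \<partial>\<mu> \<partial>W\<^sub>0 t xs)"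
    unfolding projected_def
    by (rule mix_density_nn_integral[OF W\<^sub>0_prior[OF xs] next_section_measurable[OF test_supermartingale_measurable[OF E'] xs]])
  also have "\<dots> \<le> (\<integral>\<^sup>+ \<theta>. E' t xs \<partial>W\<^sub>0 t xs)"
    using in0 by (intro nn_integral_mono_AE, eventually_elim) (use le in auto)
  also have "\<dots> = E' t xs" by (simp add: W.emeasure_space_1)
  finally show "(\<integral>\<^sup>+ x. E' (Suc t) (xs(t := x)) * projected t xs x \<partial>\<mu>) \<le> E' t xs" .
qed

text \<open>
  The supermartingale property of \<open>E' / E\<close> under the Bayesian mixture, whose density of the past is
  \<open>evidence\<close>: the new factor \<open>q\<close> of the evidence and the factor \<open>q / s\<close> of \<open>E\<close> combine to \<open>s\<close>.
\<close>

lemma ratio_supermartingale: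
  assumes E': "test_supermartingale \<mu> P \<Theta>\<^sub>0 E'" and B[measurable]: "B \<in> sets (past t)"
  shows "(\<integral>\<^sup>+ xs. E' (Suc t) xs / E (Suc t) xs * indicator B (first_obs t xs) * evidence (Suc t) xs \<partial>past (Suc t))
    \<le> (\<integral>\<^sup>+ xs. E' t xs / E t xs * indicator B xs * evidence t xs \<partial>past t)"
proof -
  note [measurable] = test_supermartingale_measurable[OF E'] measurable_first_obs_le[of t "Suc t" \<mu>, simplified]
  have m: "(\<lambda>xs. E' (Suc t) xs / E (Suc t) xs * indicator B (first_obs t xs) * evidence (Suc t) xs) \<in> borel_measurable (past (Suc t))"
    by measurable
  have "(\<integral>\<^sup>+ xs. E' (Suc t) xs / E (Suc t) xs * indicator B (first_obs t xs) * evidence (Suc t) xs \<partial>past (Suc t))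
      = (\<integral>\<^sup>+ xs. \<integral>\<^sup>+ x. E' (Suc t) (xs(t := x)) / E (Suc t) (xs(t := x)) * indicator B (first_obs t (xs(t := x)))
          * evidence (Suc t) (xs(t := x)) \<partial>\<mu> \<partial>past t)"
    by (rule nn_integral_PiM_lessThan_Suc[OF reference m])
  also have "\<dots> \<le> (\<integral>\<^sup>+ xs. E' t xs / E t xs * indicator B xs * evidence t xs \<partial>past t)"
  proof (rule nn_integral_mono_AE, use projected_constraint[OF E', of t] E_pos_finite[of t] AE_space in eventually_elim)
    fix xs assume le: "(\<integral>\<^sup>+ x. E' (Suc t) (xs(t := x)) * projected t xs x \<partial>\<mu>) \<le> E' t xs"
      and e: "0 < E t xs \<and> E t xs < \<infinity>" and xs: "xs \<in> space (past t)"
    define C where "C = indicator B xs * evidence t xs / E t xs"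
    have "(\<integral>\<^sup>+ x. E' (Suc t) (xs(t := x)) / E (Suc t) (xs(t := x)) * indicator B (first_obs t (xs(t := x)))
          * evidence (Suc t) (xs(t := x)) \<partial>\<mu>) = (\<integral>\<^sup>+ x. C * (E' (Suc t) (xs(t := x)) * projected t xs x) \<partial>\<mu>)"
      using projected_pos[OF xs] projected_finite[OF xs] AE_space
    proof (intro nn_integral_cong_AE, eventually_elim)
      fix x assume s: "0 < projected t xs x" "projected t xs x \<noteq> \<infinity>" and x: "x \<in> space \<mu>"
      show "E' (Suc t) (xs(t := x)) / E (Suc t) (xs(t := x)) * indicator B (first_obs t (xs(t := x)))
          * evidence (Suc t) (xs(t := x)) = C * (E' (Suc t) (xs(t := x)) * projected t xs x)"
        unfolding E_Suc[OF xs] evidence_Suc[OF xs x] first_obs_upd first_obs_id[OF xs] C_def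
        using e s predictive_pos_finite[OF xs x] by (intro ratio_rearrange) (auto simp: less_top)
    qed
    also have "\<dots> = C * (\<integral>\<^sup>+ x. E' (Suc t) (xs(t := x)) * projected t xs x \<partial>\<mu>)"
      using projected_section[OF xs] next_section_measurable[OF test_supermartingale_measurable[OF E'] xs]
      by (intro nn_integral_cmult borel_measurable_times_ennreal)
    also have "\<dots> \<le> C * E' t xs" using le by (rule mult_left_mono) simp
    also have "\<dots> = E' t xs / E t xs * indicator B xs * evidence t xs"
      by (simp add: C_def divide_ennreal_def ac_simps)
    finally show "(\<integral>\<^sup>+ x. E' (Suc t) (xs(t := x)) / E (Suc t) (xs(t := x)) * indicator B (first_obs t (xs(t := x)))
          * evidence (Suc t) (xs(t := x)) \<partial>\<mu>) \<le> E' t xs / E t xs * indicator B xs * evidence t xs" .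
  qed
  finally show ?thesis .
qed

abbreviation path :: "'p \<Rightarrow> (nat \<Rightarrow> 'x) measure" where "path \<theta> \<equiv> (\<Pi>\<^sub>M i\<in>UNIV. P \<theta>)"

abbreviation filtration :: "nat \<Rightarrow> (nat \<Rightarrow> 'x) measure" where "filtration t \<equiv> obs_filtration \<mu> (enat t)"

text \<open>
  Expectation when the parameter is first drawn from the prior and the observations then follow it.
\<close>

definition mean :: "((nat \<Rightarrow> 'x) \<Rightarrow> ennreal) \<Rightarrow> ennreal" where
  "mean h = (\<integral>\<^sup>+ \<theta>. \<integral>\<^sup>+ \<omega>. h \<omega> \<partial>path \<theta> \<partial>\<pi>)"

lemma path_integral_first_obs:
  assumes \<theta>: "\<theta> \<in> space \<pi>" and g[measurable]: "g \<in> borel_measurable (past t)"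
  shows "(\<integral>\<^sup>+ \<omega>. g (first_obs t \<omega>) \<partial>path \<theta>) = (\<integral>\<^sup>+ xs. lik t \<theta> xs * g xs \<partial>past t)"
proof -
  have \<theta>T: "\<theta> \<in> space T" using \<theta> by (simp add: space_\<pi>)
  have "(\<integral>\<^sup>+ \<omega>. g (first_obs t \<omega>) \<partial>path \<theta>) = (\<integral>\<^sup>+ xs. g xs \<partial>(\<Pi>\<^sub>M i\<in>{..<t}. P \<theta>))"
    using g by (intro nn_integral_first_obs[OF distributions[OF \<theta>T]]) (simp cong: measurable_cong_sets)
  then show ?thesis
    unfolding PiM_P_eq_density[OF \<theta>T] using lik_section[OF \<theta>T] by (simp add: nn_integral_density)
qed

lemma lik_measurable_\<pi>[measurable]: "(\<lambda>(xs, \<theta>). lik t \<theta> xs) \<in> borel_measurable (past t \<Otimes>\<^sub>M \<pi>)"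
  using lik_measurable by (simp cong: measurable_cong_sets sets_pair_measure_cong add: sets_\<pi>)

lemma path_integral_measurable:
  assumes h: "h \<in> borel_measurable (filtration t)"
  shows "(\<lambda>\<theta>. \<integral>\<^sup>+ \<omega>. h \<omega> \<partial>path \<theta>) \<in> borel_measurable \<pi>"
proof -
  obtain g where g[measurable]: "g \<in> borel_measurable (past t)"
    and hg: "\<And>\<omega>. \<omega> \<in> space (\<Pi>\<^sub>M i\<in>UNIV. \<mu>) \<Longrightarrow> h \<omega> = g (first_obs t \<omega>)"
    using obs_measurable_factor[OF h space_\<mu>_nonempty] by blast
  interpret past: sigma_finite_measure "past t" by (rule past_sigma_finite)
  have 1: "(\<lambda>z. lik t (fst z) (snd z) * g (snd z)) \<in> borel_measurable (\<pi> \<Otimes>\<^sub>M past t)"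
    using measurable_compose[OF measurable_pair_swap' lik_measurable_\<pi>] by (simp add: case_prod_beta')
  have "(\<lambda>\<theta>. \<integral>\<^sup>+ xs. lik t \<theta> xs * g xs \<partial>past t) \<in> borel_measurable \<pi>"
    using past.borel_measurable_nn_integral_fst[OF 1] by simp
  moreover have "(\<integral>\<^sup>+ \<omega>. h \<omega> \<partial>path \<theta>) = (\<integral>\<^sup>+ xs. lik t \<theta> xs * g xs \<partial>past t)" if "\<theta> \<in> space \<pi>" for \<theta>
  proof -
    have "(\<integral>\<^sup>+ \<omega>. h \<omega> \<partial>path \<theta>) = (\<integral>\<^sup>+ \<omega>. g (first_obs t \<omega>) \<partial>path \<theta>)"
      by (intro nn_integral_cong hg) (simp add: space_PiM_P)
    then show ?thesis using path_integral_first_obs[OF that g] by simp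
  qed
  ultimately show ?thesis by (simp cong: measurable_cong)
qed

lemma mean_first_obs:
  assumes g[measurable]: "g \<in> borel_measurable (past t)"
  shows "mean (\<lambda>\<omega>. g (first_obs t \<omega>)) = (\<integral>\<^sup>+ xs. g xs * evidence t xs \<partial>past t)"
proof -
  interpret past: sigma_finite_measure "past t" by (rule past_sigma_finite)
  interpret pair_sigma_finite "past t" \<pi> by unfold_locales
  have "mean (\<lambda>\<omega>. g (first_obs t \<omega>)) = (\<integral>\<^sup>+ \<theta>. \<integral>\<^sup>+ xs. lik t \<theta> xs * g xs \<partial>past t \<partial>\<pi>)"
    unfolding mean_def by (intro nn_integral_cong path_integral_first_obs g)
  also have "\<dots> = (\<integral>\<^sup>+ xs. \<integral>\<^sup>+ \<theta>. lik t \<theta> xs * g xs \<partial>\<pi> \<partial>past t)"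
    by (rule Fubini') measurable
  also have "\<dots> = (\<integral>\<^sup>+ xs. g xs * evidence t xs \<partial>past t)"
    by (intro nn_integral_cong) (simp add: nn_integral_multc lik_section_\<theta> evidence_def mult.commute[of "g _"])
  finally show ?thesis .
qed

lemma filtration_measurable_path: "h \<in> borel_measurable (filtration t) \<Longrightarrow> h \<in> borel_measurable (path \<theta>)"
  using measurable_from_subalg[OF subalgebra_obs_filtration] by (simp cong: measurable_cong_sets)

lemma mean_add:
  assumes h: "h \<in> borel_measurable (filtration t)" and k: "k \<in> borel_measurable (filtration t)"
  shows "mean (\<lambda>\<omega>. h \<omega> + k \<omega>) = mean h + mean k"
  unfolding mean_def
  using path_integral_measurable[OF h] path_integral_measurable[OF k]
  by (simp add: nn_integral_add filtration_measurable_path[OF h] filtration_measurable_path[OF k])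

lemma mean_mono_AE:
  assumes "\<And>\<theta>. \<theta> \<in> \<Theta>\<^sub>1 \<Longrightarrow> AE \<omega> in path \<theta>. h \<omega> \<le> k \<omega>"
  shows "mean h \<le> mean k"
  unfolding mean_def
  using prior_in by (intro nn_integral_mono_AE, eventually_elim) (intro nn_integral_mono_AE assms)

lemma mean_cong: "(\<And>\<omega>. \<omega> \<in> space (\<Pi>\<^sub>M i\<in>UNIV. \<mu>) \<Longrightarrow> h \<omega> = k \<omega>) \<Longrightarrow> mean h = mean k"
  unfolding mean_def by (intro nn_integral_cong) (simp add: space_PiM_P)

lemma mean_one: "mean (\<lambda>\<omega>. 1) = 1"
proof -
  have "(\<integral>\<^sup>+ \<omega>. 1 \<partial>path \<theta>) = 1" if "\<theta> \<in> space \<pi>" for \<theta>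
    using prob_space.emeasure_space_1[OF prob_space_PiM[of UNIV "\<lambda>_. P \<theta>", OF distributions]] that
    by (simp add: space_\<pi>)
  then have "mean (\<lambda>\<omega>. 1) = (\<integral>\<^sup>+ \<theta>. 1 \<partial>\<pi>)" unfolding mean_def by (intro nn_integral_cong)
  then show ?thesis by (simp add: \<pi>.emeasure_space_1)
qed

text \<open>
  Optional stopping at bounded times, by induction over the horizon: from \<open>t\<close> to \<open>t + 1\<close> the stopped
  ratio changes only on the event that the process still runs, and this event belongs to the past.
\<close>

lemma mean_stopped_ratio_le_one:
  assumes E': "test_supermartingale \<mu> P \<Theta>\<^sub>0 E'" and \<tau>: "stopping_time (obs_filtration \<mu>) \<tau>"
  shows "mean (\<lambda>\<omega>. stopped E' \<tau> t \<omega> / stopped E \<tau> t \<omega>) \<le> 1"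
proof -
  define R where "R t xs = E' t xs / E t xs" for t xs
  note [measurable] = test_supermartingale_measurable[OF E']
  have R[measurable]: "R t \<in> borel_measurable (past t)" for t unfolding R_def by measurable
  have eq: "(\<lambda>\<omega>. stopped E' \<tau> t \<omega> / stopped E \<tau> t \<omega>) = stopped R \<tau> t" for t
    by (simp add: stopped_def R_def Let_def fun_eq_iff)
  have "mean (stopped R \<tau> t) \<le> 1"
  proof (induction t)
    case 0
    have "R 0 xs \<le> 1" if xs: "xs \<in> space (past 0)" for xs
    proof -
      have "prob_space (W\<^sub>0 0 xs)" "AE \<theta> in W\<^sub>0 0 xs. \<theta> \<in> \<Theta>\<^sub>0"
        using W\<^sub>0_prior[OF xs] by (auto simp: priors_def)
      then have "\<Theta>\<^sub>0 \<noteq> {}" using prob_space.AE_False by fastforce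
      then obtain \<theta> where \<theta>: "\<theta> \<in> \<Theta>\<^sub>0" by blast
      have "(\<integral>\<^sup>+ xs. E' 0 xs \<partial>(\<Pi>\<^sub>M i\<in>{..<0::nat}. P \<theta>)) \<le> 1"
        using E' \<theta> unfolding test_supermartingale_def e_variable_def by blast
      moreover have "xs = (\<lambda>_. undefined)" using xs by (simp add: space_PiM)
      moreover have "product_sigma_finite (\<lambda>_::nat. P \<theta>)"
        using \<theta> \<Theta>_space distributions by (simp add: product_sigma_finite_def prob_space_imp_sigma_finite)
      ultimately show ?thesis by (simp add: R_def E_0 product_sigma_finite.nn_integral_empty divide_ennreal_def)
    qed
    then have "mean (stopped R \<tau> 0) \<le> mean (\<lambda>\<omega>. 1)"
      unfolding stopped_0[abs_def] mean_def
      using measurable_space[OF measurable_first_obs[of 0 \<mu>]] by (intro nn_integral_mono) (simp add: space_PiM_P)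
    then show ?case by (simp add: mean_one)
  next
    case (Suc t)
    have pred: "Measurable.pred (filtration t) (\<lambda>\<omega>. \<tau> \<omega> \<le> enat t)"
      using \<tau> by (auto simp: stopping_time_def)
    then have "{\<omega> \<in> space (filtration t). \<not> \<tau> \<omega> \<le> enat t} \<in> sets (filtration t)" by measurable
    then obtain B where B[measurable]: "B \<in> sets (past t)"
      and run: "{\<omega> \<in> space (filtration t). \<not> \<tau> \<omega> \<le> enat t} = first_obs t -` B \<inter> space (\<Pi>\<^sub>M i\<in>UNIV. \<mu>)"
      by (auto simp: sets_obs_filtration)
    have ind: "indicator B (first_obs t \<omega>) = (if \<tau> \<omega> \<le> enat t then 0 else 1 :: ennreal)"
      if "\<omega> \<in> space (\<Pi>\<^sub>M i\<in>UNIV. \<mu>)" for \<omega>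
    proof -
      have "first_obs t \<omega> \<in> B \<longleftrightarrow> \<omega> \<in> first_obs t -` B \<inter> space (\<Pi>\<^sub>M i\<in>UNIV. \<mu>)" using that by simp
      also have "\<dots> \<longleftrightarrow> \<not> \<tau> \<omega> \<le> enat t" unfolding run[symmetric] using that by (simp add: space_obs_filtration)
      finally show ?thesis by (simp add: indicator_def)
    qed
    (* The part of the ratio that is already final at time t. *)
    define h where "h \<omega> = (if \<tau> \<omega> \<le> enat t then stopped R \<tau> t \<omega> else 0)" for \<omega>
    have h: "h \<in> borel_measurable (filtration t)"
      unfolding h_def using pred stopped_measurable[OF \<tau> R, of t]
      by (intro measurable_If) (auto simp: pred_def)
    have h': "h \<in> borel_measurable (filtration (Suc t))"
      by (rule measurable_from_subalg[OF subalgebra_obs_filtration_mono h]) simp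
    have k: "(\<lambda>\<omega>. R t (first_obs t \<omega>) * indicator B (first_obs t \<omega>)) \<in> borel_measurable (filtration t)"
      using measurable_first_obs_filtration[of t \<mu>] by measurable
    note [measurable] = measurable_first_obs_le[of t "Suc t" \<mu>, simplified]
    have k': "(\<lambda>\<omega>. R (Suc t) (first_obs (Suc t) \<omega>) * indicator B (first_obs t (first_obs (Suc t) \<omega>))) \<in> borel_measurable (filtration (Suc t))"
      using measurable_first_obs_filtration[of "Suc t" \<mu>] by measurable
    have "mean (stopped R \<tau> (Suc t)) = mean (\<lambda>\<omega>. h \<omega> + R (Suc t) (first_obs (Suc t) \<omega>) * indicator B (first_obs t (first_obs (Suc t) \<omega>)))"
      by (intro mean_cong) (simp add: stopped_Suc h_def first_obs_first_obs ind)
    also have "\<dots> = mean h + mean (\<lambda>\<omega>. R (Suc t) (first_obs (Suc t) \<omega>) * indicator B (first_obs t (first_obs (Suc t) \<omega>)))"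
      by (rule mean_add[OF h' k'])
    also have "mean (\<lambda>\<omega>. R (Suc t) (first_obs (Suc t) \<omega>) * indicator B (first_obs t (first_obs (Suc t) \<omega>)))
        = (\<integral>\<^sup>+ xs. R (Suc t) xs * indicator B (first_obs t xs) * evidence (Suc t) xs \<partial>past (Suc t))"
      by (rule mean_first_obs) measurable
    also have "\<dots> \<le> (\<integral>\<^sup>+ xs. R t xs * indicator B xs * evidence t xs \<partial>past t)"
      unfolding R_def by (rule ratio_supermartingale[OF E' B])
    also have "\<dots> = mean (\<lambda>\<omega>. R t (first_obs t \<omega>) * indicator B (first_obs t \<omega>))"
      by (rule mean_first_obs[symmetric]) measurable
    also have "mean h + \<dots> = mean (\<lambda>\<omega>. h \<omega> + R t (first_obs t \<omega>) * indicator B (first_obs t \<omega>))"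
      by (rule mean_add[OF h k, symmetric])
    also have "\<dots> = mean (stopped R \<tau> t)"
      by (intro mean_cong) (auto simp: h_def ind stopped_running)
    also note Suc
    finally show ?case by (simp add: add_left_mono)
  qed
  then show ?thesis by (simp add: eq)
qed

section \<open>Comparison of growth\<close>

lemma stopped_E_pos_finite:
  assumes \<theta>: "\<theta> \<in> \<Theta>\<^sub>1"
  shows "AE \<omega> in path \<theta>. 0 < stopped E \<tau> t \<omega> \<and> stopped E \<tau> t \<omega> < \<infinity>"
proof -
  have \<theta>': "\<theta> \<in> \<Theta>\<^sub>0 \<union> \<Theta>\<^sub>1" using \<theta> by blast
  have "AE \<omega> in path \<theta>. 0 < E n (first_obs n \<omega>) \<and> E n (first_obs n \<omega>) < \<infinity>" for n
  proof -
    have "AE xs in distr (path \<theta>) (\<Pi>\<^sub>M i\<in>{..<n}. P \<theta>) (first_obs n). 0 < E n xs \<and> E n xs < \<infinity>"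
      unfolding distr_first_obs[OF distributions[OF \<Theta>_space[OF \<theta>']]] AE_past_P[OF \<theta>'] by (rule E_pos_finite)
    then show ?thesis by (rule AE_distrD[OF measurable_first_obs])
  qed
  then have "AE \<omega> in path \<theta>. \<forall>n. 0 < E n (first_obs n \<omega>) \<and> E n (first_obs n \<omega>) < \<infinity>"
    by (simp add: AE_all_countable)
  then show ?thesis by eventually_elim (simp add: stopped_def Let_def)
qed

text \<open>
  Almost every parameter lies in \<open>\<Theta>\<^sub>1\<close>, so the indicator in the growth can be dropped.
\<close>

lemma growth_eq:
  "growth P \<Theta>\<^sub>1 t E' \<pi> \<tau> = eexpect \<pi> (\<lambda>\<theta>. enn2ereal (\<integral>\<^sup>+ \<omega>. e2ennreal (elog (stopped E' \<tau> t \<omega>)) \<partial>path \<theta>)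
      - enn2ereal (\<integral>\<^sup>+ \<omega>. e2ennreal (- elog (stopped E' \<tau> t \<omega>)) \<partial>path \<theta>))"
  unfolding growth_def
  by (rule eexpect_cong_AE, use prior_in in eventually_elim) (simp add: eexpect_def)

text \<open>
  The constant process makes the bounds on \<open>E' / E\<close> into bounds on \<open>1 / E\<close>.
\<close>

lemma test_supermartingale_one: "test_supermartingale \<mu> P \<Theta>\<^sub>0 (\<lambda>t xs. 1)"
  unfolding test_supermartingale_def e_variable_def
proof (intro conjI allI ballI)
  fix t \<theta> assume "\<theta> \<in> \<Theta>\<^sub>0"
  then have "\<theta> \<in> space T" using \<Theta>_space by blast
  note P = distributions[OF this]
  show "AE \<omega> in path \<theta>. nn_cond_exp (path \<theta>) (filtration t) (\<lambda>\<omega>'. 1) \<omega> \<le> 1"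
  proof (rule supermartingale_step_iff[OF P, of \<mu> "\<lambda>_. 1" t "\<lambda>_. 1", THEN iffD2])
    have "(\<integral>\<^sup>+ x. 1 \<partial>P \<theta>) = 1" using prob_space.emeasure_space_1[OF P] by simp
    then show "AE xs in (\<Pi>\<^sub>M i\<in>{..<t}. P \<theta>). (\<integral>\<^sup>+ x. 1 \<partial>P \<theta>) \<le> 1" by simp
  qed simp_all
next
  fix t Q assume "Q \<in> (\<lambda>\<theta>. \<Pi>\<^sub>M i\<in>{..<t}. P \<theta>) ` \<Theta>\<^sub>0"
  then obtain \<theta> where "\<theta> \<in> space T" "Q = (\<Pi>\<^sub>M i\<in>{..<t}. P \<theta>)" using \<Theta>_space by blast
  then have "prob_space Q" by (auto intro: prob_space_PiM distributions)
  then show "(\<integral>\<^sup>+ x. 1 \<partial>Q) \<le> 1" by (simp add: prob_space.emeasure_space_1)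
qed simp

lemma growth_le:
  assumes E': "test_supermartingale \<mu> P \<Theta>\<^sub>0 E'" and \<tau>: "stopping_time (obs_filtration \<mu>) \<tau>"
  shows "growth P \<Theta>\<^sub>1 t E' \<pi> \<tau> \<le> growth P \<Theta>\<^sub>1 t E \<pi> \<tau>"
proof -
  define y where "y = stopped E' \<tau> t"
  define z where "z = stopped E \<tau> t"
  have y[measurable]: "y \<in> borel_measurable (filtration t)"
    unfolding y_def by (rule stopped_measurable[OF \<tau> test_supermartingale_measurable[OF E']])
  have z[measurable]: "z \<in> borel_measurable (filtration t)"
    unfolding z_def by (rule stopped_measurable[OF \<tau> E_measurable])
  have zpf: "AE \<omega> in path \<theta>. 0 < z \<omega> \<and> z \<omega> < \<infinity>" if "\<theta> \<in> \<Theta>\<^sub>1" for \<theta>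
    unfolding z_def by (rule stopped_E_pos_finite[OF that])
  define yp yn zp zn where "yp = (\<lambda>\<omega>. e2ennreal (elog (y \<omega>)))" and "yn = (\<lambda>\<omega>. e2ennreal (- elog (y \<omega>)))"
    and "zp = (\<lambda>\<omega>. e2ennreal (elog (z \<omega>)))" and "zn = (\<lambda>\<omega>. e2ennreal (- elog (z \<omega>)))"
  have m[measurable]: "yp \<in> borel_measurable (filtration t)" "yn \<in> borel_measurable (filtration t)"
    "zp \<in> borel_measurable (filtration t)" "zn \<in> borel_measurable (filtration t)"
    unfolding yp_def yn_def zp_def zn_def by measurable
  note pm = m[THEN path_integral_measurable]
  have ratio: "mean (\<lambda>\<omega>. y \<omega> / z \<omega>) \<le> 1"
    unfolding y_def z_def by (rule mean_stopped_ratio_le_one[OF E' \<tau>])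
  (* The negative part of ln z is at most 1 / z, whose mean is at most 1. *)
  have "mean (\<lambda>\<omega>. 1 / z \<omega>) \<le> 1"
    using mean_stopped_ratio_le_one[OF test_supermartingale_one \<tau>, of t] by (simp add: z_def stopped_def[of "\<lambda>t xs. 1"])
  moreover have "mean zn \<le> mean (\<lambda>\<omega>. 1 / z \<omega>)"
  proof (rule mean_mono_AE)
    fix \<theta> assume "\<theta> \<in> \<Theta>\<^sub>1"
    from zpf[OF this] show "AE \<omega> in path \<theta>. zn \<omega> \<le> 1 / z \<omega>"
      unfolding zn_def by eventually_elim (rule elog_ratio_bounds, auto)
  qed
  ultimately have zn: "mean zn < \<infinity>" by (auto intro: le_less_trans order_trans)
  have gy: "growth P \<Theta>\<^sub>1 t E' \<pi> \<tau> = eexpect \<pi> (\<lambda>\<theta>. enn2ereal (\<integral>\<^sup>+ \<omega>. yp \<omega> \<partial>path \<theta>) - enn2ereal (\<integral>\<^sup>+ \<omega>. yn \<omega> \<partial>path \<theta>))"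
    unfolding growth_eq yp_def yn_def y_def ..
  have gz: "growth P \<Theta>\<^sub>1 t E \<pi> \<tau> = eexpect \<pi> (\<lambda>\<theta>. enn2ereal (\<integral>\<^sup>+ \<omega>. zp \<omega> \<partial>path \<theta>) - enn2ereal (\<integral>\<^sup>+ \<omega>. zn \<omega> \<partial>path \<theta>))"
    unfolding growth_eq zp_def zn_def z_def ..
  show ?thesis
  proof (cases "mean zp = \<infinity>")
    case True
    then have "growth P \<Theta>\<^sub>1 t E \<pi> \<tau> = \<infinity>"
      unfolding gz using zn by (intro eexpect_difference_infinite pm) (auto simp: mean_def)
    then show ?thesis by simp
  next
    case False
    then have zp: "mean zp < \<infinity>" by (simp add: less_top)
    have "mean yp \<le> mean (\<lambda>\<omega>. zp \<omega> + y \<omega> / z \<omega>)"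
    proof (rule mean_mono_AE)
      fix \<theta> assume "\<theta> \<in> \<Theta>\<^sub>1"
      from zpf[OF this] show "AE \<omega> in path \<theta>. yp \<omega> \<le> zp \<omega> + y \<omega> / z \<omega>"
        unfolding yp_def zp_def by eventually_elim (rule elog_ratio_bounds, auto)
    qed
    also have "\<dots> = mean zp + mean (\<lambda>\<omega>. y \<omega> / z \<omega>)"
      by (rule mean_add[where t=t]) measurable
    also have "\<dots> \<le> mean zp + 1" using ratio by (rule add_left_mono)
    finally have yp: "mean yp < \<infinity>" using zp by (auto simp: less_top[symmetric] top_unique)
    (* The integrated form of ln (y / z) + 1 \<le> y / z, where the mean of the ratio y / z on the right
       compensates the 1 on the left. *)
    have "mean yp + mean zn + 1 = mean (\<lambda>\<omega>. yp \<omega> + zn \<omega>) + mean (\<lambda>\<omega>. 1)"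
      using mean_add[OF m(1) m(4)] by (simp add: mean_one)
    also have "\<dots> = mean (\<lambda>\<omega>. yp \<omega> + zn \<omega> + 1)"
      by (rule mean_add[where t=t, symmetric]) measurable
    also have "\<dots> \<le> mean (\<lambda>\<omega>. zp \<omega> + yn \<omega> + y \<omega> / z \<omega>)"
    proof (rule mean_mono_AE)
      fix \<theta> assume "\<theta> \<in> \<Theta>\<^sub>1"
      from zpf[OF this] show "AE \<omega> in path \<theta>. yp \<omega> + zn \<omega> + 1 \<le> zp \<omega> + yn \<omega> + y \<omega> / z \<omega>"
        unfolding yp_def zp_def yn_def zn_def by eventually_elim (rule elog_ratio_bounds, auto)
    qed
    also have "\<dots> = mean (\<lambda>\<omega>. zp \<omega> + yn \<omega>) + mean (\<lambda>\<omega>. y \<omega> / z \<omega>)"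
      by (rule mean_add[where t=t]) measurable
    also have "mean (\<lambda>\<omega>. zp \<omega> + yn \<omega>) = mean zp + mean yn"
      by (rule mean_add[OF m(3) m(2)])
    also have "mean zp + mean yn + mean (\<lambda>\<omega>. y \<omega> / z \<omega>) \<le> mean zp + mean yn + 1" using ratio by (rule add_left_mono)
    finally have "mean yp + mean zn \<le> mean zp + mean yn" by (simp add: ennreal_add_left_cancel_le add.commute[of _ 1])
    then show ?thesis
      unfolding gy gz using zn zp yp
      by (subst (1 2) eexpect_difference) (auto simp: mean_def[symmetric] intro!: pm enn2ereal_diff_le_iff)
  qed
qed

end

theorem theorem2:
  fixes \<mu> :: "'x measure" and T :: "'p measure" and p :: "'p \<Rightarrow> 'x \<Rightarrow> real"
    and P :: "'p \<Rightarrow> 'x measure"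
    and \<Theta>\<^sub>0 \<Theta>\<^sub>1 :: "'p set" and \<pi> :: "'p measure"
    and W\<^sub>1 W\<^sub>0 :: "nat \<Rightarrow> (nat \<Rightarrow> 'x) \<Rightarrow> 'p measure"
    and E :: "nat \<Rightarrow> (nat \<Rightarrow> 'x) \<Rightarrow> ennreal"
  defines "P \<equiv> \<lambda>\<theta>. density \<mu> (\<lambda>x. ennreal (p \<theta> x))"
    and "W\<^sub>1 \<equiv> posterior p \<pi>"
    and "E \<equiv> \<lambda>t xs. \<Prod>i<t. mix_density p (W\<^sub>1 i (first_obs i xs)) (xs i) /
                          mix_density p (W\<^sub>0 i (first_obs i xs)) (xs i)"
  assumes reference: "sigma_finite_measure \<mu>"
    and density_measurable: "(\<lambda>(\<theta>, x). p \<theta> x) \<in> borel_measurable (T \<Otimes>\<^sub>M \<mu>)"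
    and density_nonneg: "\<And>\<theta> x. \<theta> \<in> space T \<Longrightarrow> x \<in> space \<mu> \<Longrightarrow> 0 \<le> p \<theta> x"
    and distributions: "\<And>\<theta>. \<theta> \<in> space T \<Longrightarrow> prob_space (P \<theta>)"
    and hypotheses: "\<Theta>\<^sub>0 \<in> sets T" "\<Theta>\<^sub>1 \<in> sets T"
    and prior: "\<pi> \<in> priors T \<Theta>\<^sub>1"
    and full_support: "\<And>t xs x. xs \<in> space (\<Pi>\<^sub>M i\<in>{..<t}. \<mu>) \<Longrightarrow> x \<in> space \<mu> \<Longrightarrow>
          0 < mix_density p (W\<^sub>1 t xs) x"
    and finite_inf: "\<And>t xs. xs \<in> space (\<Pi>\<^sub>M i\<in>{..<t}. \<mu>) \<Longrightarrow>
          (INF W\<in>priors T \<Theta>\<^sub>0. KL (mixture \<mu> p (W\<^sub>1 t xs)) (mixture \<mu> p W)) < \<infinity>"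
    and projection: "\<And>t xs. xs \<in> space (\<Pi>\<^sub>M i\<in>{..<t}. \<mu>) \<Longrightarrow>
          is_arg_min (\<lambda>W. KL (mixture \<mu> p (W\<^sub>1 t xs)) (mixture \<mu> p W))
            (\<lambda>W. W \<in> priors T \<Theta>\<^sub>0) (W\<^sub>0 t xs)"
    and projection_measurable: "\<And>t. (\<lambda>(xs, x). mix_density p (W\<^sub>0 t xs) x)
          \<in> borel_measurable ((\<Pi>\<^sub>M i\<in>{..<t}. \<mu>) \<Otimes>\<^sub>M \<mu>)"
    and KL_finite: "\<And>\<theta> \<theta>'. \<theta> \<in> \<Theta>\<^sub>0 \<union> \<Theta>\<^sub>1 \<Longrightarrow> \<theta>' \<in> \<Theta>\<^sub>0 \<union> \<Theta>\<^sub>1 \<Longrightarrow> KL (P \<theta>) (P \<theta>') < \<infinity>"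
  shows "posterior_optimal_e_value \<mu> P \<Theta>\<^sub>0 \<Theta>\<^sub>1 \<pi> E"
proof -
  interpret poe: poe_setting \<mu> T p \<Theta>\<^sub>0 \<Theta>\<^sub>1 \<pi> W\<^sub>0
    using assms(4-) unfolding P_def W\<^sub>1_def by (rule poe_setting.intro)
  have "E = poe.E"
    by (simp add: E_def W\<^sub>1_def poe.E_def poe.predictive_def poe.projected_def fun_eq_iff)
  then show ?thesis
    unfolding posterior_optimal_e_value_def P_def
    using poe.test_supermartingale_E poe.growth_le by simp
qed

end
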